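(* Let $\Omega\subset\mathbb{C}$ be a bounded $n$-connected domain with $C^{\infty}$-smooth boundary such that no boundary curve is an isolated point, let $\varphi$ be a positive real-valued $C^{\infty}$-smooth function on $\partial\Omega$, and let $a\in\Omega$. Let $$F(z)=\frac{S_\varphi(z,a)}{L_\varphi(z,a)}$$ be the weighted Ahlfors map. Then $\lim_{z\to z_0}|F(z)|$ exists for all $z_0\in\partial\Omega$, and $$\lim_{z\to z_0}|F(z)|=\frac{1}{\varphi(z_0)},\qquad z_0\in\partial\Omega.$$
   Context: $ds$ is arc length on $\partial\Omega$ and $T(z)$ is the complex unit tangent vector at $z\in\partial\Omega$ in the positive orientation, so $dz=T\,ds$. $A^\infty(\Omega)$ is the space of holomorphic functions on $\Omega$ that are $C^\infty$ on $\overline\Omega$; $H^2(\partial\Omega)$ is the closure in $L^2(\partial\Omega)$ of the boundary values of functions in $A^\infty(\Omega)$. For $a\in\Omega$, the weighted Szegő kernel $S_\varphi(\cdot,a)$ is the unique element of $H^2(\partial\Omega)$ with $h(a)=\int_{\partial\Omega}h\,\overline{S_\varphi(\cdot,a)}\,\varphi\,ds$ for all $h\in H^2(\partial\Omega)$; it belongs to $A^\infty(\Omega)$. Let $C_a(z)=\overline{\frac{1}{2\pi i}\frac{T(z)}{z-a}}$, $z\in\partial\Omega$. There is a unique $H_a\in A^\infty(\Omega)$ with $\varphi^{-1}C_a=S_\varphi(\cdot,a)+\varphi^{-1}\overline{H_aT}$ on $\partial\Omega$, and the weighted Garabedian kernel is $L_\varphi(z,a)=\frac{1}{2\pi}\frac{1}{z-a}-iH_a(z)$.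 They satisfy $\overline{S_\varphi(z,a)}=\frac{1}{i\varphi(z)}L_\varphi(z,a)T(z)$ for $z\in\partial\Omega$. $F$ is regarded as a meromorphic function on $\Omega$, and the limits are taken with $z\in\Omega$. *)

theory Defs
  imports "HOL-Complex_Analysis.Complex_Analysis"
begin

definition smooth_curve_fun :: "(real \<Rightarrow> 'a::real_normed_vector) \<Rightarrow> bool" where
  "smooth_curve_fun f \<longleftrightarrow>
     (\<exists>D. D 0 = f \<and> (\<forall>k t. (D k has_vector_derivative D (Suc k) t) (at t)))"

text \<open>For a bounded set the components of the complement in the plane correspond bijectively to
  those in the Riemann sphere, so that the connectivity can be read off in the plane.\<close>

definition n_connected_domain :: "nat \<Rightarrow> complex set \<Rightarrow> bool" where
  "n_connected_domain n \<Omega> \<longleftrightarrow>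
     open \<Omega> \<and> connected \<Omega> \<and> \<Omega> \<noteq> {} \<and>
     finite (components (- \<Omega>)) \<and> card (components (- \<Omega>)) = n"

text \<open>The family \<open>\<gamma> 0, \<dots>, \<gamma> (n - 1)\<close> consists of 1-periodic regular parametrizations of the
  boundary curves.  The last conjunct is the positive orientation: the normal \<open>\<i> \<gamma>'\<close> points
  into the domain, which thus lies to the left of each curve.\<close>

definition smooth_boundary_param :: "complex set \<Rightarrow> nat \<Rightarrow> (nat \<Rightarrow> real \<Rightarrow> complex) \<Rightarrow> bool" where
  "smooth_boundary_param \<Omega> n \<gamma> \<longleftrightarrow>
     (\<forall>i<n. smooth_curve_fun (\<gamma> i) \<and> (\<forall>t. \<gamma> i (t + 1) = \<gamma> i t) \<and> inj_on (\<gamma> i) {0..<1} \<and>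
            (\<forall>t. vector_derivative (\<gamma> i) (at t) \<noteq> 0)) \<and>
     (\<forall>i<n. \<forall>j<n. i \<noteq> j \<longrightarrow> range (\<gamma> i) \<inter> range (\<gamma> j) = {}) \<and>
     frontier \<Omega> = (\<Union>i<n. range (\<gamma> i)) \<and>
     (\<forall>i<n. \<forall>t. \<exists>\<epsilon>>0. \<forall>s\<in>{0<..<\<epsilon>}.
        \<gamma> i t + of_real s * (\<i> * vector_derivative (\<gamma> i) (at t)) \<in> \<Omega>)"

definition smooth_on_boundary :: "nat \<Rightarrow> (nat \<Rightarrow> real \<Rightarrow> complex) \<Rightarrow> (complex \<Rightarrow> real) \<Rightarrow> bool" where
  "smooth_on_boundary n \<gamma> f \<longleftrightarrow> (\<forall>i<n. smooth_curve_fun (\<lambda>t. f (\<gamma> i t)))"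

definition unit_tangent :: "nat \<Rightarrow> (nat \<Rightarrow> real \<Rightarrow> complex) \<Rightarrow> complex \<Rightarrow> complex" where
  "unit_tangent n \<gamma> z =
     (THE T. \<exists>i<n. \<exists>t. \<gamma> i t = z \<and> T = sgn (vector_derivative (\<gamma> i) (at t)))"

text \<open>Arc length as a measure whose space is the boundary itself, so that the behaviour
  of functions off the boundary is irrelevant for measurability and integration.\<close>

definition arc_length :: "nat \<Rightarrow> (nat \<Rightarrow> real \<Rightarrow> complex) \<Rightarrow> complex measure" where
  "arc_length n \<gamma> =
     distr
       (density (count_space {..<n} \<Otimes>\<^sub>M lborel)
          (\<lambda>(i, t). indicator {0..<1} t * ennreal (norm (vector_derivative (\<gamma> i) (at t)))))
       (restrict_space borel (\<Union>i<n. range (\<gamma> i)))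
       (\<lambda>(i, t). \<gamma> i t)"

text \<open>Functions are total; only their values on the closure of the domain matter.  As all real
  partial derivatives of a holomorphic function are constant multiples of its complex derivatives,
  smoothness up to the boundary means that all the latter extend continuously to the closure.\<close>

definition A_infty :: "complex set \<Rightarrow> (complex \<Rightarrow> complex) set" where
  "A_infty \<Omega> =
     {f. f holomorphic_on \<Omega> \<and> continuous_on (closure \<Omega>) f \<and>
         (\<forall>k. \<exists>g. continuous_on (closure \<Omega>) g \<and> (\<forall>z\<in>\<Omega>. g z = (deriv ^^ k) f z))}"

definition L2_functions :: "complex measure \<Rightarrow> (complex \<Rightarrow> complex) set" where
  "L2_functions M = {h \<in> borel_measurable M. integrable M (\<lambda>z. (norm (h z))\<^sup>2)}"

text \<open>The Hardy space, given by representatives of its almost-everywhere classes.\<close>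

definition hardy2 :: "complex set \<Rightarrow> nat \<Rightarrow> (nat \<Rightarrow> real \<Rightarrow> complex) \<Rightarrow> (complex \<Rightarrow> complex) set" where
  "hardy2 \<Omega> n \<gamma> =
     {h \<in> L2_functions (arc_length n \<gamma>).
        \<forall>\<epsilon>>0. \<exists>g\<in>A_infty \<Omega>. (LINT z|arc_length n \<gamma>. (norm (h z - g z))\<^sup>2) < \<epsilon>}"

text \<open>The value at an interior point of an element of the Hardy space, which a priori is only a
  function on the boundary, is given by the Cauchy integral.\<close>

definition hardy_value ::
    "nat \<Rightarrow> (nat \<Rightarrow> real \<Rightarrow> complex) \<Rightarrow> (complex \<Rightarrow> complex) \<Rightarrow> complex \<Rightarrow> complex" where
  "hardy_value n \<gamma> h a =
     (LINT z|arc_length n \<gamma>. h z * unit_tangent n \<gamma> z / (z - a)) / (2 * pi * \<i>)"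

text \<open>\<open>S\<close> is the weighted Szego kernel with second argument \<open>a\<close>.  The kernel is known to be in
  \<open>A_infty \<Omega>\<close>, which is what makes it a function on the closure of the domain; it is unique there.\<close>

definition is_weighted_szego ::
    "complex set \<Rightarrow> nat \<Rightarrow> (nat \<Rightarrow> real \<Rightarrow> complex) \<Rightarrow> (complex \<Rightarrow> real) \<Rightarrow> complex \<Rightarrow>
     (complex \<Rightarrow> complex) \<Rightarrow> bool" where
  "is_weighted_szego \<Omega> n \<gamma> \<phi> a S \<longleftrightarrow>
     S \<in> A_infty \<Omega> \<and> S \<in> hardy2 \<Omega> n \<gamma> \<and>
     (\<forall>h\<in>hardy2 \<Omega> n \<gamma>.
        hardy_value n \<gamma> h a = (LINT z|arc_length n \<gamma>. h z * cnj (S z) * of_real (\<phi> z)))"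

definition cauchy_fun :: "nat \<Rightarrow> (nat \<Rightarrow> real \<Rightarrow> complex) \<Rightarrow> complex \<Rightarrow> complex \<Rightarrow> complex" where
  "cauchy_fun n \<gamma> a z = cnj (1 / (2 * pi * \<i>) * (unit_tangent n \<gamma> z / (z - a)))"

definition is_weighted_garabedian ::
    "complex set \<Rightarrow> nat \<Rightarrow> (nat \<Rightarrow> real \<Rightarrow> complex) \<Rightarrow> (complex \<Rightarrow> real) \<Rightarrow> complex \<Rightarrow>
     (complex \<Rightarrow> complex) \<Rightarrow> (complex \<Rightarrow> complex) \<Rightarrow> bool" where
  "is_weighted_garabedian \<Omega> n \<gamma> \<phi> a S L \<longleftrightarrow>
     (\<exists>H\<in>A_infty \<Omega>.
        (\<forall>z\<in>frontier \<Omega>.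
           cauchy_fun n \<gamma> a z / of_real (\<phi> z) =
             S z + cnj (H z * unit_tangent n \<gamma> z) / of_real (\<phi> z)) \<and>
        (\<forall>z\<in>closure \<Omega> - {a}. L z = 1 / (2 * pi) * (1 / (z - a)) - \<i> * H z))"

text \<open>\<open>remove_sings\<close> makes this the meromorphic function: removable singularities of the pointwise
  quotient, at \<open>a\<close> and at common zeros, are filled in (poles get the value 0).\<close>

definition weighted_ahlfors :: "(complex \<Rightarrow> complex) \<Rightarrow> (complex \<Rightarrow> complex) \<Rightarrow> complex \<Rightarrow> complex" where
  "weighted_ahlfors S L = remove_sings (\<lambda>z. S z / L z)"

end

theory Submission
  imports Defs "HOL-Library.Landau_Symbols"
begin

text \<open>On the boundary the kernels satisfy \<open>\<phi> |S| = |L|\<close>, so the limit is clear at a boundary point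
  where \<open>S\<close> does not vanish.  The work is at common boundary zeros of \<open>S\<close> and \<open>L\<close>.  If both vanish there to
  finite order, then, being smooth up to the boundary, they have leading terms \<open>s w\<^sup>m\<close> and \<open>b w\<^sup>l\<close>;
  comparing moduli along the boundary gives \<open>m = l\<close> and \<open>\<phi> |s| = |b|\<close>, which is the claim.  The order is
  finite because the differential \<open>S L dz / i\<close> is real along the boundary: in coordinates straightening the
  boundary it solves a Cauchy--Riemann system with a perturbation that vanishes on the real axis, and
  Almgren's frequency function of a solution with real boundary values stays bounded at a
  boundary point, so that the solution decays at most polynomially.\<close>

subsection \<open>Boundedness of the frequency function\<close>

text \<open>Smoothness up to the boundary does not rule out zeros of infinite order: exp (-
  z^(-1/2)) is flat at 0 in the half-plane Re z > 0. As the boundary is merely smooth, Schwarz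
  reflection cannot exclude them either. What is special about the product of the kernels is its
  phase: the boundary relation \<phi> conj(S) = - i T L, multiplied by S, gives \<phi> |S|^2, which
  is real. The straightening map t + i s \<mapsto> c(t) + i s c'(t) is explicit, so its smoothness
  up to the axis is immediate, whereas for a conformal map it would be a theorem. It agrees with a
  holomorphic extension of c to first order in s, so the error in the principal part is O(s); as
  that error vanishes on the axis, so do the boundary terms of the frequency computation. The
  frequency argument also needs that the product does not vanish on a whole half circle. This is a
  global matter: it rests on the pole of L at a and on S not being identically zero, which follows
  from the maximum principle.\<close>

text \<open>In complex notation, \<open>q = u + \<i> v\<close> solves
  \<open>r q\<^sub>r = - \<i> a (1 + \<i> b) q\<^sub>\<theta> + (e + \<i> f)\<close> and is real for \<open>\<theta> = 0, \<pi>\<close>.  With the weight \<open>1 / a\<close>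
  the operator \<open>- \<i> a \<partial>\<^sub>\<theta>\<close> becomes symmetric on such functions.  Its Rayleigh quotient \<open>N = E / M\<close> satisfies
  \<open>N' \<ge> - K (|N| + 1)\<close>, so \<open>arsinh N + 2 K r\<close> is increasing and \<open>N\<close> is bounded above as \<open>r\<close> tends to \<open>0\<close>;
  finally \<open>r M' \<le> (2 N + O(r)) M\<close>.\<close>


lemma polar_frequency_growth:
  fixes u v u1 v1 u2 v2 u12 v12 a a1 b b2 e f :: "real \<Rightarrow> real \<Rightarrow> real" and R C :: real
  defines "I \<equiv> {0<..<R}" and "J \<equiv> {0..pi}"
  assumes R: "R > 0" and C: "C \<ge> 0"
    and du1: "\<And>r t. r \<in> I \<Longrightarrow> t \<in> J \<Longrightarrow> ((\<lambda>r. u r t) has_real_derivative u1 r t) (at r)"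
    and dv1: "\<And>r t. r \<in> I \<Longrightarrow> t \<in> J \<Longrightarrow> ((\<lambda>r. v r t) has_real_derivative v1 r t) (at r)"
    and du2: "\<And>r t. r \<in> I \<Longrightarrow> t \<in> J \<Longrightarrow> ((\<lambda>t. u r t) has_real_derivative u2 r t) (at t within J)"
    and dv2: "\<And>r t. r \<in> I \<Longrightarrow> t \<in> J \<Longrightarrow> ((\<lambda>t. v r t) has_real_derivative v2 r t) (at t within J)"
    and du12: "\<And>r t. r \<in> I \<Longrightarrow> t \<in> J \<Longrightarrow> ((\<lambda>t. u1 r t) has_real_derivative u12 r t) (at t within J)"
    and dv12: "\<And>r t. r \<in> I \<Longrightarrow> t \<in> J \<Longrightarrow> ((\<lambda>t. v1 r t) has_real_derivative v12 r t) (at t within J)"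
    and du21: "\<And>r t. r \<in> I \<Longrightarrow> t \<in> J \<Longrightarrow> ((\<lambda>r. u2 r t) has_real_derivative u12 r t) (at r)"
    and dv21: "\<And>r t. r \<in> I \<Longrightarrow> t \<in> J \<Longrightarrow> ((\<lambda>r. v2 r t) has_real_derivative v12 r t) (at r)"
    and da: "\<And>r t. r \<in> I \<Longrightarrow> t \<in> J \<Longrightarrow> ((\<lambda>r. a r t) has_real_derivative a1 r t) (at r)"
    and db: "\<And>r t. r \<in> I \<Longrightarrow> t \<in> J \<Longrightarrow> ((\<lambda>t. b r t) has_real_derivative b2 r t) (at t within J)"
    and cont: "continuous_on (I \<times> J) (\<lambda>(r,t). u r t)" "continuous_on (I \<times> J) (\<lambda>(r,t). v r t)"
      "continuous_on (I \<times> J) (\<lambda>(r,t). u1 r t)" "continuous_on (I \<times> J) (\<lambda>(r,t). v1 r t)"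
      "continuous_on (I \<times> J) (\<lambda>(r,t). u2 r t)" "continuous_on (I \<times> J) (\<lambda>(r,t). v2 r t)"
      "continuous_on (I \<times> J) (\<lambda>(r,t). u12 r t)" "continuous_on (I \<times> J) (\<lambda>(r,t). v12 r t)"
      "continuous_on (I \<times> J) (\<lambda>(r,t). a r t)" "continuous_on (I \<times> J) (\<lambda>(r,t). a1 r t)"
      "continuous_on (I \<times> J) (\<lambda>(r,t). b2 r t)"
    and v0: "\<And>r t. r \<in> I \<Longrightarrow> t = 0 \<or> t = pi \<Longrightarrow> v r t = 0"
    and b0: "\<And>r t. r \<in> I \<Longrightarrow> t = 0 \<or> t = pi \<Longrightarrow> b r t = 0"
    and a: "\<And>r t. r \<in> I \<Longrightarrow> t \<in> J \<Longrightarrow> 1/2 \<le> a r t \<and> a r t \<le> 2"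
    and a1: "\<And>r t. r \<in> I \<Longrightarrow> t \<in> J \<Longrightarrow> \<bar>a1 r t\<bar> \<le> C"
    and b2: "\<And>r t. r \<in> I \<Longrightarrow> t \<in> J \<Longrightarrow> \<bar>b2 r t\<bar> \<le> C * r"
    and eq1: "\<And>r t. r \<in> I \<Longrightarrow> t \<in> J \<Longrightarrow> r * u1 r t = a r t * (v2 r t + b r t * u2 r t) + e r t"
    and eq2: "\<And>r t. r \<in> I \<Longrightarrow> t \<in> J \<Longrightarrow> r * v1 r t = a r t * (- u2 r t + b r t * v2 r t) + f r t"
    and ef: "\<And>r t. r \<in> I \<Longrightarrow> t \<in> J \<Longrightarrow>
        (e r t)\<^sup>2 + (f r t)\<^sup>2 \<le> (C * r)\<^sup>2 * ((u r t)\<^sup>2 + (v r t)\<^sup>2)"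
    and nz: "\<And>r. r \<in> I \<Longrightarrow> \<exists>t\<in>J. u r t \<noteq> 0 \<or> v r t \<noteq> 0"
  shows "\<exists>c>0. \<exists>k::nat. \<forall>r\<in>{0<..R/2}. c * r ^ k \<le> integral J (\<lambda>t. (u r t)\<^sup>2 + (v r t)\<^sup>2)"
proof -
  have pi0: "0 \<in> J" "pi \<in> J" by (auto simp: J_def)
  have slice: "continuous_on J (g r)" if "continuous_on (I \<times> J) (\<lambda>(r,t). g r t)" "r \<in> I"
    for g :: "real \<Rightarrow> real \<Rightarrow> real" and r
  proof -
    have "continuous_on J ((\<lambda>(r,t). g r t) \<circ> (\<lambda>t. (r,t)))"
      by (rule continuous_on_compose) (auto intro!: continuous_intros continuous_on_subset[OF that(1)] that(2))
    then show ?thesis by (simp add: o_def)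
  qed
  note sl = cont[THEN slice]
  have cb: "continuous_on J (b r)" if "r \<in> I" for r
    using db[OF that] DERIV_continuous continuous_on_eq_continuous_within by blast
  have ap: "a r t > 0" "a r t \<noteq> 0" if "r \<in> I" "t \<in> J" for r t using a[OF that] by auto
  have int: "g integrable_on J" if "continuous_on J g" for g :: "real \<Rightarrow> real"
    using that unfolding J_def by (rule integrable_continuous_real)
  have v10: "v1 r t = 0" if "r \<in> I" "t = 0 \<or> t = pi" for r t
  proof -
    have "((\<lambda>r. v r t) has_real_derivative 0) (at r)"
      by (rule DERIV_cong_ev[THEN iffD1, OF refl _ refl, of "\<lambda>_. 0"])
         (use v0[OF _ that(2)] that(1) in \<open>auto intro!: eventually_nhds_in_open[of I] elim!: eventually_mono simp: I_def eventually_nhds\<close>)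
    with dv1[of r t] that pi0 show ?thesis using DERIV_unique by blast
  qed
  define m where "m = (\<lambda>r t. ((u r t)\<^sup>2 + (v r t)\<^sup>2) / a r t)"
  define m1 where "m1 = (\<lambda>r t. 2 * (u r t * u1 r t + v r t * v1 r t) / a r t
       - a1 r t / (a r t)\<^sup>2 * ((u r t)\<^sup>2 + (v r t)\<^sup>2))"
  \<comment> \<open>With q = u + i v this is Re (conj(q) (- i q_\<theta>)), so \<open>E\<close> is
    the quadratic form of - i a \<partial>_\<theta> in the weight 1 / a.\<close>
  define g where "g = (\<lambda>r t. v2 r t * u r t - u2 r t * v r t)"
  define g1 where "g1 = (\<lambda>r t. v12 r t * u r t + v2 r t * u1 r t - u12 r t * v r t - u2 r t * v1 r t)"
  define M where "M = (\<lambda>r. integral J (m r))"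
  define E where "E = (\<lambda>r. integral J (g r))"
  have cprod: "continuous_on (I \<times> J) (\<lambda>(r,t). m1 r t)" "continuous_on (I \<times> J) (\<lambda>(r,t). g1 r t)"
    unfolding m1_def g1_def using cont ap
    by (auto simp: case_prod_beta intro!: continuous_intros)
  have cm: "continuous_on J (m r)" "continuous_on J (g r)" if "r \<in> I" for r
    unfolding m_def g_def using sl[OF that] ap[OF that]
    by (auto intro!: continuous_intros)
  have dM: "(M has_real_derivative integral J (m1 r)) (at r)" if r: "r \<in> I" for r
  proof -
    have "((\<lambda>r. integral (cbox 0 pi) (m r)) has_field_derivative integral (cbox 0 pi) (m1 r)) (at r within I)"
    proof (rule leibniz_rule_field_derivative)
      fix x t :: real assume "x \<in> I" "t \<in> cbox 0 pi"
      then have x: "x \<in> I" "t \<in> J" by (auto simp: J_def)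
      show "((\<lambda>x. m x t) has_field_derivative m1 x t) (at x within I)"
        unfolding m_def m1_def
        by (rule derivative_eq_intros DERIV_subset[OF du1[OF x] subset_UNIV] DERIV_subset[OF dv1[OF x] subset_UNIV]
           DERIV_subset[OF da[OF x] subset_UNIV] refl ap[OF x])+
          (use ap[OF x] in \<open>simp add: field_simps power2_eq_square\<close>)
    qed (use cprod cm int r in \<open>auto simp: I_def J_def\<close>)
    then show ?thesis using at_within_open[of r I] r unfolding M_def J_def by (simp add: I_def)
  qed
  have dE: "(E has_real_derivative integral J (g1 r)) (at r)" if r: "r \<in> I" for r
  proof -
    have "((\<lambda>r. integral (cbox 0 pi) (g r)) has_field_derivative integral (cbox 0 pi) (g1 r)) (at r within I)"
    proof (rule leibniz_rule_field_derivative)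
      fix x t :: real assume "x \<in> I" "t \<in> cbox 0 pi"
      then have x: "x \<in> I" "t \<in> J" by (auto simp: J_def)
      show "((\<lambda>x. g x t) has_field_derivative g1 x t) (at x within I)"
        unfolding g_def g1_def
        by (rule derivative_eq_intros DERIV_subset[OF du1[OF x] subset_UNIV] DERIV_subset[OF dv1[OF x] subset_UNIV]
           DERIV_subset[OF du21[OF x] subset_UNIV] DERIV_subset[OF dv21[OF x] subset_UNIV] refl)+
          (simp add: algebra_simps)
    qed (use cprod cm int r in \<open>auto simp: I_def J_def\<close>)
    then show ?thesis using at_within_open[of r I] r unfolding E_def J_def by (simp add: I_def)
  qed
  have ftc: "(h' has_integral (h pi - h 0)) J"
    if "\<And>t. t \<in> J \<Longrightarrow> (h has_real_derivative h' t) (at t within J)" for h h' :: "real \<Rightarrow> real"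
    using that unfolding J_def
    by (intro fundamental_theorem_of_calculus) (auto simp: has_real_derivative_iff_has_vector_derivative)
  have Mpos: "M r > 0" if r: "r \<in> I" for r
  proof -
    have "m r t \<ge> 0" if "t \<in> J" for t using ap[OF r that] by (simp add: m_def)
    then have "M r \<ge> 0" unfolding M_def by (intro integral_nonneg int cm r) auto
    moreover have "M r \<noteq> 0"
    proof
      assume "M r = 0"
      then have "(m r has_integral 0) (cbox 0 pi)"
        using int[OF cm(1)[OF r]] unfolding M_def by (metis J_def cbox_interval integrable_integral)
      moreover obtain t where t: "t \<in> J" "u r t \<noteq> 0 \<or> v r t \<noteq> 0" using nz[OF r] by auto
      ultimately have "m r t = 0"
        using cm(1)[OF r] \<open>\<And>t. t \<in> J \<Longrightarrow> m r t \<ge> 0\<close> t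
        by (intro has_integral_0_cbox_imp_0[of 0 pi "m r"]) (auto simp: J_def not_le)
      with t ap[OF r t(1)] show False
        by (auto simp: m_def sum_power2_eq_zero_iff)
    qed
    ultimately show ?thesis by simp
  qed
  \<comment> \<open>The integrand is the \<theta>-derivative of b |q|^2, and b vanishes at both
    ends. Subtracting this zero trades the terms b q_\<theta>, for which there is no bound, for
    \<open>b2\<close> times |q|^2.\<close>
  have bI: "((\<lambda>t. 2 * b r t * (u r t * u2 r t + v r t * v2 r t) + b2 r t * ((u r t)\<^sup>2 + (v r t)\<^sup>2)) has_integral 0) J"
    if r: "r \<in> I" for r
  proof -
    have "((\<lambda>t. 2 * b r t * (u r t * u2 r t + v r t * v2 r t) + b2 r t * ((u r t)\<^sup>2 + (v r t)\<^sup>2)) has_integral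
       (b r pi * ((u r pi)\<^sup>2 + (v r pi)\<^sup>2) - b r 0 * ((u r 0)\<^sup>2 + (v r 0)\<^sup>2))) J"
      by (rule ftc, (rule derivative_eq_intros db[OF r] du2[OF r] dv2[OF r] refl | assumption)+) (simp add: algebra_simps)
    then show ?thesis using b0[OF r] by simp
  qed
  \<comment> \<open>The integrand is the \<theta>-derivative of u v_r - v u_r, which vanishes at
    both ends along with v and v_r. This is the symmetry of the operator; it removes the mixed
    derivatives from the integral of \<open>g1\<close>.\<close>
  have gI: "((\<lambda>t. u2 r t * v1 r t + u r t * v12 r t - v2 r t * u1 r t - v r t * u12 r t) has_integral 0) J"
    if r: "r \<in> I" for r
  proof -
    have "((\<lambda>t. u2 r t * v1 r t + u r t * v12 r t - v2 r t * u1 r t - v r t * u12 r t) has_integral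
       ((u r pi * v1 r pi - v r pi * u1 r pi) - (u r 0 * v1 r 0 - v r 0 * u1 r 0))) J"
      by (rule ftc, (rule derivative_eq_intros du12[OF r] dv12[OF r] du2[OF r] dv2[OF r] refl | assumption)+) (simp add: algebra_simps)
    then show ?thesis using v0[OF r] v10[OF r] by simp
  qed
  have hasM: "(m r has_integral M r) J" "(g r has_integral E r) J"
     "(m1 r has_integral integral J (m1 r)) J" "(g1 r has_integral integral J (g1 r)) J" if r: "r \<in> I" for r
    using int[OF cm(1)[OF r]] int[OF cm(2)[OF r]] int[OF slice[OF cprod(1) r]] int[OF slice[OF cprod(2) r]]
    unfolding M_def E_def by (auto intro: integrable_integral)
  have a2: "a1 r t / (a r t)\<^sup>2 \<le> 4 * C \<and> - (4 * C) \<le> a1 r t / (a r t)\<^sup>2" if r: "r \<in> I" "t \<in> J" for r t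
  proof -
    have "(1/2)\<^sup>2 \<le> (a r t)\<^sup>2" using a[OF r] by (intro power_mono) auto
    then have "\<bar>a1 r t\<bar> / (a r t)\<^sup>2 \<le> C / (1/2)\<^sup>2" using a1[OF r] C by (intro frac_le) auto
    then have "\<bar>a1 r t / (a r t)\<^sup>2\<bar> \<le> 4 * C" by (simp add: power2_eq_square)
    then show ?thesis by linarith
  qed
  have uvm: "(u r t)\<^sup>2 + (v r t)\<^sup>2 \<le> 2 * m r t" "(u r t)\<^sup>2 + (v r t)\<^sup>2 = a r t * m r t" "m r t \<ge> 0" 
    if r: "r \<in> I" "t \<in> J" for r t
  proof -
    show 1: "(u r t)\<^sup>2 + (v r t)\<^sup>2 = a r t * m r t" "m r t \<ge> 0"  using ap[OF r] by (auto simp: m_def)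
    show "(u r t)\<^sup>2 + (v r t)\<^sup>2 \<le> 2 * m r t" unfolding 1 using a[OF r] 1(2) by (intro mult_right_mono) auto
  qed
  \<comment> \<open>The 14: Cauchy--Schwarz with \<open>ef\<close> contributes 2, the derivative of
    the weight 4 and \<open>b2\<close> 1, the last two doubled by \<open>n2 \<le> 2 * m r t\<close>.
    This makes 12; the rest is slack.\<close>
  have up: "r * integral J (m1 r) \<le> 2 * E r + 14 * C * r * M r" if r: "r \<in> I" for r
  proof -
    have rp: "r > 0" using r by (simp add: I_def)
    have "((\<lambda>t. r * m1 r t - 2 * g r t -
          (2 * b r t * (u r t * u2 r t + v r t * v2 r t) + b2 r t * ((u r t)\<^sup>2 + (v r t)\<^sup>2))) has_integral
          (r * integral J (m1 r) - 2 * E r - 0)) J"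
      by (intro has_integral_diff has_integral_mult_right hasM r bI)
    moreover have "((\<lambda>t. 14 * C * r * m r t) has_integral (14 * C * r * M r)) J"
      by (intro has_integral_mult_right hasM r)
    moreover have "r * m1 r t - 2 * g r t -
          (2 * b r t * (u r t * u2 r t + v r t * v2 r t) + b2 r t * ((u r t)\<^sup>2 + (v r t)\<^sup>2)) \<le> 14 * C * r * m r t"
      if t: "t \<in> J" for t
    proof -
      define n2 where "n2 = (u r t)\<^sup>2 + (v r t)\<^sup>2"
      have n2: "n2 \<ge> 0" "n2 \<le> 2 * m r t" using uvm(1)[OF r t] by (auto simp: n2_def)
      have "r * m1 r t = 2 * (u r t * (r * u1 r t) + v r t * (r * v1 r t)) / a r t - r * (a1 r t / (a r t)\<^sup>2) * n2"
        by (simp add: m1_def n2_def algebra_simps add_divide_distrib)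
      also have "2 * (u r t * (r * u1 r t) + v r t * (r * v1 r t)) / a r t = 
         2 * g r t + 2 * b r t * (u r t * u2 r t + v r t * v2 r t) + 2 * (u r t * e r t + v r t * f r t) / a r t"
        unfolding eq1[OF r t] eq2[OF r t] g_def using ap[OF r t] by (simp add: field_simps)
      finally have eq: "r * m1 r t - 2 * g r t -
          (2 * b r t * (u r t * u2 r t + v r t * v2 r t) + b2 r t * ((u r t)\<^sup>2 + (v r t)\<^sup>2)) =
          2 * (u r t * e r t + v r t * f r t) / a r t - r * (a1 r t / (a r t)\<^sup>2) * n2 - b2 r t * n2"
        by (simp add: n2_def)
      have "(u r t * e r t + v r t * f r t)\<^sup>2 \<le> n2 * ((e r t)\<^sup>2 + (f r t)\<^sup>2)"
        unfolding n2_def using zero_le_power2[of "u r t * f r t - v r t * e r t"] by (simp add: power2_eq_square algebra_simps)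
      also have "\<dots> \<le> n2 * ((C * r)\<^sup>2 * n2)" using ef[OF r t] n2 by (intro mult_left_mono) (auto simp: n2_def)
      also have "\<dots> = (C * r * n2)\<^sup>2" by (simp add: power2_eq_square)
      finally have "u r t * e r t + v r t * f r t \<le> C * r * n2"
        by (rule power2_le_imp_le) (use C rp n2 in auto)
      then have "2 * (u r t * e r t + v r t * f r t) / a r t \<le> 2 * (C * r * n2) / a r t"
        using ap[OF r t] by (intro divide_right_mono) auto
      also have "\<dots> = 2 * C * r * m r t" using ap[OF r t] by (simp add: n2_def m_def)
      finally have 1: "2 * (u r t * e r t + v r t * f r t) / a r t \<le> 2 * C * r * m r t" .
      have "- (r * (a1 r t / (a r t)\<^sup>2)) \<le> r * (4 * C)"
        using mult_left_mono[of "- (a1 r t / (a r t)\<^sup>2)" "4 * C" r] a2[OF r t] rp by auto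
      then have "(- (r * (a1 r t / (a r t)\<^sup>2)) - b2 r t) * n2 \<le> (5 * C * r) * n2"
        using b2[OF r t] n2 by (intro mult_right_mono) (auto simp: algebra_simps)
      also have "\<dots> \<le> (5 * C * r) * (2 * m r t)" using n2 C rp by (intro mult_left_mono) auto
      finally have 2: "(- (r * (a1 r t / (a r t)\<^sup>2)) - b2 r t) * n2 \<le> 10 * C * r * m r t" by simp
      have 3: "0 \<le> 2 * C * r * m r t" using C rp uvm(3)[OF r t] by simp
      show ?thesis unfolding eq using 1 2 3 by (simp add: algebra_simps)
    qed
    ultimately have "r * integral J (m1 r) - 2 * E r - 0 \<le> 14 * C * r * M r"
      by (rule has_integral_le)
    then show ?thesis by simp
  qed
  \<comment> \<open>Here 10 C bounds the derivatives of the weight and of \<open>b\<close> (4 + 1,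
    doubled as before), and C^2 R the multiple of e^2 + f^2 left over by completing the
    square.\<close>
  define K where "K = 10 * C + C\<^sup>2 * R"
  have K0: "K \<ge> 0" using C R by (auto simp: K_def)
  have freq: "integral J (g1 r) * M r - E r * integral J (m1 r) \<ge> - K * (\<bar>E r / M r\<bar> + 1) * (M r)\<^sup>2"
    if r: "r \<in> I" for r
  proof -
    have rp: "r > 0" "r < R" using r by (auto simp: I_def)
    define N where "N = E r / M r"
    have EN: "E r = N * M r" using Mpos[OF r] by (simp add: N_def)
    \<comment> \<open>The integral of \<open>F\<close> is r (E' - N M'): the two subtracted boundary
      integrals are zero, and - 2 N E + 2 N^2 M = 0 because N = E / M. These last terms are what
      completes the square.\<close>
    define F where "F = (\<lambda>t. r * (g1 r t - (u2 r t * v1 r t + u r t * v12 r t - v2 r t * u1 r t - v r t * u12 r t))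
        - N * (r * m1 r t - (2 * b r t * (u r t * u2 r t + v r t * v2 r t) + b2 r t * ((u r t)\<^sup>2 + (v r t)\<^sup>2)))
        - 2 * N * g r t + 2 * N\<^sup>2 * m r t)"
    have "(F has_integral (r * (integral J (g1 r) - 0) - N * (r * integral J (m1 r) - 0) - 2 * N * E r + 2 * N\<^sup>2 * M r)) J"
      unfolding F_def by (intro has_integral_diff has_integral_add has_integral_mult_right hasM r bI gI)
    moreover have "((\<lambda>t. - (K * r * (\<bar>N\<bar> + 1)) * m r t) has_integral (- (K * r * (\<bar>N\<bar> + 1)) * M r)) J"
      by (intro has_integral_mult_right hasM r)
    moreover have "- (K * r * (\<bar>N\<bar> + 1)) * m r t \<le> F t" if t: "t \<in> J" for t
    proof -
      define A X Y n2 where "A = a r t" and "X = v2 r t - N * u r t / A" and "Y = - u2 r t - N * v r t / A"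
        and "n2 = (u r t)\<^sup>2 + (v r t)\<^sup>2"
      have A: "A > 0" "A \<noteq> 0" using ap[OF r t] by (auto simp: A_def)
      have n2: "n2 \<ge> 0" "n2 \<le> 2 * m r t" using uvm(1)[OF r t] by (auto simp: n2_def)
      have rm1: "r * m1 r t = 2 * (u r t * (r * u1 r t) + v r t * (r * v1 r t)) / a r t - r * (a1 r t / (a r t)\<^sup>2) * n2"
        by (simp add: m1_def n2_def algebra_simps add_divide_distrib)
      have rg1: "r * (g1 r t - (u2 r t * v1 r t + u r t * v12 r t - v2 r t * u1 r t - v r t * u12 r t)) =
          2 * (v2 r t * (r * u1 r t) - u2 r t * (r * v1 r t))"
        by (simp add: g1_def algebra_simps)
      \<comment> \<open>Completing the square: \<open>X\<close> and \<open>Y\<close> vanish on eigenfunctions with eigenvalue \<open>N\<close>.\<close>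
      have "F t = 2 * A * (X\<^sup>2 + Y\<^sup>2) + 2 * (X * e r t + Y * f r t) + N * (r * (a1 r t / A\<^sup>2) + b2 r t) * n2"
        unfolding F_def rg1 rm1 eq1[OF r t] eq2[OF r t] m_def g_def n2_def[symmetric]
        unfolding X_def Y_def A_def[symmetric] using A
        by (simp add: field_simps power2_eq_square n2_def)
      moreover have "2 * A * (X\<^sup>2 + Y\<^sup>2) + 2 * (X * e r t + Y * f r t) \<ge> - (((e r t)\<^sup>2 + (f r t)\<^sup>2) / (2 * A))"
      proof -
        have "2 * A * (X\<^sup>2 + Y\<^sup>2) + 2 * (X * e r t + Y * f r t) + ((e r t)\<^sup>2 + (f r t)\<^sup>2) / (2 * A) =
           2 * A * ((X + e r t / (2 * A))\<^sup>2 + (Y + f r t / (2 * A))\<^sup>2)"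
          using A by (simp add: field_simps power2_eq_square)
        also have "\<dots> \<ge> 0" using A by simp
        finally show ?thesis by linarith
      qed
      moreover have "((e r t)\<^sup>2 + (f r t)\<^sup>2) / (2 * A) \<le> C\<^sup>2 * R * r * m r t"
      proof -
        have "((e r t)\<^sup>2 + (f r t)\<^sup>2) / (2 * A) \<le> ((C * r)\<^sup>2 * n2) / (2 * A)"
          using A ef[OF r t] by (intro divide_right_mono) (auto simp: n2_def)
        also have "\<dots> = C\<^sup>2 * r * r * m r t / 2" by (simp add: m_def n2_def A_def power2_eq_square mult_ac)
        also have "\<dots> \<le> C\<^sup>2 * R * r * m r t"
          using rp uvm(3)[OF r t] mult_right_mono[of r "2 * R" "C\<^sup>2 * r * m r t"] by (simp add: algebra_simps)
        finally show ?thesis .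
      qed
      moreover have "N * (r * (a1 r t / A\<^sup>2) + b2 r t) * n2 \<ge> - (\<bar>N\<bar> * (5 * C * r) * (2 * m r t))"
      proof -
        have "r * \<bar>a1 r t / A\<^sup>2\<bar> \<le> r * (4 * C)" using a2[OF r t] rp unfolding A_def by (intro mult_left_mono) auto
        then have "\<bar>r * (a1 r t / A\<^sup>2)\<bar> \<le> 4 * (C * r)" using rp by (simp add: abs_mult mult_ac)
        moreover have "\<bar>x + y\<bar> \<le> 5 * z" if "\<bar>x\<bar> \<le> 4 * z" "\<bar>y\<bar> \<le> z" for x y z :: real
          using that by linarith
        ultimately have "\<bar>r * (a1 r t / A\<^sup>2) + b2 r t\<bar> \<le> 5 * (C * r)" using b2[OF r t] by blast
        then have "\<bar>r * (a1 r t / A\<^sup>2) + b2 r t\<bar> \<le> 5 * C * r" by simp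
        then have "\<bar>N\<bar> * \<bar>r * (a1 r t / A\<^sup>2) + b2 r t\<bar> * n2 \<le> \<bar>N\<bar> * (5 * C * r) * (2 * m r t)"
          using n2 C rp by (intro mult_mono) auto
        moreover have "\<bar>N * (r * (a1 r t / A\<^sup>2) + b2 r t) * n2\<bar> = \<bar>N\<bar> * \<bar>r * (a1 r t / A\<^sup>2) + b2 r t\<bar> * n2"
          using n2 by (simp add: abs_mult)
        ultimately show ?thesis by (metis abs_le_D2 minus_le_iff)
      qed
      moreover have "C\<^sup>2 * R * r * m r t + \<bar>N\<bar> * (5 * C * r) * (2 * m r t) \<le> (K * r * (\<bar>N\<bar> + 1)) * m r t"
      proof -
        have "(K * r * (\<bar>N\<bar> + 1)) * m r t - (C\<^sup>2 * R * r * m r t + \<bar>N\<bar> * (5 * C * r) * (2 * m r t)) = 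
          (10 * C + C\<^sup>2 * R * \<bar>N\<bar>) * r * m r t" by (simp add: K_def algebra_simps)
        also have "\<dots> \<ge> 0" using C R rp uvm(3)[OF r t] by simp
        finally show ?thesis by linarith
      qed
      moreover have "- z \<le> F'" if "F' = p + q" "- s \<le> p" "s \<le> t" "- w \<le> q" "t + w \<le> z" for F' p q s t w z :: real
        using that by linarith
      ultimately show ?thesis unfolding mult_minus_left by blast
    qed
    ultimately have "- (K * r * (\<bar>N\<bar> + 1)) * M r \<le>
        r * (integral J (g1 r) - 0) - N * (r * integral J (m1 r) - 0) - 2 * N * E r + 2 * N\<^sup>2 * M r"
      by - (rule has_integral_le, assumption, assumption, blast)
    then have "r * (- (K * (\<bar>N\<bar> + 1)) * M r) \<le> r * (integral J (g1 r) - N * integral J (m1 r))"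
      unfolding EN by (simp add: algebra_simps power2_eq_square)
    then have "- (K * (\<bar>N\<bar> + 1)) * M r \<le> integral J (g1 r) - N * integral J (m1 r)"
      using rp by (simp only: mult_le_cancel_left_pos)
    then have "- (K * (\<bar>N\<bar> + 1)) * M r * M r \<le> (integral J (g1 r) - N * integral J (m1 r)) * M r"
      using Mpos[OF r] by (intro mult_right_mono) auto
    then show ?thesis using Mpos[OF r] unfolding N_def[symmetric] EN by (simp add: algebra_simps power2_eq_square)
  qed
  define N where "N = (\<lambda>r. E r / M r)"
  \<comment> \<open>The derivative of arsinh is 1 / sqrt (N^2 + 1), and |N| + 1 is at most twice
    that root; hence the factor 2 in front of \<open>K * r\<close>.\<close>
  define h where "h = (\<lambda>r. arsinh (N r) + 2 * K * r)"
  have dh: "\<exists>y. (h has_real_derivative y) (at r) \<and> 0 \<le> y" if r: "r \<in> I" for r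
  proof -
    define N' where "N' = (integral J (g1 r) * M r - E r * integral J (m1 r)) / (M r)\<^sup>2"
    have dN: "(N has_real_derivative N') (at r)"
      unfolding N_def N'_def using Mpos[OF r]
      by (auto intro!: derivative_eq_intros dM dE r simp: power2_eq_square)
    have "N' \<ge> - K * (\<bar>N r\<bar> + 1)"
      unfolding N'_def N_def using freq[OF r] Mpos[OF r] by (simp add: pos_le_divide_eq)
    moreover have s: "\<bar>N r\<bar> + 1 \<le> 2 * sqrt ((N r)\<^sup>2 + 1)"
    proof -
      have "\<bar>N r\<bar> \<le> sqrt ((N r)\<^sup>2 + 1)" by (rule real_le_rsqrt) simp
      moreover have "1 \<le> sqrt ((N r)\<^sup>2 + 1)" by simp
      ultimately show ?thesis by linarith
    qed
    ultimately have "N' \<ge> - K * (2 * sqrt ((N r)\<^sup>2 + 1))"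
      using mult_left_mono[OF s K0] by linarith
    moreover have "sqrt ((N r)\<^sup>2 + 1) > 0" by (simp add: add_nonneg_pos)
    ultimately have "N' / sqrt ((N r)\<^sup>2 + 1) + 2 * K \<ge> 0"
      by (simp add: field_simps)
    moreover have "(h has_real_derivative (N' / sqrt ((N r)\<^sup>2 + 1) + 2 * K)) (at r)"
      unfolding h_def by (auto intro!: derivative_eq_intros DERIV_chain2[OF arsinh_real_has_field_derivative dN] simp: field_simps)
    ultimately show ?thesis by blast
  qed
  have sub: "x \<in> I" if "r > 0" "r \<le> x" "x \<le> R / 2" for r x using that R by (auto simp: I_def)
  have Nb: "N r \<le> sinh (h (R/2))" if r: "0 < r" "r \<le> R/2" for r
  proof -
    have "h r \<le> h (R/2)"
      using r dh sub by (intro DERIV_nonneg_imp_nondecreasing[of r "R/2" h]) blast+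
    then have "arsinh (N r) \<le> h (R/2)" using mult_nonneg_nonneg[of K r] K0 r unfolding h_def by linarith
    then have "sinh (arsinh (N r)) \<le> sinh (h (R/2))" by (simp only: sinh_real_le_iff)
    then show ?thesis by (simp add: sinh_arsinh_real)
  qed
  obtain k :: nat where k: "2 * sinh (h (R/2)) + 14 * C * R \<le> real k" using real_arch_simple by blast
  \<comment> \<open>The inequality r M' \<le> k M says that M / r^k does not increase;
    \<open>p\<close> is minus the logarithm of this quotient.\<close>
  define p where "p = (\<lambda>r. real k * ln r - ln (M r))"
  have dp: "\<exists>y. (p has_real_derivative y) (at r) \<and> 0 \<le> y" if r: "0 < r" "r \<le> R/2" for r
  proof -
    have rI: "r \<in> I" using sub r by blast
    have "E r = N r * M r" using Mpos[OF rI] by (simp add: N_def)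
    also have "\<dots> \<le> sinh (h (R/2)) * M r" using Nb[OF r] Mpos[OF rI] by (intro mult_right_mono) auto
    finally have "r * integral J (m1 r) \<le> 2 * (sinh (h (R/2)) * M r) + 14 * C * r * M r" using up[OF rI] by linarith
    also have "14 * C * r * M r \<le> 14 * C * R * M r" using C R r Mpos[OF rI] by (intro mult_right_mono mult_left_mono) auto
    also have "2 * (sinh (h (R/2)) * M r) + 14 * C * R * M r = (2 * sinh (h (R/2)) + 14 * C * R) * M r" by (simp add: algebra_simps)
    also have "\<dots> \<le> real k * M r" using k Mpos[OF rI] by (intro mult_right_mono) auto
    finally have "real k / r - integral J (m1 r) / M r \<ge> 0"
      using Mpos[OF rI] r by (simp add: field_simps)
    moreover have "(p has_real_derivative (real k / r - integral J (m1 r) / M r)) (at r)"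
      unfolding p_def using Mpos[OF rI] r by (auto intro!: derivative_eq_intros dM rI simp: field_simps)
    ultimately show ?thesis by blast
  qed
  \<comment> \<open>The factor 1/2 pays for dropping the weight 1 / a, which is at most 2.\<close>
  have "exp (- p (R/2)) / 2 * r ^ k \<le> integral J (\<lambda>t. (u r t)\<^sup>2 + (v r t)\<^sup>2)" if r: "r \<in> {0<..R/2}" for r
  proof -
    have rI: "r \<in> I" using sub r by auto
    have "p r \<le> p (R/2)"
      using r dp by (intro DERIV_nonneg_imp_nondecreasing[of r "R/2" p]) fastforce+
    then have "exp (real k * ln r - p (R/2)) \<le> exp (ln (M r))" unfolding p_def by (subst exp_le_cancel_iff) linarith
    then have "exp (- p (R/2)) * r ^ k \<le> M r"
      using Mpos[OF rI] r by (simp add: exp_diff exp_minus field_simps exp_of_nat_mult)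
    moreover have "M r \<le> integral J (\<lambda>t. 2 * ((u r t)\<^sup>2 + (v r t)\<^sup>2))"
      unfolding M_def
    proof (intro integral_le int cm rI)
      show "continuous_on J (\<lambda>t. 2 * ((u r t)\<^sup>2 + (v r t)\<^sup>2))"
        using sl[OF rI] by (auto intro!: continuous_intros)
      fix t assume t: "t \<in> J"
      show "m r t \<le> 2 * ((u r t)\<^sup>2 + (v r t)\<^sup>2)"
        unfolding uvm(2)[OF rI t] using a[OF rI t] uvm(3)[OF rI t] mult_right_mono[of "1/2" "a r t" "m r t"] by simp
    qed
    ultimately show ?thesis unfolding integral_mult_right by simp
  qed
  then show ?thesis by (intro exI[of _ "exp (- p (R/2)) / 2"] conjI exI[of _ k] ballI) auto
qed


subsection \<open>A perturbed Cauchy--Riemann system in a half disc\<close>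

definition half_disc :: "real \<Rightarrow> complex set" where
  "half_disc R = {z. norm z < R \<and> 0 \<le> Im z}"

section \<open>Differentiation rules along curves\<close>

lemma has_vector_derivative_compose_within:
  fixes p :: "real \<Rightarrow> 'a::real_normed_vector" and f :: "'a \<Rightarrow> 'b::real_normed_vector"
  assumes "(f has_derivative D) (at (p t) within B)" "(p has_vector_derivative v) (at t within I)" "p ` I \<subseteq> B"
  shows "((\<lambda>t. f (p t)) has_vector_derivative D v) (at t within I)"
proof -
  have "bounded_linear D" by (rule has_derivative_bounded_linear[OF assms(1)])
  then have "D (h *\<^sub>R v) = h *\<^sub>R D v" for h by (simp add: linear_simps)
  then show ?thesis
    using has_derivative_in_compose[OF assms(2)[unfolded has_vector_derivative_def]
        has_derivative_subset[OF assms(1,3)]]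
    by (simp add: has_vector_derivative_def)
qed

lemma has_vector_derivative_quotient:
  fixes f g :: "real \<Rightarrow> 'a::real_normed_field"
  assumes "(f has_vector_derivative f') (at t within S)" "(g has_vector_derivative g') (at t within S)" "g t \<noteq> 0"
  shows "((\<lambda>t. f t / g t) has_vector_derivative ((f' * g t - f t * g') / (g t)\<^sup>2)) (at t within S)"
proof -
  have eq: "(h *\<^sub>R f' * g t - f t * (h *\<^sub>R g')) / (g t * g t) = h *\<^sub>R ((f' * g t - f t * g') / (g t)\<^sup>2)" for h
    by (simp add: power2_eq_square scaleR_conv_of_real algebra_simps diff_divide_distrib)
  show ?thesis
    using has_derivative_divide'[OF assms(1,2)[unfolded has_vector_derivative_def] assms(3)]
    unfolding eq by (simp add: has_vector_derivative_def)
qed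

lemma has_real_derivative_Re_Im:
  assumes "(f has_vector_derivative f') (at t within S)"
  shows "((\<lambda>t. Re (f t)) has_real_derivative Re f') (at t within S)"
    and "((\<lambda>t. Im (f t)) has_real_derivative Im f') (at t within S)"
  unfolding has_real_derivative_iff_has_vector_derivative
  by (rule bounded_linear.has_vector_derivative[OF bounded_linear_Re assms]
      bounded_linear.has_vector_derivative[OF bounded_linear_Im assms])+

lemma has_vector_derivative_cis:
  "((\<lambda>t. cis (k * t)) has_vector_derivative (\<i> * of_real k * cis (k * t))) (at t within S)"
proof -
  have "((\<lambda>z. exp (\<i> * of_real k * z)) has_field_derivative (\<i> * of_real k * exp (\<i> * of_real k * of_real t))) (at (of_real t))"
    by (auto intro!: derivative_eq_intros)
  from has_vector_derivative_real_field[OF this] show ?thesis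
    unfolding cis_conv_exp by (simp add: mult.assoc)
qed

text \<open>In polar coordinates the equation becomes the system of
  \<open>polar_frequency_growth\<close>. Its principal part deviates from the Cauchy--Riemann system
  by a multiple of \<open>Im z\<close>, hence by O(r), and the deviation vanishes on the rays
  \<theta> = 0 and \<theta> = pi, as the boundary condition on the coefficient \<open>b\<close> of
  that lemma demands.\<close>

lemma half_disc_growth:
  fixes Q Qt Qs Qtt Qts Qss :: "complex \<Rightarrow> complex" and b b' :: "real \<Rightarrow> complex" and R :: real
  defines "B \<equiv> half_disc R"
  assumes R: "R > 0"
    and dQ: "\<And>z. z \<in> B \<Longrightarrow> (Q has_derivative (\<lambda>h. Re h *\<^sub>R Qt z + Im h *\<^sub>R Qs z)) (at z within B)"
    and dQt: "\<And>z. z \<in> B \<Longrightarrow> (Qt has_derivative (\<lambda>h. Re h *\<^sub>R Qtt z + Im h *\<^sub>R Qts z)) (at z within B)"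
    and dQs: "\<And>z. z \<in> B \<Longrightarrow> (Qs has_derivative (\<lambda>h. Re h *\<^sub>R Qts z + Im h *\<^sub>R Qss z)) (at z within B)"
    and cQ: "continuous_on B Qtt" "continuous_on B Qts" "continuous_on B Qss"
    and real: "\<And>z. z \<in> B \<Longrightarrow> Im z = 0 \<Longrightarrow> Im (Q z) = 0"
    and db: "\<And>t. (b has_vector_derivative b' t) (at t)" and cb': "continuous_on UNIV b'"
    and eq: "\<And>z. z \<in> B \<Longrightarrow> (1 + \<i> * of_real (Im z) * b (Re z)) * Qs z = \<i> * (Qt z - b (Re z) * Q z)"
    and nz: "\<And>r. 0 < r \<Longrightarrow> r < R \<Longrightarrow> \<exists>z\<in>B. norm z = r \<and> Q z \<noteq> 0"
  shows "\<exists>c>0. \<exists>k::nat. \<exists>R'>0. \<forall>r\<in>{0<..R'}. \<exists>z\<in>B. norm z = r \<and> c * r ^ k \<le> (norm (Q z))\<^sup>2"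
proof -
  have cb: "continuous_on UNIV b"
    using db by (intro continuous_at_imp_continuous_on ballI) (blast intro: has_vector_derivative_continuous)
  obtain b0 where b0: "b0 > 0" "\<And>t. t \<in> {-1..1} \<Longrightarrow> norm (b t) \<le> b0 \<and> norm (b' t) \<le> b0"
  proof -
    have bd: "\<exists>x. \<forall>t\<in>{-1..1}. norm (g t) \<le> x" if "continuous_on UNIV g" for g :: "real \<Rightarrow> complex"
    proof -
      have "bounded (g ` {-1..1})"
        by (intro compact_imp_bounded compact_continuous_image continuous_on_subset[OF that]) auto
      then show ?thesis unfolding bounded_iff by blast
    qed
    obtain x y where "\<forall>t\<in>{-1..1}. norm (b t) \<le> x" "\<forall>t\<in>{-1..1}. norm (b' t) \<le> y"
      using bd[OF cb] bd[OF cb'] by blast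
    then have "norm (b t) \<le> max 1 (max x y) \<and> norm (b' t) \<le> max 1 (max x y)" if "t \<in> {-1..1}" for t
      using that by (simp add: le_max_iff_disj)
    then show ?thesis using that[of "max 1 (max x y)"] by simp
  qed
  \<comment> \<open>The bound 1 keeps \<open>r * cos t\<close> in the interval on which
    \<open>b0\<close> is a bound. The bound 1 / (4 b0) gives \<open>norm (Bf r t) \<le> 1/4\<close>,
    hence \<open>norm (Dn r t) \<ge> 3/4\<close> and \<open>norm (\<rho> r t - 1) \<le> 1/2\<close>,
    so that \<open>Re (\<rho> r t)\<close> stays between 1/2 and 2.\<close>
  define R1 where "R1 = min R (min 1 (1 / (4 * b0)))"
  have R1: "R1 > 0" "R1 \<le> R" "R1 \<le> 1" "R1 * b0 \<le> 1/4"
  proof -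
    have "R1 * b0 \<le> 1 / (4 * b0) * b0" using b0 by (intro mult_right_mono) (auto simp: R1_def)
    then show "R1 * b0 \<le> 1/4" using b0 by simp
  qed (use R b0 in \<open>auto simp: R1_def\<close>)
  define I J :: "real set" where "I = {0<..<R1}" and "J = {0..pi}"
  \<comment> \<open>The largest constant arises for \<open>\<beta>2\<close>: (10 * 3/2 + 1/2 * 10)
    b0 r, divided by (1/2)^2.\<close>
  define C where "C = 80 * b0"
  define pz where "pz = (\<lambda>r t. of_real r * cis t :: complex)"
  have pz: "pz r t \<in> B" "norm (pz r t) = r" "Re (pz r t) = r * cos t" "Im (pz r t) = r * sin t"
    if "r \<in> I" "t \<in> J" for r t
    using that R1 by (auto simp: pz_def B_def half_disc_def I_def J_def norm_mult intro!: mult_nonneg_nonneg sin_ge_zero)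
  define q q1 q2 q12 where "q = (\<lambda>r t. Q (pz r t))"
    and "q1 = (\<lambda>r t. cos t *\<^sub>R Qt (pz r t) + sin t *\<^sub>R Qs (pz r t))"
    and "q2 = (\<lambda>r t. (- r * sin t) *\<^sub>R Qt (pz r t) + (r * cos t) *\<^sub>R Qs (pz r t))"
    and "q12 = (\<lambda>r t. (- sin t) *\<^sub>R Qt (pz r t) + cos t *\<^sub>R Qs (pz r t)
       + (- r * sin t * cos t) *\<^sub>R Qtt (pz r t) + (r * (cos t * cos t - sin t * sin t)) *\<^sub>R Qts (pz r t)
       + (r * cos t * sin t) *\<^sub>R Qss (pz r t))"
  have dpr: "((\<lambda>r. pz r t) has_vector_derivative cis t) (at r within S)" for r t S
    unfolding pz_def by (auto intro!: derivative_eq_intros)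
  have dpt: "((\<lambda>t. pz r t) has_vector_derivative (of_real r * \<i> * cis t)) (at t within S)" for r t S
    unfolding pz_def using has_vector_derivative_cis[of 1 t S] by (auto intro!: derivative_eq_intros)
  have rad: "((\<lambda>r. F (pz r t)) has_vector_derivative (cos t *\<^sub>R Ft (pz r t) + sin t *\<^sub>R Fs (pz r t))) (at r)"
    if rt: "r \<in> I" "t \<in> J" and "\<And>z. z \<in> B \<Longrightarrow> (F has_derivative (\<lambda>h. Re h *\<^sub>R Ft z + Im h *\<^sub>R Fs z)) (at z within B)"
    for F Ft Fs :: "complex \<Rightarrow> complex" and r t
  proof -
    have "((\<lambda>r. F (pz r t)) has_vector_derivative (Re (cis t) *\<^sub>R Ft (pz r t) + Im (cis t) *\<^sub>R Fs (pz r t))) (at r within I)"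
      by (rule has_vector_derivative_compose_within[OF that(3) dpr]) (use pz rt in auto)
    moreover have "at r within I = at r" using rt by (intro at_within_open) (auto simp: I_def)
    ultimately show ?thesis by simp
  qed
  have ang: "((\<lambda>t. F (pz r t)) has_vector_derivative ((- r * sin t) *\<^sub>R Ft (pz r t) + (r * cos t) *\<^sub>R Fs (pz r t))) (at t within J)"
    if rt: "r \<in> I" "t \<in> J" and "\<And>z. z \<in> B \<Longrightarrow> (F has_derivative (\<lambda>h. Re h *\<^sub>R Ft z + Im h *\<^sub>R Fs z)) (at z within B)"
    for F Ft Fs :: "complex \<Rightarrow> complex" and r t
  proof -
    have "((\<lambda>t. F (pz r t)) has_vector_derivative (Re (of_real r * \<i> * cis t) *\<^sub>R Ft (pz r t) + Im (of_real r * \<i> * cis t) *\<^sub>R Fs (pz r t))) (at t within J)"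
      by (rule has_vector_derivative_compose_within[OF that(3) dpt]) (use pz rt in auto)
    then show ?thesis by simp
  qed
  have dq1: "((\<lambda>r. q r t) has_vector_derivative q1 r t) (at r)" if "r \<in> I" "t \<in> J" for r t
    unfolding q_def q1_def by (rule rad[OF that dQ])
  have dq2: "((\<lambda>t. q r t) has_vector_derivative q2 r t) (at t within J)" if "r \<in> I" "t \<in> J" for r t
    unfolding q_def q2_def by (rule ang[OF that dQ])
  have dq12: "((\<lambda>t. q1 r t) has_vector_derivative q12 r t) (at t within J)" if "r \<in> I" "t \<in> J" for r t
    unfolding q1_def q12_def
    by (rule has_vector_derivative_eq_rhs[OF has_vector_derivative_add[OF
          has_vector_derivative_scaleR[OF DERIV_subset[OF DERIV_cos subset_UNIV] ang[OF that dQt]]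
          has_vector_derivative_scaleR[OF DERIV_subset[OF DERIV_sin subset_UNIV] ang[OF that dQs]]]])
       (auto simp: scaleR_conv_of_real algebra_simps)
  have dq21: "((\<lambda>r. q2 r t) has_vector_derivative q12 r t) (at r)" if "r \<in> I" "t \<in> J" for r t
  proof -
    have 1: "((\<lambda>r. - r * sin t) has_real_derivative - sin t) (at r)" "((\<lambda>r. r * cos t) has_real_derivative cos t) (at r)"
      by (auto intro!: derivative_eq_intros)
    show ?thesis
      unfolding q2_def q12_def
      by (rule has_vector_derivative_eq_rhs[OF has_vector_derivative_add[OF
            has_vector_derivative_scaleR[OF 1(1) rad[OF that dQt]] has_vector_derivative_scaleR[OF 1(2) rad[OF that dQs]]]])
         (auto simp: scaleR_conv_of_real algebra_simps)
  qed
  have contp: "continuous_on (I \<times> J) (\<lambda>(r,t). F (pz r t))" if "continuous_on B F" for F :: "complex \<Rightarrow> complex"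
  proof -
    have 1: "continuous_on (I \<times> J) (\<lambda>x. pz (fst x) (snd x))"
      unfolding pz_def cis_conv_exp by (intro continuous_intros)
    have "continuous_on (I \<times> J) (\<lambda>x. F (pz (fst x) (snd x)))"
      by (rule continuous_on_compose2[OF that 1]) (use pz in auto)
    then show ?thesis by (simp add: case_prod_beta)
  qed
  have cQ': "continuous_on B Q" "continuous_on B Qt" "continuous_on B Qs"
    by (rule has_derivative_continuous_on[OF dQ] has_derivative_continuous_on[OF dQt]
        has_derivative_continuous_on[OF dQs]; assumption)+
  note cc = cQ[THEN contp] cQ'[THEN contp]
  have cq: "continuous_on (I \<times> J) (\<lambda>(r,t). q r t)" "continuous_on (I \<times> J) (\<lambda>(r,t). q1 r t)"
     "continuous_on (I \<times> J) (\<lambda>(r,t). q2 r t)" "continuous_on (I \<times> J) (\<lambda>(r,t). q12 r t)"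
    unfolding q_def q1_def q2_def q12_def using cc
    by (auto simp: case_prod_beta intro!: continuous_intros)

  \<comment> \<open>In polar coordinates the equation reads \<open>r q\<^sub>r = - \<i> \<rho> q\<^sub>\<theta> + \<tau> q\<close>, where
    \<open>\<rho> = (cos \<theta> + \<i> \<lambda> sin \<theta>) / (\<lambda> cos \<theta> + \<i> sin \<theta>)\<close> with \<open>\<lambda> = 1 / (1 + \<i> Bf)\<close>; the suffixes 1 and 2 denote
    the derivatives with respect to \<open>r\<close> and \<open>\<theta>\<close>.\<close>
  define Bf Bf1 Bf2 where "Bf = (\<lambda>r t. of_real (r * sin t) * b (r * cos t))"
    and "Bf1 = (\<lambda>r t. of_real (sin t) * b (r * cos t) + of_real (r * sin t * cos t) * b' (r * cos t))"
    and "Bf2 = (\<lambda>r t. of_real (r * cos t) * b (r * cos t) - of_real (r * sin t * (r * sin t)) * b' (r * cos t))"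
  \<comment> \<open>Clearing \<lambda> turns the quotient into (cis t + i Bf cos t) / (cis t - Bf
    sin t). Splitting off 1 leaves i Bf cis (- t) over this denominator; \<open>Dn\<close> is the
    denominator times cis t.\<close>
  define Dn where "Dn = (\<lambda>r t. cis (2 * t) - Bf r t * of_real (sin t) * cis t)"
  define \<rho> \<rho>1 \<rho>2 where "\<rho> = (\<lambda>r t. 1 + \<i> * Bf r t / Dn r t)"
    and "\<rho>1 = (\<lambda>r t. \<i> * Bf1 r t * cis (2 * t) / (Dn r t)\<^sup>2)"
    and "\<rho>2 = (\<lambda>r t. \<i> * cis (2 * t) * (Bf2 r t - 2 * \<i> * Bf r t + (Bf r t)\<^sup>2) / (Dn r t)\<^sup>2)"
  have bb: "norm (b (r * cos t)) \<le> b0" "norm (b' (r * cos t)) \<le> b0" if "r \<in> I" for r t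
  proof -
    have "\<bar>r * cos t\<bar> \<le> 1" using that R1 abs_cos_le_one[of t] by (auto simp: I_def abs_mult intro!: mult_le_one)
    then show "norm (b (r * cos t)) \<le> b0" "norm (b' (r * cos t)) \<le> b0" using b0(2)[of "r * cos t"] by (auto simp: abs_le_iff)
  qed
  have rI: "0 < r" "r \<le> 1" "r * b0 \<le> 1/4" "b0 * r \<le> 1/4" if "r \<in> I" for r
  proof -
    have "r * b0 \<le> R1 * b0" using that b0 by (intro mult_right_mono) (auto simp: I_def)
    then show "r * b0 \<le> 1/4" using R1 by linarith
    then show "b0 * r \<le> 1/4" by (simp add: mult.commute)
  qed (use that R1 in \<open>auto simp: I_def\<close>)
  have nBf: "norm (Bf r t) \<le> b0 * r" if "r \<in> I" for r t
  proof -
    have "norm (Bf r t) = r * \<bar>sin t\<bar> * norm (b (r * cos t))" using rI[OF that] by (simp add: Bf_def norm_mult abs_mult)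
    also have "\<dots> \<le> r * 1 * b0" using rI[OF that] bb[OF that] b0 by (intro mult_mono) auto
    finally show ?thesis by (simp add: mult.commute)
  qed
  have nBf1: "norm (Bf1 r t) \<le> 2 * b0" if r: "r \<in> I" for r t
  proof -
    have "norm (Bf1 r t) \<le> \<bar>sin t\<bar> * norm (b (r * cos t)) + (r * \<bar>sin t\<bar> * \<bar>cos t\<bar>) * norm (b' (r * cos t))"
      unfolding Bf1_def using rI[OF that] by (intro norm_triangle_le) (simp add: norm_mult abs_mult)
    also have "\<dots> \<le> 1 * b0 + (1 * 1 * 1) * b0" using rI[OF that] bb[OF that] b0 by (intro add_mono mult_mono) auto
    finally show ?thesis by simp
  qed
  have nBf2: "norm (Bf2 r t) \<le> 2 * b0 * r" if r: "r \<in> I" for r t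
  proof -
    have "norm (Bf2 r t) \<le> (r * \<bar>cos t\<bar>) * norm (b (r * cos t)) + (r * \<bar>sin t\<bar> * (r * \<bar>sin t\<bar>)) * norm (b' (r * cos t))"
      unfolding Bf2_def using rI[OF that] by (intro norm_triangle_le_diff) (simp add: norm_mult abs_mult)
    also have "\<dots> \<le> (r * 1) * b0 + (r * 1 * (1 * 1)) * b0" using rI[OF that] bb[OF that] b0 by (intro add_mono mult_mono) auto
    finally show ?thesis by (simp add: mult_ac)
  qed
  have nDn: "norm (Dn r t) \<ge> 3/4" if r: "r \<in> I" for r t
  proof -
    have "norm (Bf r t * of_real (sin t) * cis t) = norm (Bf r t) * \<bar>sin t\<bar>" by (simp add: norm_mult)
    also have "\<dots> \<le> (b0 * r) * 1" using nBf[OF r] b0 rI[OF r] by (intro mult_mono) auto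
    finally have "norm (Bf r t * of_real (sin t) * cis t) \<le> 1/4" using rI[OF r] by simp
    then show ?thesis unfolding Dn_def
      using norm_triangle_ineq2[of "cis (2*t)" "Bf r t * of_real (sin t) * cis t"] by simp
  qed
  have Dn0: "Dn r t \<noteq> 0" if r: "r \<in> I" for r t using nDn[OF r, of t] by auto
  have divD: "norm (z / (Dn r t)\<^sup>2) \<le> 2 * norm z" if r: "r \<in> I" for r t z
  proof -
    have "(3/4)\<^sup>2 \<le> (norm (Dn r t))\<^sup>2" using nDn[OF r] by (intro power_mono) auto
    then have "1/2 \<le> norm ((Dn r t)\<^sup>2)" by (simp add: norm_mult power2_eq_square)
    then have "norm z / norm ((Dn r t)\<^sup>2) \<le> norm z / (1/2)" by (intro divide_left_mono) (use Dn0[OF r] in auto)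
    then show ?thesis by (simp add: norm_divide)
  qed
  have n\<rho>: "norm (\<rho> r t - 1) \<le> 1/2" if r: "r \<in> I" for r t
  proof -
    have "norm (Bf r t) / norm (Dn r t) \<le> (1/4) / (3/4)" using nBf[OF r, of t] rI[OF r] nDn[OF r] by (intro frac_le) auto
    then show ?thesis by (simp add: \<rho>_def norm_divide norm_mult)
  qed
  have n\<rho>1: "norm (\<rho>1 r t) \<le> 4 * b0" if r: "r \<in> I" for r t
    using divD[OF r, of "\<i> * Bf1 r t * cis (2 * t)" t] nBf1[OF r, of t] by (simp add: \<rho>1_def norm_mult)
  have n\<rho>2: "norm (\<rho>2 r t) \<le> 10 * b0 * r" if r: "r \<in> I" for r t
  proof -
    have "norm ((Bf r t)\<^sup>2) \<le> (b0 * r) * 1"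
      unfolding power2_eq_square norm_mult using nBf[OF r, of t] rI[OF r] b0 by (intro mult_mono) auto
    then have "norm (Bf2 r t - 2 * \<i> * Bf r t + (Bf r t)\<^sup>2) \<le> 2 * b0 * r + 2 * (b0 * r) + b0 * r"
      using nBf2[OF r, of t] nBf[OF r, of t]
      by (intro norm_triangle_le add_mono norm_triangle_le_diff) (auto simp: norm_mult)
    then show ?thesis
      using divD[OF r, of "\<i> * cis (2 * t) * (Bf2 r t - 2 * \<i> * Bf r t + (Bf r t)\<^sup>2)" t]
      by (simp add: \<rho>2_def norm_mult)
  qed
  have dbr: "((\<lambda>r. b (r * cos t)) has_vector_derivative (cos t *\<^sub>R b' (r * cos t))) (at r within S)" for r t S
    by (rule has_vector_derivative_compose_within[where p="\<lambda>r. r * cos t" and B=UNIV, OF db[unfolded has_vector_derivative_def]])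
       (auto intro!: derivative_eq_intros)
  have dbt: "((\<lambda>t. b (r * cos t)) has_vector_derivative ((- r * sin t) *\<^sub>R b' (r * cos t))) (at t within S)" for r t S
    by (rule has_vector_derivative_compose_within[where p="\<lambda>t. r * cos t" and B=UNIV, OF db[unfolded has_vector_derivative_def]])
       (auto intro!: derivative_eq_intros simp: has_real_derivative_iff_has_vector_derivative[symmetric])
  have dBf1: "((\<lambda>r. Bf r t) has_vector_derivative Bf1 r t) (at r within S)" for r t S
    unfolding Bf_def Bf1_def
    by (rule derivative_eq_intros dbr refl)+ (simp add: scaleR_conv_of_real algebra_simps)
  have dBf2: "((\<lambda>t. Bf r t) has_vector_derivative Bf2 r t) (at t within S)" for r t S
    unfolding Bf_def Bf2_def
    by (rule derivative_eq_intros dbt refl)+ (simp add: scaleR_conv_of_real algebra_simps)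
  have cis2: "cis (2 * t) = cis t * cis t" for t by (simp add: cis_mult)
  have cist: "cis t = of_real (cos t) + \<i> * of_real (sin t)" for t by (simp add: complex_eq_iff)
  have d\<rho>1: "((\<lambda>r. \<rho> r t) has_vector_derivative \<rho>1 r t) (at r)" if r: "r \<in> I" for r t
    unfolding \<rho>_def \<rho>1_def
    by (rule derivative_eq_intros has_vector_derivative_quotient dBf1 Dn0[OF r] refl | subst Dn_def)+
       (simp add: Dn_def algebra_simps)
  have d\<rho>2: "((\<lambda>t. \<rho> r t) has_vector_derivative \<rho>2 r t) (at t within J)" if r: "r \<in> I" for r t
  proof -
    have dD: "((\<lambda>t. Dn r t) has_vector_derivative (2 * \<i> * cis (2 * t) - Bf2 r t * of_real (sin t) * cis t
        - Bf r t * cis (2 * t))) (at t within J)"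
      unfolding Dn_def
      by (rule derivative_eq_intros dBf2 has_vector_derivative_cis has_vector_derivative_cis[of 1, simplified] refl)+
         (simp only: cis2, simp add: cist algebra_simps)
    show ?thesis unfolding \<rho>_def \<rho>2_def
      by (rule derivative_eq_intros has_vector_derivative_quotient[OF _ dD] dBf2 Dn0[OF r] refl)+
         (simp add: Dn_def power2_eq_square algebra_simps)
  qed
  \<comment> \<open>This writes \<rho> as a (1 + i \<beta>), the form of the coefficient in
    \<open>polar_frequency_growth\<close>.\<close>
  define a a1 \<beta> \<beta>2 where "a = (\<lambda>r t. Re (\<rho> r t))" and "a1 = (\<lambda>r t. Re (\<rho>1 r t))"
    and "\<beta> = (\<lambda>r t. Im (\<rho> r t) / Re (\<rho> r t))"
    and "\<beta>2 = (\<lambda>r t. (Im (\<rho>2 r t) * Re (\<rho> r t) - Im (\<rho> r t) * Re (\<rho>2 r t)) / (Re (\<rho> r t))\<^sup>2)"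
  have Re\<rho>: "1/2 \<le> Re (\<rho> r t)" "Re (\<rho> r t) \<le> 3/2" "\<bar>Im (\<rho> r t)\<bar> \<le> 1/2" if r: "r \<in> I" for r t
    using n\<rho>[OF r, of t] abs_Re_le_cmod[of "\<rho> r t - 1"] abs_Im_le_cmod[of "\<rho> r t - 1"] by auto
  \<comment> \<open>The zeroth-order coefficient is what the term b Q of the equation contributes
    once \<open>Qt\<close> is expressed through \<open>Qs\<close> and \<open>Q\<close>.\<close>
  define \<tau> where "\<tau> = (\<lambda>r t. b (r * cos t) * (of_real (r * cos t) - \<i> * \<rho> r t * of_real (r * sin t)))"
  have pde: "of_real r * q1 r t = - \<i> * \<rho> r t * q2 r t + \<tau> r t * q r t" if r: "r \<in> I" "t \<in> J" for r t
  proof -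
    define z x s T S QQ where "z = pz r t" and "x = r * cos t" and "s = r * sin t" and "T = Qt z" and "S = Qs z" and "QQ = Q z"
    define bz where "bz = b x"
    have "(1 + \<i> * of_real s * bz) * S = \<i> * (T - bz * QQ)"
      using eq[OF pz(1)[OF r]] unfolding pz(3)[OF r] pz(4)[OF r] by (simp add: z_def x_def s_def T_def S_def QQ_def bz_def)
    then have "- \<i> * (\<i> * (T - bz * QQ)) = - \<i> * ((1 + \<i> * of_real s * bz) * S)" by simp
    then have T: "T = bz * QQ - \<i> * (1 + \<i> * of_real s * bz) * S" by (simp add: algebra_simps)
    have q1: "of_real r * q1 r t = of_real x * T + of_real s * S" "q2 r t = - of_real s * T + of_real x * S"
      "\<tau> r t = bz * (of_real x - \<i> * \<rho> r t * of_real s)" "q r t = QQ"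
      by (auto simp: q1_def q2_def q_def x_def s_def T_def S_def z_def scaleR_conv_of_real algebra_simps \<tau>_def bz_def QQ_def)
    have \<rho>e: "\<rho> r t * (of_real x + \<i> * of_real s * (1 + \<i> * of_real s * bz)) = of_real x * (1 + \<i> * of_real s * bz) + \<i> * of_real s"
    proof -
      define D where "D = cis t - Bf r t * of_real (sin t)"
      have DD: "Dn r t = D * cis t" by (simp only: Dn_def D_def cis2, simp add: algebra_simps)
      then have D0: "D \<noteq> 0" using Dn0[OF r(1), of t] by auto
      have "\<i> * Bf r t / Dn r t * D = \<i> * Bf r t / cis t" using D0 by (simp add: DD)
      also have "\<dots> = \<i> * Bf r t * (of_real (cos t) - \<i> * of_real (sin t))"
        by (simp add: divide_inverse cis_inverse, simp add: cist)
      finally have 1: "\<rho> r t * D = D + \<i> * Bf r t * (of_real (cos t) - \<i> * of_real (sin t))"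
        by (simp add: \<rho>_def algebra_simps)
      have 2: "of_real x + \<i> * of_real s * (1 + \<i> * of_real s * bz) = of_real r * D"
        unfolding D_def by (simp add: x_def s_def bz_def Bf_def cist algebra_simps)
      show ?thesis unfolding 2 using arg_cong[OF 1, of "\<lambda>w. of_real r * w"]
        by (simp add: algebra_simps D_def x_def s_def bz_def Bf_def cist)
    qed
    have "- \<i> * \<rho> r t * q2 r t + \<tau> r t * q r t = 
       - \<i> * (\<rho> r t * (of_real x + \<i> * of_real s * (1 + \<i> * of_real s * bz))) * S + of_real x * bz * QQ"
      unfolding q1 T by (simp add: algebra_simps)
    also have "\<dots> = of_real x * T + of_real s * S" unfolding \<rho>e T by (simp add: algebra_simps)
    finally show ?thesis by (simp add: q1)
  qed
  have n\<tau>: "norm (\<tau> r t) \<le> C * r" if r: "r \<in> I" for r t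
  proof -
    have "norm (\<rho> r t) \<le> 2" using n\<rho>[OF r, of t] norm_triangle_ineq2[of "\<rho> r t" 1] by simp
    have "norm (of_real (r * cos t) - \<i> * \<rho> r t * of_real (r * sin t)) \<le> r * \<bar>cos t\<bar> + norm (\<rho> r t) * (r * \<bar>sin t\<bar>)"
      using rI[OF r] by (intro norm_triangle_le_diff) (simp add: norm_mult abs_mult)
    also have "\<dots> \<le> r * 1 + 2 * (r * 1)"
      using rI[OF r] \<open>norm (\<rho> r t) \<le> 2\<close> by (intro add_mono mult_mono) auto
    finally have "norm (of_real (r * cos t) - \<i> * \<rho> r t * of_real (r * sin t)) \<le> r * 1 + 2 * (r * 1)" .
    then have "norm (\<tau> r t) \<le> b0 * (r * 1 + 2 * (r * 1))"
      unfolding \<tau>_def norm_mult using bb[OF r] b0 by (intro mult_mono) auto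
    also have "\<dots> \<le> C * r" using b0 rI[OF r] by (simp add: C_def)
    finally show ?thesis .
  qed
  have c\<rho>: "continuous_on (I \<times> J) (\<lambda>x. \<rho> (fst x) (snd x))" "continuous_on (I \<times> J) (\<lambda>x. \<rho>1 (fst x) (snd x))"
    "continuous_on (I \<times> J) (\<lambda>x. \<rho>2 (fst x) (snd x))"
  proof -
    have 1: "continuous_on (I \<times> J) (\<lambda>x. b (fst x * cos (snd x)))" "continuous_on (I \<times> J) (\<lambda>x. b' (fst x * cos (snd x)))"
      by (auto intro!: continuous_on_compose2[OF cb] continuous_on_compose2[OF cb'] continuous_intros)
    have 2: "continuous_on (I \<times> J) (\<lambda>x. Bf (fst x) (snd x))" "continuous_on (I \<times> J) (\<lambda>x. Bf1 (fst x) (snd x))"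
      "continuous_on (I \<times> J) (\<lambda>x. Bf2 (fst x) (snd x))" 
      unfolding Bf_def Bf1_def Bf2_def by (intro continuous_intros 1)+
    have 3: "continuous_on (I \<times> J) (\<lambda>x. cis (snd x))" "continuous_on (I \<times> J) (\<lambda>x. cis (2 * snd x))"
      unfolding cis_conv_exp by (intro continuous_intros)+
    have 4: "continuous_on (I \<times> J) (\<lambda>x. Dn (fst x) (snd x))"
      unfolding Dn_def by (intro continuous_intros 2 3)
    show "continuous_on (I \<times> J) (\<lambda>x. \<rho> (fst x) (snd x))" "continuous_on (I \<times> J) (\<lambda>x. \<rho>1 (fst x) (snd x))"
      "continuous_on (I \<times> J) (\<lambda>x. \<rho>2 (fst x) (snd x))"
      unfolding \<rho>_def \<rho>1_def \<rho>2_def by (intro continuous_intros 2 3 4; use Dn0 in auto)+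
  qed
  have cReIm: "continuous_on (I \<times> J) (\<lambda>(r,t). Re (F r t))" "continuous_on (I \<times> J) (\<lambda>(r,t). Im (F r t))"
    if "continuous_on (I \<times> J) (\<lambda>(r,t). F r t)" for F :: "real \<Rightarrow> real \<Rightarrow> complex"
    using continuous_on_Re[OF that] continuous_on_Im[OF that] by (simp_all add: case_prod_beta)
  have ca: "continuous_on (I \<times> J) (\<lambda>(r,t). a r t)" "continuous_on (I \<times> J) (\<lambda>(r,t). a1 r t)"
     "continuous_on (I \<times> J) (\<lambda>(r,t). \<beta>2 r t)"
  proof -
    have "Re (\<rho> (fst x) (snd x)) \<noteq> 0" if "x \<in> I \<times> J" for x using Re\<rho>(1)[of "fst x" "snd x"] that by force
    then show "continuous_on (I \<times> J) (\<lambda>(r,t). a r t)" "continuous_on (I \<times> J) (\<lambda>(r,t). a1 r t)"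
     "continuous_on (I \<times> J) (\<lambda>(r,t). \<beta>2 r t)"
      unfolding case_prod_beta a_def a1_def \<beta>2_def by (auto intro!: continuous_intros c\<rho>)
  qed
  have "\<exists>c>0. \<exists>k::nat. \<forall>r\<in>{0<..R1/2}. c * r ^ k \<le> integral J (\<lambda>t. (Re (q r t))\<^sup>2 + (Im (q r t))\<^sup>2)"
  proof (rule polar_frequency_growth[where R = R1 and C = C and ?u1.0 = "\<lambda>r t. Re (q1 r t)" and ?v1.0 = "\<lambda>r t. Im (q1 r t)"
      and ?u2.0 = "\<lambda>r t. Re (q2 r t)" and ?v2.0 = "\<lambda>r t. Im (q2 r t)"
      and ?u12.0 = "\<lambda>r t. Re (q12 r t)" and ?v12.0 = "\<lambda>r t. Im (q12 r t)"
      and a = a and ?a1.0 = a1 and b = \<beta> and ?b2.0 = \<beta>2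
      and e = "\<lambda>r t. Re (\<tau> r t * q r t)" and f = "\<lambda>r t. Im (\<tau> r t * q r t)", folded I_def J_def])
    show "0 < R1" "0 \<le> C" using R1 b0 by (auto simp: C_def)
    fix r t :: real assume r: "r \<in> I"
    show "((\<lambda>r. a r t) has_real_derivative a1 r t) (at r)"
      unfolding a_def a1_def by (rule has_real_derivative_Re_Im d\<rho>1 r)+
    show "((\<lambda>t. \<beta> r t) has_real_derivative \<beta>2 r t) (at t within J)"
      unfolding \<beta>_def \<beta>2_def
      by (rule derivative_eq_intros has_real_derivative_Re_Im d\<rho>2 r refl)+
         (use Re\<rho>[OF r, of t] in \<open>auto simp: power2_eq_square\<close>)
    show "1/2 \<le> a r t \<and> a r t \<le> 2" using Re\<rho>[OF r, of t] by (simp add: a_def)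
    show "\<bar>a1 r t\<bar> \<le> C" using n\<rho>1[OF r, of t] abs_Re_le_cmod[of "\<rho>1 r t"] b0 by (simp add: a1_def C_def)
    show "\<bar>\<beta>2 r t\<bar> \<le> C * r"
    proof -
      have i: "\<bar>Im (\<rho>2 r t)\<bar> \<le> 10 * b0 * r" "\<bar>Re (\<rho>2 r t)\<bar> \<le> 10 * b0 * r"
        using n\<rho>2[OF r, of t] abs_Re_le_cmod[of "\<rho>2 r t"] abs_Im_le_cmod[of "\<rho>2 r t"] by auto
      have "\<bar>Im (\<rho>2 r t) * Re (\<rho> r t) - Im (\<rho> r t) * Re (\<rho>2 r t)\<bar> \<le> (10 * b0 * r) * (3/2) + (1/2) * (10 * b0 * r)"
      proof (intro order.trans[OF abs_triangle_ineq4] add_mono)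
        show "\<bar>Im (\<rho>2 r t) * Re (\<rho> r t)\<bar> \<le> (10 * b0 * r) * (3/2)" "\<bar>Im (\<rho> r t) * Re (\<rho>2 r t)\<bar> \<le> (1/2) * (10 * b0 * r)"
          unfolding abs_mult using Re\<rho>[OF r, of t] i b0 rI[OF r] by (rule_tac mult_mono; auto)+
      qed
      moreover have "(1/2)\<^sup>2 \<le> (Re (\<rho> r t))\<^sup>2" using Re\<rho>[OF r, of t] by (intro power_mono) auto
      ultimately have "\<bar>Im (\<rho>2 r t) * Re (\<rho> r t) - Im (\<rho> r t) * Re (\<rho>2 r t)\<bar> / (Re (\<rho> r t))\<^sup>2 \<le> 
        ((10 * b0 * r) * (3/2) + (1/2) * (10 * b0 * r)) / (1/2)\<^sup>2"
        using b0 rI[OF r] by (intro frac_le) auto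
      then show ?thesis by (simp add: \<beta>2_def C_def power2_eq_square)
    qed
    show "(Re (\<tau> r t * q r t))\<^sup>2 + (Im (\<tau> r t * q r t))\<^sup>2 \<le> (C * r)\<^sup>2 * ((Re (q r t))\<^sup>2 + (Im (q r t))\<^sup>2)"
    proof -
      have "(norm (\<tau> r t * q r t))\<^sup>2 \<le> (C * r)\<^sup>2 * (norm (q r t))\<^sup>2"
        unfolding norm_mult power_mult_distrib[of "norm (\<tau> r t)"] using n\<tau>[OF r, of t] by (intro mult_right_mono power_mono) auto
      then show ?thesis by (simp only: cmod_power2)
    qed
    show "Im (q r t) = 0" if "t = 0 \<or> t = pi"
    proof -
      have t: "t \<in> J" using that by (auto simp: J_def)
      show ?thesis unfolding q_def using real[OF pz(1)[OF r t]] pz(4)[OF r t] that by auto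
    qed
    show "\<beta> r t = 0" if "t = 0 \<or> t = pi"
      using that by (auto simp: \<beta>_def \<rho>_def Bf_def)
    show "\<exists>t\<in>J. Re (q r t) \<noteq> 0 \<or> Im (q r t) \<noteq> 0"
    proof -
      obtain z where z: "z \<in> B" "norm z = r" "Q z \<noteq> 0" using nz[of r] r R1 by (auto simp: I_def)
      have "z = rcis (norm z) (Arg z)" by (simp add: rcis_cmod_Arg)
      then have "z = pz r (Arg z)" using z by (simp add: rcis_def pz_def)
      then have "q r (Arg z) \<noteq> 0" using z(3) by (simp add: q_def)
      moreover have "Arg z \<in> J" using z Arg_less_0[of z] Arg_le_pi[of z] by (auto simp: J_def B_def half_disc_def)
      ultimately show ?thesis by (auto simp: complex_eq_iff)
    qed
    assume t: "t \<in> J"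
    show "((\<lambda>r. Re (q r t)) has_real_derivative Re (q1 r t)) (at r)" 
      "((\<lambda>r. Im (q r t)) has_real_derivative Im (q1 r t)) (at r)"
      "((\<lambda>t. Re (q r t)) has_real_derivative Re (q2 r t)) (at t within J)" 
      "((\<lambda>t. Im (q r t)) has_real_derivative Im (q2 r t)) (at t within J)"
      "((\<lambda>t. Re (q1 r t)) has_real_derivative Re (q12 r t)) (at t within J)" 
      "((\<lambda>t. Im (q1 r t)) has_real_derivative Im (q12 r t)) (at t within J)"
      "((\<lambda>r. Re (q2 r t)) has_real_derivative Re (q12 r t)) (at r)" 
      "((\<lambda>r. Im (q2 r t)) has_real_derivative Im (q12 r t)) (at r)"
      using r t by (auto intro!: has_real_derivative_Re_Im dq1 dq2 dq12 dq21)
    have "Re (\<rho> r t) \<noteq> 0" using Re\<rho>[OF r, of t] by auto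
    then have ab: "a r t * (x + \<beta> r t * y) = Re (\<rho> r t) * x + Im (\<rho> r t) * y" for x y
      by (simp add: a_def \<beta>_def field_simps)
    show "r * Re (q1 r t) = a r t * (Im (q2 r t) + \<beta> r t * Re (q2 r t)) + Re (\<tau> r t * q r t)"
      "r * Im (q1 r t) = a r t * (- Re (q2 r t) + \<beta> r t * Im (q2 r t)) + Im (\<tau> r t * q r t)"
      unfolding ab using arg_cong[OF pde[OF r t], of Re] arg_cong[OF pde[OF r t], of Im]
      by (simp_all add: algebra_simps)
  qed (rule cReIm cq ca)+
  then obtain c k where c: "c > 0" "\<And>r. r \<in> {0<..R1/2} \<Longrightarrow> c * r ^ k \<le> integral J (\<lambda>t. (norm (q r t))\<^sup>2)"
    unfolding cmod_power2 by blast
  \<comment> \<open>From the mean to a point: were |Q|^2 below c r^k / (2 pi) on the whole half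
    circle, its integral over an angle pi would be at most c r^k / 2.\<close>
  have "\<exists>z\<in>B. norm z = r \<and> c / (2 * pi) * r ^ k \<le> (norm (Q z))\<^sup>2" if r: "r \<in> {0<..R1/2}" for r
  proof (rule ccontr)
    assume neg: "\<not> ?thesis"
    have rI': "r \<in> I" using r R1 by (auto simp: I_def)
    have "continuous_on J (q r)"
      unfolding continuous_on_eq_continuous_within
      using has_vector_derivative_continuous[OF dq2[OF rI']] by blast
    then have "integral J (\<lambda>t. (norm (q r t))\<^sup>2) \<le> integral J (\<lambda>t. c / (2 * pi) * r ^ k)"
      unfolding J_def
    proof (intro integral_le integrable_continuous_real continuous_intros)
      fix t assume "t \<in> {0..pi}"
      then have t: "t \<in> J" by (simp add: J_def)
      show "(norm (q r t))\<^sup>2 \<le> c / (2 * pi) * r ^ k"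
        using neg pz[OF rI' t] unfolding q_def by (meson linear)
    qed auto
    also have "\<dots> = c * r ^ k / 2" by (simp add: J_def)
    finally have "c * r ^ k \<le> c * r ^ k / 2" using c(2)[OF r] by linarith
    moreover have "c * r ^ k > 0" using c r by simp
    ultimately show False by linarith
  qed
  then show ?thesis using c R1
    by (intro exI[of _ "c / (2 * pi)"] conjI exI[of _ k] exI[of _ "R1/2"]) auto
qed


subsection \<open>Charts straightening a boundary curve\<close>

lemma half_disc_props:
  "convex (half_disc R)" "z \<in> half_disc R \<Longrightarrow> 0 \<le> t \<Longrightarrow> t \<le> 1 \<Longrightarrow> of_real t * z \<in> half_disc R"
  "R > 0 \<Longrightarrow> 0 \<in> half_disc R"
proof -
  have "half_disc R = ball 0 R \<inter> {z. 0 \<le> Im z}" by (auto simp: half_disc_def)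
  then show "convex (half_disc R)" by (simp add: convex_Int convex_halfspace_Im_ge)
  assume "z \<in> half_disc R" "0 \<le> t" "t \<le> 1"
  then have "t * norm z \<le> 1 * norm z" "norm z < R" "0 \<le> t * Im z" using mult_right_mono[of t 1 "norm z"] by (auto simp: half_disc_def)
  then show "of_real t * z \<in> half_disc R" using \<open>0 \<le> t\<close> by (simp add: half_disc_def norm_mult)
qed (simp add: half_disc_def)

text \<open>Subtract from \<open>f\<close> the linear map with the partials at \<open>z\<close>.
  Near \<open>z\<close>, in the open upper part, the remainder has derivative of norm at most e, so
  by convexity it has Lipschitz constant e there. Moving two points of the half disc up by i
  \<epsilon> and letting \<epsilon> tend to 0 carries the estimate over to the real axis.\<close>

lemma has_derivative_half_disc_boundary:
  fixes f ft fs :: "complex \<Rightarrow> complex"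
  assumes cont: "continuous_on (half_disc R) f" "continuous_on (half_disc R) ft" "continuous_on (half_disc R) fs"
    and der: "\<And>z. z \<in> half_disc R \<Longrightarrow> Im z > 0 \<Longrightarrow> (f has_derivative (\<lambda>h. Re h *\<^sub>R ft z + Im h *\<^sub>R fs z)) (at z)"
    and z: "z \<in> half_disc R"
  shows "(f has_derivative (\<lambda>h. Re h *\<^sub>R ft z + Im h *\<^sub>R fs z)) (at z within half_disc R)"
  unfolding has_derivative_within_alt
proof (intro conjI allI impI)
  have bl: "bounded_linear (\<lambda>h. Re h *\<^sub>R a + Im h *\<^sub>R b)" for a b :: complex
    by (intro bounded_linear_add bounded_linear_scaleR_left bounded_linear_compose[OF bounded_linear_scaleR_left]
        bounded_linear_Re bounded_linear_Im)
  show "bounded_linear (\<lambda>h. Re h *\<^sub>R ft z + Im h *\<^sub>R fs z)" by (rule bl)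
  fix e :: real assume e: "e > 0"
  obtain d1 where d1: "d1 > 0" "\<And>y. y \<in> half_disc R \<Longrightarrow> dist y z < d1 \<Longrightarrow> dist (ft y) (ft z) < e / 2"
    using cont(2) z e unfolding continuous_on_iff by (metis half_gt_zero)
  obtain d2 where d2: "d2 > 0" "\<And>y. y \<in> half_disc R \<Longrightarrow> dist y z < d2 \<Longrightarrow> dist (fs y) (fs z) < e / 2"
    using cont(3) z e unfolding continuous_on_iff by (metis half_gt_zero)
  define d where "d = min d1 d2"
  define A where "A = half_disc R \<inter> ball z d \<inter> {z. 0 < Im z}"
  define g where "g = (\<lambda>y. f y - (Re y *\<^sub>R ft z + Im y *\<^sub>R fs z))"
  have "convex A" unfolding A_def by (intro convex_Int half_disc_props(1) convex_ball convex_halfspace_Im_gt)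
  have bound: "norm (g x - g y) \<le> e * norm (x - y)" if xy: "x \<in> A" "y \<in> A" for x y
  proof (rule differentiable_bound[OF \<open>convex A\<close> _ _ xy])
    fix w assume w: "w \<in> A"
    then have w': "w \<in> half_disc R" "Im w > 0" "dist w z < d1" "dist w z < d2" by (auto simp: A_def d_def dist_commute)
    show "(g has_derivative (\<lambda>h. Re h *\<^sub>R (ft w - ft z) + Im h *\<^sub>R (fs w - fs z))) (at w within A)"
    proof -
      have "(g has_derivative (\<lambda>h. (Re h *\<^sub>R ft w + Im h *\<^sub>R fs w) - (Re h *\<^sub>R ft z + Im h *\<^sub>R fs z))) (at w within A)"
        unfolding g_def
        by (intro has_derivative_diff has_derivative_at_withinI[OF der[OF w'(1,2)]] bounded_linear_imp_has_derivative bl)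
      then show ?thesis by (simp add: algebra_simps)
    qed
    show "onorm (\<lambda>h. Re h *\<^sub>R (ft w - ft z) + Im h *\<^sub>R (fs w - fs z)) \<le> e"
    proof (rule onorm_le)
      fix h :: complex
      have "norm (Re h *\<^sub>R (ft w - ft z) + Im h *\<^sub>R (fs w - fs z)) \<le> \<bar>Re h\<bar> * norm (ft w - ft z) + \<bar>Im h\<bar> * norm (fs w - fs z)"
        by (intro norm_triangle_le) simp
      also have "\<dots> \<le> norm h * (e / 2) + norm h * (e / 2)"
        using d1(2)[OF w'(1,3)] d2(2)[OF w'(1,4)] 
        by (intro add_mono mult_mono abs_Re_le_cmod abs_Im_le_cmod) (auto simp: dist_norm)
      finally show "norm (Re h *\<^sub>R (ft w - ft z) + Im h *\<^sub>R (fs w - fs z)) \<le> e * norm h" by (simp add: mult.commute)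
    qed
  qed
  have cg: "continuous_on (half_disc R) g" unfolding g_def by (intro continuous_intros cont)
  have up: "\<forall>\<^sub>F \<epsilon> in at_right (0::real). y + \<i> * of_real \<epsilon> \<in> A" if "y \<in> half_disc R" "dist z y < d" for y
  proof -
    have 0: "((\<lambda>\<epsilon>. y + \<i> * of_real \<epsilon>) \<longlongrightarrow> y + \<i> * of_real 0) (at_right 0)" by (intro tendsto_intros)
    have "open (ball 0 R \<inter> ball z d)" by auto
    moreover have "y + \<i> * of_real 0 \<in> ball 0 R \<inter> ball z d" using that by (auto simp: half_disc_def)
    ultimately have "\<forall>\<^sub>F \<epsilon> in at_right 0. y + \<i> * of_real \<epsilon> \<in> ball 0 R \<inter> ball z d"
      using topological_tendstoD[OF 0] by blast
    moreover have "\<forall>\<^sub>F \<epsilon> in at_right (0::real). \<epsilon> > 0" by (simp add: eventually_at_right_less)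
    ultimately show ?thesis
      by eventually_elim (use that in \<open>auto simp: A_def half_disc_def\<close>)
  qed
  have lim: "((\<lambda>\<epsilon>. g (y + \<i> * of_real \<epsilon>)) \<longlongrightarrow> g y) (at_right 0)" if "y \<in> half_disc R" "dist z y < d" for y
  proof (rule continuous_within_tendsto_compose[of y "half_disc R" g])
    show "continuous (at y within half_disc R) g" using cg that continuous_on_eq_continuous_within by blast
    show "\<forall>\<^sub>F \<epsilon> in at_right (0::real). y + \<i> * of_real \<epsilon> \<in> half_disc R"
      using up[OF that] by eventually_elim (auto simp: A_def)
    have "((\<lambda>\<epsilon>. y + \<i> * of_real \<epsilon>) \<longlongrightarrow> y + \<i> * of_real 0) (at_right 0)" by (intro tendsto_intros)
    then show "((\<lambda>\<epsilon>. y + \<i> * of_real \<epsilon>) \<longlongrightarrow> y) (at_right 0)" by simp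
  qed
  have "norm (f y - f z - (Re (y - z) *\<^sub>R ft z + Im (y - z) *\<^sub>R fs z)) \<le> e * norm (y - z)"
    if y: "y \<in> half_disc R" "norm (y - z) < d" for y
  proof -
    have y': "dist z y < d" "dist z z < d" using y d1 d2 by (auto simp: dist_norm norm_minus_commute d_def)
    have "norm (g y - g z) \<le> e * norm (y - z)"
    proof (rule tendsto_upperbound)
      show "((\<lambda>\<epsilon>. norm (g (y + \<i> * of_real \<epsilon>) - g (z + \<i> * of_real \<epsilon>))) \<longlongrightarrow> norm (g y - g z)) (at_right 0)"
        by (intro tendsto_intros lim y z y')
      show "\<forall>\<^sub>F \<epsilon> in at_right 0. norm (g (y + \<i> * of_real \<epsilon>) - g (z + \<i> * of_real \<epsilon>)) \<le> e * norm (y - z)"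
        using up[OF y(1) y'(1)] up[OF z y'(2)] by eventually_elim (use bound in fastforce)
    qed simp
    then show ?thesis by (simp add: g_def algebra_simps)
  qed
  then show "\<exists>d>0. \<forall>y\<in>half_disc R. norm (y - z) < d \<longrightarrow>
      norm (f y - f z - (Re (y - z) *\<^sub>R ft z + Im (y - z) *\<^sub>R fs z)) \<le> e * norm (y - z)"
    using d1 d2 by (intro exI[of _ d]) (auto simp: d_def)
qed

section \<open>Real partial derivatives in the plane\<close>

lemma has_partials_mult:
  fixes f g :: "complex \<Rightarrow> complex"
  assumes "(f has_derivative (\<lambda>h. Re h *\<^sub>R ft + Im h *\<^sub>R fs)) (at z within B)"
    and "(g has_derivative (\<lambda>h. Re h *\<^sub>R gt + Im h *\<^sub>R gs)) (at z within B)"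
  shows "((\<lambda>z. f z * g z) has_derivative (\<lambda>h. Re h *\<^sub>R (ft * g z + f z * gt) + Im h *\<^sub>R (fs * g z + f z * gs))) (at z within B)"
  using has_derivative_mult[OF assms] by (simp add: scaleR_conv_of_real algebra_simps)

lemma has_partials_add:
  fixes f g :: "complex \<Rightarrow> complex"
  assumes "(f has_derivative (\<lambda>h. Re h *\<^sub>R ft + Im h *\<^sub>R fs)) (at z within B)"
    and "(g has_derivative (\<lambda>h. Re h *\<^sub>R gt + Im h *\<^sub>R gs)) (at z within B)"
  shows "((\<lambda>z. f z + g z) has_derivative (\<lambda>h. Re h *\<^sub>R (ft + gt) + Im h *\<^sub>R (fs + gs))) (at z within B)"
  using has_derivative_add[OF assms] by (simp add: algebra_simps)

lemma has_partials_basic: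
  fixes k :: "real \<Rightarrow> complex" and a :: complex
  shows "((\<lambda>z. a) has_derivative (\<lambda>h. Re h *\<^sub>R 0 + Im h *\<^sub>R (0::complex))) (at z within B)"
    and "((\<lambda>z. of_real (Im z)) has_derivative (\<lambda>h. Re h *\<^sub>R 0 + Im h *\<^sub>R (1::complex))) (at z within B)"
    and "(k has_vector_derivative k') (at (Re z)) \<Longrightarrow>
      ((\<lambda>z. k (Re z)) has_derivative (\<lambda>h. Re h *\<^sub>R k' + Im h *\<^sub>R 0)) (at z within B)"
proof -
  show "((\<lambda>z. of_real (Im z)) has_derivative (\<lambda>h. Re h *\<^sub>R 0 + Im h *\<^sub>R (1::complex))) (at z within B)"
    by (rule has_derivative_eq_rhs) (auto intro!: derivative_eq_intros simp: scaleR_conv_of_real)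
  assume "(k has_vector_derivative k') (at (Re z))"
  from has_derivative_compose[OF bounded_linear.has_derivative[OF bounded_linear_Re has_derivative_ident] this[unfolded has_vector_derivative_def]]
  show "((\<lambda>z. k (Re z)) has_derivative (\<lambda>h. Re h *\<^sub>R k' + Im h *\<^sub>R 0)) (at z within B)" by simp
qed simp

text \<open>The coordinate \<open>Re z\<close> runs along the curve and \<open>Im z\<close> along
  its left normal, scaled by the speed. The partials are c1 + i s c2 and i c1, where s =
  \<open>Im z\<close>, so the Cauchy--Riemann equations hold exactly on the real axis and fail by
  O(s) off it.\<close>

definition normal_chart :: "(real \<Rightarrow> complex) \<Rightarrow> (real \<Rightarrow> complex) \<Rightarrow> complex \<Rightarrow> complex" where
  "normal_chart c c1 z = c (Re z) + \<i> * of_real (Im z) * c1 (Re z)"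

lemma normal_chart_0: "normal_chart c c1 0 = c 0"
  by (simp add: normal_chart_def)

lemma normal_chart_of_real: "normal_chart c c1 (of_real t) = c t"
  by (simp add: normal_chart_def)

lemma normal_chart_partials:
  assumes "\<And>t. (c has_vector_derivative c1 t) (at t)" "\<And>t. (c1 has_vector_derivative c2 t) (at t)"
  shows "(normal_chart c c1 has_derivative
      (\<lambda>h. Re h *\<^sub>R (c1 (Re z) + \<i> * of_real (Im z) * c2 (Re z)) + Im h *\<^sub>R (\<i> * c1 (Re z)))) (at z within B)"
proof -
  note * = has_partials_add[OF has_partials_basic(3)[OF assms(1)]
      has_partials_mult[OF has_partials_mult[OF has_partials_basic(1) has_partials_basic(2)] has_partials_basic(3)[OF assms(2)]]]
  show ?thesis unfolding normal_chart_def[abs_def] by (rule has_derivative_eq_rhs[OF *]) simp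
qed

text \<open>Here \<open>U\<close> is where the functions under study are differentiable and
  \<open>V\<close> where they are continuous; the axis of the half disc is mapped into
  \<open>V\<close> only. Three derivatives of the curve occur because the growth lemma takes second
  partials of a function that contains \<open>c1\<close> as a factor.\<close>

locale half_disc_chart =
  fixes c c1 c2 c3 :: "real \<Rightarrow> complex" and R :: real and U V :: "complex set" and \<Phi> :: "complex \<Rightarrow> complex"
  defines "\<Phi> \<equiv> normal_chart c c1"
  assumes c_der: "\<And>t. (c has_vector_derivative c1 t) (at t)" "\<And>t. (c1 has_vector_derivative c2 t) (at t)"
      "\<And>t. (c2 has_vector_derivative c3 t) (at t)"
    and c3_cont: "continuous_on UNIV c3"
    and regular: "\<And>t. c1 t \<noteq> 0"
    and R_pos: "R > 0"
    and into_U: "\<And>z. z \<in> half_disc R \<Longrightarrow> Im z > 0 \<Longrightarrow> \<Phi> z \<in> U"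
    and into_V: "\<And>z. z \<in> half_disc R \<Longrightarrow> \<Phi> z \<in> V"
begin

lemma c_cont: "continuous_on UNIV c" "continuous_on UNIV c1" "continuous_on UNIV c2"
  using c_der by (meson continuous_at_imp_continuous_on has_vector_derivative_continuous)+

lemma chart_partials:
  "(\<Phi> has_derivative (\<lambda>h. Re h *\<^sub>R (c1 (Re z) + \<i> * of_real (Im z) * c2 (Re z)) + Im h *\<^sub>R (\<i> * c1 (Re z)))) (at z within B)"
  unfolding \<Phi>_def by (rule normal_chart_partials[OF c_der(1,2)])

lemma chart_cont: "continuous_on B \<Phi>"
  by (rule has_derivative_continuous_on[OF chart_partials])

lemma compose_cont:
  assumes "continuous_on V g" shows "continuous_on (half_disc R) (\<lambda>z. g (\<Phi> z))"
  by (rule continuous_on_compose2[OF assms chart_cont]) (use into_V in auto)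

lemma curve_cont:
  assumes "continuous_on UNIV k" shows "continuous_on B (\<lambda>z. k (Re z))"
  by (rule continuous_on_compose2[OF assms]) (auto intro: continuous_intros)

text \<open>The chain rule applies only where the chart lands in \<open>U\<close>, above the axis.
  Since the resulting partials are continuous on the whole half disc,
  \<open>has_derivative_half_disc_boundary\<close> extends it to the axis.\<close>

lemma pullback_partials:
  assumes der: "\<And>z. z \<in> U \<Longrightarrow> (h has_field_derivative h1 z) (at z)"
    and cont: "continuous_on V h" "continuous_on V h1" and z: "z \<in> half_disc R"
  shows "((\<lambda>z. h (\<Phi> z)) has_derivative (\<lambda>e. Re e *\<^sub>R (h1 (\<Phi> z) * (c1 (Re z) + \<i> * of_real (Im z) * c2 (Re z)))
      + Im e *\<^sub>R (h1 (\<Phi> z) * (\<i> * c1 (Re z))))) (at z within half_disc R)"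
proof (rule has_derivative_half_disc_boundary[OF _ _ _ _ z, where ft = "\<lambda>z. h1 (\<Phi> z) * (c1 (Re z) + \<i> * of_real (Im z) * c2 (Re z))"
     and fs = "\<lambda>z. h1 (\<Phi> z) * (\<i> * c1 (Re z))"])
  fix w assume w: "w \<in> half_disc R" "Im w > 0"
  have "(h has_derivative (*) (h1 (\<Phi> w))) (at (\<Phi> w))"
    using der[OF into_U[OF w]] by (simp add: has_field_derivative_def)
  from has_derivative_compose[OF chart_partials this]
  show "((\<lambda>z. h (\<Phi> z)) has_derivative (\<lambda>e. Re e *\<^sub>R (h1 (\<Phi> w) * (c1 (Re w) + \<i> * of_real (Im w) * c2 (Re w)))
      + Im e *\<^sub>R (h1 (\<Phi> w) * (\<i> * c1 (Re w))))) (at w)"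
    by (simp add: algebra_simps)
qed (intro continuous_intros compose_cont curve_cont c_cont cont)+

text \<open>The unknown of the perturbed system is \<open>\<i> (G \<circ> \<Phi>) c1\<close>, with \<open>b = c2 / c1\<close>.\<close>

lemma finite_order_of_real_differential:
  assumes der: "\<And>z. z \<in> U \<Longrightarrow> (G has_field_derivative G1 z) (at z)" "\<And>z. z \<in> U \<Longrightarrow> (G1 has_field_derivative G2 z) (at z)"
    and cont: "continuous_on V G" "continuous_on V G1" "continuous_on V G2"
    and real: "\<And>t. \<bar>t\<bar> < R \<Longrightarrow> Im (\<i> * G (c t) * c1 t) = 0"
    and nz: "\<And>r. 0 < r \<Longrightarrow> r < R \<Longrightarrow> \<exists>z\<in>half_disc R. norm z = r \<and> G (\<Phi> z) \<noteq> 0"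
  shows "\<exists>k. (\<lambda>z. G (\<Phi> z)) \<notin> O[at 0 within half_disc R](\<lambda>z. z ^ k)"
proof -
  define B where "B = half_disc R"
  define A where "A = (\<lambda>z. c1 (Re z) + \<i> * of_real (Im z) * c2 (Re z))"
  have pG: "((\<lambda>z. G (\<Phi> z)) has_derivative (\<lambda>e. Re e *\<^sub>R (G1 (\<Phi> z) * A z) + Im e *\<^sub>R (G1 (\<Phi> z) * (\<i> * c1 (Re z))))) (at z within B)"
    and pG1: "((\<lambda>z. G1 (\<Phi> z)) has_derivative (\<lambda>e. Re e *\<^sub>R (G2 (\<Phi> z) * A z) + Im e *\<^sub>R (G2 (\<Phi> z) * (\<i> * c1 (Re z))))) (at z within B)"
    if "z \<in> B" for z
    using pullback_partials[of G G1 z] pullback_partials[of G1 G2 z] der cont that unfolding A_def B_def by blast+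
  have pA: "(A has_derivative (\<lambda>h. Re h *\<^sub>R (c2 (Re z) + \<i> * of_real (Im z) * c3 (Re z)) + Im h *\<^sub>R (\<i> * c2 (Re z)))) (at z within B)" for z
    unfolding A_def
    by (rule has_derivative_eq_rhs[OF has_partials_add[OF has_partials_basic(3)[OF c_der(2)]
      has_partials_mult[OF has_partials_mult[OF has_partials_basic(1) has_partials_basic(2)] has_partials_basic(3)[OF c_der(3)]]]]) simp
  note pc1 = has_partials_basic(3)[OF c_der(2), where B = B] and pc2 = has_partials_basic(3)[OF c_der(3), where B = B]
  define g0 g1 g2 where "g0 = (\<lambda>z. G (\<Phi> z))" and "g1 = (\<lambda>z. G1 (\<Phi> z))" and "g2 = (\<lambda>z. G2 (\<Phi> z))"
  define Q Qt Qs Qtt Qts Qss where "Q = (\<lambda>z. \<i> * (g0 z * c1 (Re z)))"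
    and "Qt = (\<lambda>z. \<i> * (g1 z * A z * c1 (Re z) + g0 z * c2 (Re z)))"
    and "Qs = (\<lambda>z. - 1 * (g1 z * (c1 (Re z) * c1 (Re z))))"
    and "Qtt = (\<lambda>z. \<i> * (g2 z * A z * A z * c1 (Re z) + g1 z * (c2 (Re z) + \<i> * of_real (Im z) * c3 (Re z)) * c1 (Re z)
        + 2 * g1 z * A z * c2 (Re z) + g0 z * c3 (Re z)))"
    and "Qts = (\<lambda>z. - (g2 z * A z * c1 (Re z) * c1 (Re z) + 2 * g1 z * c1 (Re z) * c2 (Re z)))"
    and "Qss = (\<lambda>z. - (\<i> * g2 z * c1 (Re z) * c1 (Re z) * c1 (Re z)))"
  define b where "b = (\<lambda>t. c2 t / c1 t)"
  have cA: "continuous_on B A" unfolding A_def by (intro continuous_intros curve_cont c_cont)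
  have cg: "continuous_on B g0" "continuous_on B g1" "continuous_on B g2"
    unfolding g0_def g1_def g2_def B_def by (intro compose_cont cont)+
  have "\<exists>c>0. \<exists>k::nat. \<exists>R'>0. \<forall>r\<in>{0<..R'}. \<exists>z\<in>B. norm z = r \<and> c * r ^ k \<le> (norm (Q z))\<^sup>2"
  proof (rule half_disc_growth[where R = R and Q = Q and b = b and b' = "\<lambda>t. (c3 t * c1 t - c2 t * c2 t) / (c1 t)\<^sup>2"
         and Qt = Qt and Qs = Qs and Qtt = Qtt and Qts = Qts and Qss = Qss, folded B_def])
    show "R > 0" by (rule R_pos)
    fix z assume z: "z \<in> B"
    show "(Q has_derivative (\<lambda>h. Re h *\<^sub>R Qt z + Im h *\<^sub>R Qs z)) (at z within B)"
      unfolding Q_def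
      by (rule has_derivative_eq_rhs[OF has_partials_mult[OF has_partials_basic(1) has_partials_mult[OF pG[OF z, folded g0_def] pc1]]])
         (simp_all add: Qt_def Qs_def g1_def g0_def algebra_simps)
    show "(Qt has_derivative (\<lambda>h. Re h *\<^sub>R Qtt z + Im h *\<^sub>R Qts z)) (at z within B)"
      unfolding Qt_def
      by (rule has_derivative_eq_rhs[OF has_partials_mult[OF has_partials_basic(1)
            has_partials_add[OF has_partials_mult[OF has_partials_mult[OF pG1[OF z, folded g1_def] pA] pc1]
              has_partials_mult[OF pG[OF z, folded g0_def] pc2]]]])
         (simp_all add: Qtt_def Qts_def g0_def g1_def g2_def algebra_simps)
    show "(Qs has_derivative (\<lambda>h. Re h *\<^sub>R Qts z + Im h *\<^sub>R Qss z)) (at z within B)"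
      unfolding Qs_def
      by (rule has_derivative_eq_rhs[OF has_partials_mult[OF has_partials_basic(1)
            has_partials_mult[OF pG1[OF z, folded g1_def] has_partials_mult[OF pc1 pc1]]]])
         (simp_all add: Qts_def Qss_def g1_def g2_def algebra_simps)
    show "Im (Q z) = 0" if "Im z = 0"
    proof -
      have "\<Phi> z = c (Re z)" using that by (simp add: \<Phi>_def normal_chart_def)
      moreover have "\<bar>Re z\<bar> < R" using z abs_Re_le_cmod[of z] by (simp add: B_def half_disc_def)
      ultimately show ?thesis using real[of "Re z"] by (simp add: Q_def g0_def algebra_simps)
    qed
    \<comment> \<open>Subtracting b Q cancels the derivative that falls on the factor
      \<open>c1\<close>, and \<open>A\<close> is \<open>c1\<close> times 1 + i s b; both sides are
      therefore - g1 A c1.\<close>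
    show "(1 + \<i> * of_real (Im z) * b (Re z)) * Qs z = \<i> * (Qt z - b (Re z) * Q z)"
      using regular[of "Re z"] by (simp add: Qs_def Qt_def Q_def b_def A_def field_simps)
  next
    fix t show "(b has_vector_derivative (c3 t * c1 t - c2 t * c2 t) / (c1 t)\<^sup>2) (at t)"
      unfolding b_def by (rule has_vector_derivative_quotient c_der regular)+
  next
    fix r assume "0 < r" "r < R"
    then show "\<exists>z\<in>B. norm z = r \<and> Q z \<noteq> 0" using nz[of r] regular by (auto simp: Q_def g0_def B_def)
  qed (use regular in \<open>auto simp: Qtt_def Qts_def Qss_def intro!: continuous_intros curve_cont c_cont c3_cont cA cg\<close>)
  then obtain e k R' where e: "e > 0" "R' > 0" "\<And>r. r \<in> {0<..R'} \<Longrightarrow> \<exists>z\<in>B. norm z = r \<and> e * r ^ k \<le> (norm (Q z))\<^sup>2"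
    by blast
  have "(\<lambda>z. G (\<Phi> z)) \<notin> O[at 0 within half_disc R](\<lambda>z. z ^ (k + 1))"
  proof
    assume "(\<lambda>z. G (\<Phi> z)) \<in> O[at 0 within half_disc R](\<lambda>z. z ^ (k + 1))"
    moreover have "(\<lambda>z. \<i> * c1 (Re z)) \<in> O[at 0 within half_disc R](\<lambda>_. 1)"
    proof (rule bigoI_tendsto)
      have "continuous (at 0) (\<lambda>z. \<i> * c1 (Re z))"
        using curve_cont[OF c_cont(2), of UNIV] by (intro continuous_intros) (simp add: continuous_on_eq_continuous_at)
      then show "((\<lambda>z. \<i> * c1 (Re z) / 1) \<longlongrightarrow> \<i> * c1 (Re 0)) (at 0 within half_disc R)"
        by (simp add: continuous_at tendsto_within_subset[of _ _ _ UNIV])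
    qed auto
    ultimately have "(\<lambda>z. (\<i> * c1 (Re z)) * G (\<Phi> z)) \<in> O[at 0 within half_disc R](\<lambda>z. 1 * z ^ (k + 1))"
      using landau_o.big.mult by blast
    then have "Q \<in> O[at 0 within half_disc R](\<lambda>z. z ^ (k + 1))" by (simp add: Q_def g0_def mult_ac)
    then obtain C where C: "C > 0" "\<forall>\<^sub>F z in at 0 within half_disc R. norm (Q z) \<le> C * norm (z ^ (k + 1))"
      by (auto elim: landau_o.bigE)
    then obtain d where d: "d > 0" "\<And>z. z \<in> half_disc R \<Longrightarrow> z \<noteq> 0 \<Longrightarrow> norm z < d \<Longrightarrow> norm (Q z) \<le> C * norm z ^ (k + 1)"
      unfolding eventually_at by (auto simp: dist_norm norm_mult norm_power)
    \<comment> \<open>The lower bound for |Q|^2 is e r^k, the upper bound C^2 r^(2k + 2). The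
      entries 1 and e / (2 C^2) make the latter at most half of the former; \<open>R'\<close> and d
      / 2 keep r where both bounds hold.\<close>
    define r where "r = Min {R', d / 2, 1, e / (2 * C\<^sup>2)}"
    have r: "r > 0" "r \<le> R'" "r < d" "r \<le> 1" "r \<le> e / (2 * C\<^sup>2)" using e C(1) d by (auto simp: r_def)
    obtain z where z: "z \<in> B" "norm z = r" "e * r ^ k \<le> (norm (Q z))\<^sup>2" using e(3)[of r] r by auto
    have "norm (Q z) \<le> C * r ^ (k + 1)" using d(2)[of z] z r by (auto simp: B_def)
    then have "(norm (Q z))\<^sup>2 \<le> (C * r ^ (k + 1))\<^sup>2" by (intro power_mono) auto
    with z have "e * r ^ k \<le> (C * r ^ (k + 1))\<^sup>2" by linarith
    also have "\<dots> = C\<^sup>2 * r ^ k * r * (r ^ (k + 1))" by (simp add: power2_eq_square)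
    also have "\<dots> \<le> C\<^sup>2 * r ^ k * (e / (2 * C\<^sup>2)) * 1" using r e C power_le_one[of r "k + 1"] by (intro mult_mono) auto
    also have "\<dots> = e * r ^ k / 2" using C by (simp add: power2_eq_square)
    finally show False using e(1) r(1) mult_pos_pos[of e "r ^ k"] by simp
  qed
  then show ?thesis by blast
qed

end


section \<open>Taylor expansion and leading terms at a boundary point\<close>

context half_disc_chart begin

lemma chart_0: "\<Phi> 0 = c 0"
  by (simp add: \<Phi>_def normal_chart_0)

text \<open>At the origin the partials are \<open>c1 0\<close> and i times it, so the chart is
  complex differentiable there. This lets powers of z replace powers of \<Phi> z - c 0 in
  expansions.\<close>

lemma chart_quotient: "((\<lambda>z. (\<Phi> z - c 0) / z) \<longlongrightarrow> c1 0) (at 0 within B)"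
proof -
  have "(\<Phi> has_derivative (*) (c1 0)) (at 0 within B)"
    by (rule has_derivative_eq_rhs[OF chart_partials]) (auto simp: fun_eq_iff complex_eq_iff algebra_simps)
  then have "(\<Phi> has_field_derivative c1 0) (at 0 within B)" by (simp add: has_field_derivative_def)
  then show ?thesis by (simp add: has_field_derivative_iff chart_0)
qed

lemma bigo_of_continuous:
  assumes "continuous_on (half_disc R) g"
  shows "g \<in> O[at 0 within half_disc R](\<lambda>_. 1::complex)"
proof (rule bigoI_tendsto)
  have "(g \<longlongrightarrow> g 0) (at 0 within half_disc R)"
    using assms half_disc_props(3)[OF R_pos] by (auto simp: continuous_on_def)
  then show "((\<lambda>z. g z / 1) \<longlongrightarrow> g 0) (at 0 within half_disc R)" by simp
qed auto

text \<open>The segment from 0 to z stays in the half disc, and along it the velocity of h \<circ>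
  \<Phi> is bounded by |z| times the bounds of the two partials. Integration thus gains one power of
  z.\<close>

lemma bigo_of_derivative:
  assumes der: "\<And>z. z \<in> U \<Longrightarrow> (h has_field_derivative h1 z) (at z)"
    and cont: "continuous_on V h" "continuous_on V h1" and h0: "h (c 0) = 0"
    and big: "(\<lambda>z. h1 (\<Phi> z)) \<in> O[at 0 within half_disc R](\<lambda>z. z ^ n)"
  shows "(\<lambda>z. h (\<Phi> z)) \<in> O[at 0 within half_disc R](\<lambda>z. z ^ Suc n)"
proof -
  define A where "A = (\<lambda>z. c1 (Re z) + \<i> * of_real (Im z) * c2 (Re z))"
  have "(\<lambda>z. h1 (\<Phi> z) * A z) \<in> O[at 0 within half_disc R](\<lambda>z. z ^ n * 1)"
    "(\<lambda>z. h1 (\<Phi> z) * (\<i> * c1 (Re z))) \<in> O[at 0 within half_disc R](\<lambda>z. z ^ n * 1)"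
    unfolding A_def by (intro landau_o.big.mult big bigo_of_continuous continuous_intros curve_cont c_cont)+
  then obtain C D where C: "C > 0" "\<forall>\<^sub>F z in at 0 within half_disc R. norm (h1 (\<Phi> z) * A z) \<le> C * norm (z ^ n)"
      and D: "D > 0" "\<forall>\<^sub>F z in at 0 within half_disc R. norm (h1 (\<Phi> z) * (\<i> * c1 (Re z))) \<le> D * norm (z ^ n)"
    by (auto elim!: landau_o.bigE)
  from eventually_conj[OF C(2) D(2)] obtain d where d: "d > 0"
    "\<And>z. z \<in> half_disc R \<Longrightarrow> z \<noteq> 0 \<Longrightarrow> norm z < d \<Longrightarrow> norm (h1 (\<Phi> z) * A z) \<le> C * norm z ^ n"
    "\<And>z. z \<in> half_disc R \<Longrightarrow> z \<noteq> 0 \<Longrightarrow> norm z < d \<Longrightarrow> norm (h1 (\<Phi> z) * (\<i> * c1 (Re z))) \<le> D * norm z ^ n"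
    unfolding eventually_at by (auto simp: dist_norm norm_power)
  have "norm (h (\<Phi> z)) \<le> (C + D) * norm (z ^ Suc n)" if z: "z \<in> half_disc R" "z \<noteq> 0" "norm z < d" for z
  proof -
    have in_B: "of_real t * z \<in> half_disc R" if "0 \<le> t" "t \<le> 1" for t by (rule half_disc_props(2)[OF z(1) that])
    define k where "k = (\<lambda>t. h (\<Phi> (of_real t * z)))"
    define k' where "k' = (\<lambda>t. Re z *\<^sub>R (h1 (\<Phi> (of_real t * z)) * A (of_real t * z))
        + Im z *\<^sub>R (h1 (\<Phi> (of_real t * z)) * (\<i> * c1 (Re (of_real t * z)))))"
    have "norm (k 1 - k 0) \<le> 1 * ((C + D) * norm z ^ Suc n) - 0 * ((C + D) * norm z ^ Suc n)"
    proof (rule differentiable_bound_general[where f' = k' and \<phi>' = "\<lambda>_. (C + D) * norm z ^ Suc n"])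
      show "continuous_on {0..1} k" unfolding k_def
        by (rule continuous_on_compose2[OF compose_cont[OF cont(1)]]) (use in_B in \<open>auto intro!: continuous_intros\<close>)
      fix t :: real assume t: "0 < t" "t < 1"
      have "((\<lambda>t. h (\<Phi> (of_real t * z))) has_vector_derivative k' t) (at t within {0<..<1})"
        unfolding k'_def A_def
        by (rule has_vector_derivative_compose_within[OF pullback_partials[OF der cont in_B]])
           (use t in_B in \<open>auto intro!: derivative_eq_intros\<close>)
      then show "(k has_vector_derivative k' t) (at t)"
        using t at_within_open[of t "{0<..<1}"] by (simp add: k_def)
      have tz: "of_real t * z \<in> half_disc R" "of_real t * z \<noteq> 0" "norm (of_real t * z) \<le> norm z"
        using in_B[of t] t z mult_right_mono[of t 1 "norm z"] by (auto simp: norm_mult)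
      then have "norm (of_real t * z) ^ n \<le> norm z ^ n" by (intro power_mono) auto
      then have CD: "C * norm (of_real t * z) ^ n \<le> C * norm z ^ n" "D * norm (of_real t * z) ^ n \<le> D * norm z ^ n"
        using C(1) D(1) by auto
      have "norm (k' t) \<le> \<bar>Re z\<bar> * norm (h1 (\<Phi> (of_real t * z)) * A (of_real t * z))
          + \<bar>Im z\<bar> * norm (h1 (\<Phi> (of_real t * z)) * (\<i> * c1 (Re (of_real t * z))))"
        unfolding k'_def by (intro norm_triangle_le add_mono) (simp only: norm_scaleR order.refl)+
      also have "\<dots> \<le> norm z * (C * norm z ^ n) + norm z * (D * norm z ^ n)"
        using d(2)[OF tz(1,2)] d(3)[OF tz(1,2)] CD tz(3) z(3)
        by (intro add_mono mult_mono abs_Re_le_cmod abs_Im_le_cmod) (auto simp del: of_real_mult)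
      finally show "norm (k' t) \<le> (C + D) * norm z ^ Suc n" by (simp add: algebra_simps)
    qed (auto intro!: continuous_intros derivative_eq_intros)
    then show ?thesis by (simp add: k_def chart_0 h0 norm_mult norm_power)
  qed
  then show ?thesis
    using d(1) by (intro landau_o.bigI[of "C + D"]) (auto simp: eventually_at dist_norm C(1) D(1) add_pos_pos intro!: exI[of _ d])
qed

text \<open>Induction over all chains at once: the hypothesis for the shifted chain estimates the
  derivative of the remainder, the remainder vanishes at c 0, and \<open>bigo_of_derivative\<close>
  integrates.\<close>

lemma taylor_at_boundary:
  assumes "\<And>k z. z \<in> U \<Longrightarrow> (D k has_field_derivative D (Suc k) z) (at z)" "\<And>k. continuous_on V (D k)"
  shows "(\<lambda>z. D 0 (\<Phi> z) - (\<Sum>i<n. D i (c 0) / fact i * (\<Phi> z - c 0) ^ i)) \<in> O[at 0 within half_disc R](\<lambda>z. z ^ n)"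
  using assms
proof (induction n arbitrary: D)
  case 0
  then show ?case using bigo_of_continuous[OF compose_cont[OF 0(2)]] by simp
next
  case (Suc n)
  have "(\<lambda>z. D (Suc 0) (\<Phi> z) - (\<Sum>i<n. D (Suc i) (c 0) / fact i * (\<Phi> z - c 0) ^ i)) \<in> O[at 0 within half_disc R](\<lambda>z. z ^ n)"
    using Suc.IH[of "\<lambda>k. D (Suc k)"] Suc.prems by simp
  moreover have "((\<lambda>z. D 0 z - (\<Sum>i<Suc n. D i (c 0) / fact i * (z - c 0) ^ i)) has_field_derivative
        D (Suc 0) z - (\<Sum>i<n. D (Suc i) (c 0) / fact i * (z - c 0) ^ i)) (at z)" if "z \<in> U" for z
  proof (rule DERIV_diff[OF Suc.prems(1)[OF that]])
    have "((\<lambda>z. D 0 (c 0) + (\<Sum>i<n. D (Suc i) (c 0) / fact (Suc i) * (z - c 0) ^ Suc i)) has_field_derivative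
       0 + (\<Sum>i<n. D (Suc i) (c 0) / fact i * (z - c 0) ^ i)) (at z)"
    proof (intro DERIV_add DERIV_sum DERIV_const)
      fix i
      have f: "(fact (Suc i) :: complex) = of_nat (Suc i) * fact i" "(of_nat (Suc i) :: complex) \<noteq> 0"
        by (simp, simp del: of_nat_Suc)
      have "((\<lambda>z. (z - c 0) ^ Suc i) has_field_derivative of_nat (Suc i) * (z - c 0) ^ i) (at z)"
        by (rule DERIV_cong[OF DERIV_power_Suc]) (auto intro!: derivative_eq_intros)
      from DERIV_cmult[OF this, of "D (Suc i) (c 0) / fact (Suc i)"]
      show "((\<lambda>z. D (Suc i) (c 0) / fact (Suc i) * (z - c 0) ^ Suc i) has_field_derivative
          D (Suc i) (c 0) / fact i * (z - c 0) ^ i) (at z)"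
        unfolding f(1) using f(2) by (simp del: of_nat_Suc)
    qed
    then show "((\<lambda>z. \<Sum>i<Suc n. D i (c 0) / fact i * (z - c 0) ^ i) has_field_derivative
       (\<Sum>i<n. D (Suc i) (c 0) / fact i * (z - c 0) ^ i)) (at z)"
      unfolding sum.lessThan_Suc_shift by simp
  qed
  ultimately show ?case
    by (intro bigo_of_derivative) (auto intro!: continuous_intros Suc.prems(2) simp: sum.lessThan_Suc_shift)
qed

text \<open>If all derivatives at c 0 vanish, the Taylor estimate is flatness. Otherwise m is the
  least order of a nonzero derivative, and s is D m (c 0) / m! times c1 0 ^ m, the power coming from
  \<open>chart_quotient\<close>.\<close>

lemma leading_order:
  assumes D: "\<And>k z. z \<in> U \<Longrightarrow> (D k has_field_derivative D (Suc k) z) (at z)" "\<And>k. continuous_on V (D k)"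
  shows "(\<forall>n. (\<lambda>z. D 0 (\<Phi> z)) \<in> O[at 0 within half_disc R](\<lambda>z. z ^ n)) \<or>
     (\<exists>m s. s \<noteq> 0 \<and> ((\<lambda>z. D 0 (\<Phi> z) / z ^ m) \<longlongrightarrow> s) (at 0 within half_disc R))"
proof (cases "\<forall>i. D i (c 0) = 0")
  case True
  then show ?thesis using taylor_at_boundary[of D, OF D] by simp
next
  case False
  define m where "m = (LEAST i. D i (c 0) \<noteq> 0)"
  have m: "D m (c 0) \<noteq> 0" unfolding m_def using False by (metis (mono_tags, lifting) LeastI)
  have lt: "D i (c 0) = 0" if "i < m" for i using that not_less_Least unfolding m_def by blast
  define a where "a = D m (c 0) / fact m"
  have "(\<lambda>z. D 0 (\<Phi> z) - a * (\<Phi> z - c 0) ^ m) \<in> O[at 0 within half_disc R](\<lambda>z. z ^ Suc m)"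
    using taylor_at_boundary[of D "Suc m", OF D] lt by (simp add: a_def)
  then obtain C where C: "C > 0" "\<forall>\<^sub>F z in at 0 within half_disc R. norm (D 0 (\<Phi> z) - a * (\<Phi> z - c 0) ^ m) \<le> C * norm (z ^ Suc m)"
    by (auto elim: landau_o.bigE)
  have "((\<lambda>z. D 0 (\<Phi> z) / z ^ m - a * ((\<Phi> z - c 0) / z) ^ m) \<longlongrightarrow> 0) (at 0 within half_disc R)"
  proof (rule Lim_null_comparison)
    have "\<forall>\<^sub>F z in at 0 within half_disc R. z \<noteq> 0" by (simp add: eventually_at_filter)
    with C(2) show "\<forall>\<^sub>F z in at 0 within half_disc R. norm (D 0 (\<Phi> z) / z ^ m - a * ((\<Phi> z - c 0) / z) ^ m) \<le> C * norm z"
    proof eventually_elim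
      case (elim z)
      have "D 0 (\<Phi> z) / z ^ m - a * ((\<Phi> z - c 0) / z) ^ m = (D 0 (\<Phi> z) - a * (\<Phi> z - c 0) ^ m) / z ^ m"
        by (subst power_divide, simp only: times_divide_eq_right diff_divide_distrib)
      then show ?case using elim by (simp add: norm_divide norm_power norm_mult field_simps)
    qed
    show "((\<lambda>z. C * norm z) \<longlongrightarrow> 0) (at 0 within half_disc R)"
      by (rule tendsto_eq_intros refl)+ simp
  qed
  moreover have "((\<lambda>z. a * ((\<Phi> z - c 0) / z) ^ m) \<longlongrightarrow> a * c1 0 ^ m) (at 0 within half_disc R)"
    by (intro tendsto_intros chart_quotient)
  ultimately have "((\<lambda>z. D 0 (\<Phi> z) / z ^ m) \<longlongrightarrow> 0 + a * c1 0 ^ m) (at 0 within half_disc R)"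
    using tendsto_add by fastforce
  moreover have "a * c1 0 ^ m \<noteq> 0" using m regular by (simp add: a_def)
  ultimately show ?thesis unfolding add_0 by blast
qed

text \<open>If one factor were flat at 0, so would be the product, the other factor being bounded;
  \<open>finite_order_of_real_differential\<close> forbids this. Hence both factors have leading
  terms, and the modulus of the quotient of these is read off on the axis. The second conclusion
  serves to identify F with the quotient near the boundary point.\<close>

lemma norm_quotient_tendsto:
  assumes S: "\<And>k z. z \<in> U \<Longrightarrow> (S k has_field_derivative S (Suc k) z) (at z)" "\<And>k. continuous_on V (S k)"
    and L: "\<And>k z. z \<in> U \<Longrightarrow> (L k has_field_derivative L (Suc k) z) (at z)" "\<And>k. continuous_on V (L k)"
    and bdry: "\<And>t. \<bar>t\<bar> < R \<Longrightarrow> norm (S 0 (c t)) * \<phi> (c t) = norm (L 0 (c t))"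
    and real: "\<And>t. \<bar>t\<bar> < R \<Longrightarrow> Im (\<i> * (S 0 (c t) * L 0 (c t)) * c1 t) = 0"
    and nz: "\<And>r. 0 < r \<Longrightarrow> r < R \<Longrightarrow> \<exists>z\<in>half_disc R. norm z = r \<and> S 0 (\<Phi> z) * L 0 (\<Phi> z) \<noteq> 0"
    and \<phi>: "isCont (\<lambda>t. \<phi> (c t)) 0" "\<phi> (c 0) > 0"
  shows "((\<lambda>z. norm (S 0 (\<Phi> z) / L 0 (\<Phi> z))) \<longlongrightarrow> 1 / \<phi> (c 0)) (at 0 within half_disc R)"
    and "\<forall>\<^sub>F z in at 0 within half_disc R. L 0 (\<Phi> z) \<noteq> 0"
proof -
  let ?F = "at 0 within half_disc R"
  obtain k where k: "(\<lambda>z. S 0 (\<Phi> z) * L 0 (\<Phi> z)) \<notin> O[?F](\<lambda>z. z ^ k)"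
  proof -
    have "\<exists>k. (\<lambda>z. S 0 (\<Phi> z) * L 0 (\<Phi> z)) \<notin> O[?F](\<lambda>z. z ^ k)"
    proof (rule finite_order_of_real_differential[where G = "\<lambda>z. S 0 z * L 0 z"])
      fix z assume z: "z \<in> U"
      have d: "(S 0 has_field_derivative S 1 z) (at z)" "(S 1 has_field_derivative S 2 z) (at z)"
        "(L 0 has_field_derivative L 1 z) (at z)" "(L 1 has_field_derivative L 2 z) (at z)"
        using S(1)[OF z, of 0] S(1)[OF z, of 1] L(1)[OF z, of 0] L(1)[OF z, of 1] by (simp_all add: numeral_2_eq_2)
      show "((\<lambda>z. S 0 z * L 0 z) has_field_derivative (S 1 z * L 0 z + S 0 z * L 1 z)) (at z)"
        by (rule DERIV_cong[OF DERIV_mult[OF d(1,3)]]) (simp add: algebra_simps)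
      show "((\<lambda>z. S 1 z * L 0 z + S 0 z * L 1 z) has_field_derivative
          (S 2 z * L 0 z + 2 * S 1 z * L 1 z + S 0 z * L 2 z)) (at z)"
        by (rule DERIV_cong[OF DERIV_add[OF DERIV_mult[OF d(2,3)] DERIV_mult[OF d(1,4)]]])
           (simp add: algebra_simps)
    qed (use real nz in \<open>auto intro!: continuous_intros S(2) L(2)\<close>)
    then show ?thesis using that by blast
  qed
  have bS: "(\<lambda>z. S 0 (\<Phi> z)) \<in> O[?F](\<lambda>_. 1)" and bL: "(\<lambda>z. L 0 (\<Phi> z)) \<in> O[?F](\<lambda>_. 1)"
    by (intro bigo_of_continuous compose_cont S L)+
  have "\<not> (\<forall>n. (\<lambda>z. S 0 (\<Phi> z)) \<in> O[?F](\<lambda>z. z ^ n))"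
    using landau_o.big.mult[OF _ bL, of "\<lambda>z. S 0 (\<Phi> z)" "\<lambda>z. z ^ k"] k by auto
  then obtain m s where s: "s \<noteq> 0" "((\<lambda>z. S 0 (\<Phi> z) / z ^ m) \<longlongrightarrow> s) ?F"
    using leading_order[of S, OF S] by blast
  have "\<not> (\<forall>n. (\<lambda>z. L 0 (\<Phi> z)) \<in> O[?F](\<lambda>z. z ^ n))"
    using landau_o.big.mult[OF bS, of "\<lambda>z. L 0 (\<Phi> z)" "\<lambda>z. z ^ k"] k by auto
  then obtain l b where b: "b \<noteq> 0" "((\<lambda>z. L 0 (\<Phi> z) / z ^ l) \<longlongrightarrow> b) ?F"
    using leading_order[of L, OF L] by blast
  \<comment> \<open>The positive real ray belongs to the half disc and is mapped to the curve.
    Limits on the half disc can be restricted to it, where \<open>bdry\<close> compares the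
    moduli.\<close>
  have ray: "filterlim (\<lambda>t. of_real t) ?F (at_right 0)"
    unfolding filterlim_at
  proof (intro conjI)
    show "((\<lambda>t. complex_of_real t) \<longlongrightarrow> 0) (at_right 0)" by (rule tendsto_eq_intros refl)+ simp
    have "\<forall>\<^sub>F t in at_right 0. t \<in> {0<..<R}" by (rule eventually_at_right_real[OF R_pos])
    then show "\<forall>\<^sub>F t in at_right 0. complex_of_real t \<in> half_disc R \<and> complex_of_real t \<noteq> 0"
      by eventually_elim (auto simp: half_disc_def)
  qed
  have ev: "\<forall>\<^sub>F t in at_right 0. t \<in> {0<..<R}" by (rule eventually_at_right_real[OF R_pos])
  have \<Phi>r: "\<Phi> (of_real t) = c t" for t by (simp add: \<Phi>_def normal_chart_of_real)
  have sr: "((\<lambda>t. norm (S 0 (c t)) / t ^ m) \<longlongrightarrow> norm s) (at_right 0)"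
    by (rule Lim_transform_eventually[OF tendsto_norm[OF filterlim_compose[OF s(2) ray]]])
       (use ev in \<open>eventually_elim, auto simp: \<Phi>r norm_divide norm_power\<close>)
  have br: "((\<lambda>t. norm (L 0 (c t)) / t ^ l) \<longlongrightarrow> norm b) (at_right 0)"
    by (rule Lim_transform_eventually[OF tendsto_norm[OF filterlim_compose[OF b(2) ray]]])
       (use ev in \<open>eventually_elim, auto simp: \<Phi>r norm_divide norm_power\<close>)
  have \<phi>r: "((\<lambda>t. \<phi> (c t)) \<longlongrightarrow> \<phi> (c 0)) (at_right 0)"
    using \<phi>(1) by (simp add: isCont_def filterlim_at_split)
  have p0: "((\<lambda>t::real. t ^ j) \<longlongrightarrow> 0) (at_right 0)" if "j > 0" for j
    by (rule tendsto_eq_intros refl)+ (use that in auto)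
  \<comment> \<open>For m < l, the boundary relation divided by t^m has a left side tending to |s|
    \<phi> (c 0), which is nonzero, and a right side tending to 0.\<close>
  have ml: "\<not> m < l"
  proof
    assume "m < l"
    then have "((\<lambda>t. norm (L 0 (c t)) / t ^ l * t ^ (l - m)) \<longlongrightarrow> norm b * 0) (at_right 0)"
      by (intro tendsto_mult br p0) auto
    then have "((\<lambda>t. norm (S 0 (c t)) / t ^ m * \<phi> (c t)) \<longlongrightarrow> norm b * 0) (at_right 0)"
    proof (rule Lim_transform_eventually)
      show "\<forall>\<^sub>F t in at_right 0. norm (L 0 (c t)) / t ^ l * t ^ (l - m) = norm (S 0 (c t)) / t ^ m * \<phi> (c t)"
        using ev by eventually_elim (use \<open>m < l\<close> bdry in \<open>auto simp: power_diff field_simps\<close>)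
    qed
    from tendsto_unique[OF _ this tendsto_mult[OF sr \<phi>r]] s \<phi> show False by simp
  qed
  have lm: "\<not> l < m"
  proof
    assume "l < m"
    then have "((\<lambda>t. norm (S 0 (c t)) / t ^ m * \<phi> (c t) * t ^ (m - l)) \<longlongrightarrow> norm s * \<phi> (c 0) * 0) (at_right 0)"
      by (intro tendsto_mult sr \<phi>r p0) auto
    then have "((\<lambda>t. norm (L 0 (c t)) / t ^ l) \<longlongrightarrow> norm s * \<phi> (c 0) * 0) (at_right 0)"
    proof (rule Lim_transform_eventually)
      show "\<forall>\<^sub>F t in at_right 0. norm (S 0 (c t)) / t ^ m * \<phi> (c t) * t ^ (m - l) = norm (L 0 (c t)) / t ^ l"
        using ev by eventually_elim (use \<open>l < m\<close> bdry in \<open>auto simp: power_diff field_simps\<close>)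
    qed
    from tendsto_unique[OF _ this br] b show False by simp
  qed
  have ml: "m = l" using ml lm by simp
  have "((\<lambda>t. norm (L 0 (c t)) / t ^ l) \<longlongrightarrow> norm s * \<phi> (c 0)) (at_right 0)"
    by (rule Lim_transform_eventually[OF tendsto_mult[OF sr \<phi>r]])
       (use ev in \<open>eventually_elim, use bdry ml in \<open>auto simp: field_simps\<close>\<close>)
  from tendsto_unique[OF _ this br] have sb: "norm s * \<phi> (c 0) = norm b" by simp
  have nz': "\<forall>\<^sub>F z in ?F. z \<noteq> 0" by (simp add: eventually_at_filter)
  have "((\<lambda>z. norm ((S 0 (\<Phi> z) / z ^ m) / (L 0 (\<Phi> z) / z ^ l))) \<longlongrightarrow> norm (s / b)) ?F"
    by (intro tendsto_intros s b)
  then have "((\<lambda>z. norm (S 0 (\<Phi> z) / L 0 (\<Phi> z))) \<longlongrightarrow> norm (s / b)) ?F"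
    by (rule Lim_transform_eventually) (use nz' in \<open>eventually_elim, simp add: ml\<close>)
  moreover have "norm (s / b) = 1 / \<phi> (c 0)" using sb s \<phi>(2) by (simp add: norm_divide sb[symmetric])
  ultimately show "((\<lambda>z. norm (S 0 (\<Phi> z) / L 0 (\<Phi> z))) \<longlongrightarrow> 1 / \<phi> (c 0)) ?F" by simp
  have "\<forall>\<^sub>F z in ?F. L 0 (\<Phi> z) / z ^ l \<noteq> 0" using b by (rule tendsto_imp_eventually_ne[rotated])
  then show "\<forall>\<^sub>F z in ?F. L 0 (\<Phi> z) \<noteq> 0" by eventually_elim auto
qed

end


text \<open>Near 0 the chart differs from multiplication by \<open>c1 0\<close> by a map with
  Lipschitz constant 2 e, where e is a third of |c1 0|; the linear part expands distances by 3
  e.\<close>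

lemma normal_chart_inj:
  assumes der: "\<And>t. (c has_vector_derivative c1 t) (at t)" "\<And>t. (c1 has_vector_derivative c2 t) (at t)"
    and cont: "continuous_on UNIV c2" and c1: "c1 0 \<noteq> 0"
  shows "\<exists>d>0. inj_on (normal_chart c c1) (ball 0 d)"
proof -
  define e where "e = norm (c1 0) / 3"
  have e: "e > 0" using c1 by (simp add: e_def)
  have cc1: "continuous_on UNIV c1"
    using der(2) by (meson continuous_at_imp_continuous_on has_vector_derivative_continuous)
  have "continuous_on UNIV (\<lambda>z. c1 (Re z) + \<i> * of_real (Im z) * c2 (Re z))" "continuous_on UNIV (\<lambda>z. c1 (Re z))"
    by (intro continuous_intros continuous_on_compose2[OF cont] continuous_on_compose2[OF cc1]; simp)+
  then obtain d1 d2 where d: "d1 > 0" "d2 > 0"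
    "\<And>z. dist z 0 < d1 \<Longrightarrow> dist (c1 (Re z) + \<i> * of_real (Im z) * c2 (Re z)) (c1 0) < e"
    "\<And>z. dist z 0 < d2 \<Longrightarrow> dist (c1 (Re z)) (c1 0) < e"
    using e unfolding continuous_on_iff by (metis UNIV_I zero_complex.simps mult_zero_left mult_zero_right of_real_0 add.right_neutral)
  define d where "d = min d1 d2"
  define g where "g = (\<lambda>z. normal_chart c c1 z - c1 0 * z)"
  have bound: "norm (g x - g y) \<le> 2 * e * norm (x - y)" if xy: "x \<in> ball 0 d" "y \<in> ball 0 d" for x y
  proof (rule differentiable_bound[OF convex_ball _ _ xy])
    fix z :: complex assume z: "z \<in> ball 0 d"
    let ?D = "\<lambda>h. Re h *\<^sub>R (c1 (Re z) + \<i> * of_real (Im z) * c2 (Re z) - c1 0) + Im h *\<^sub>R (\<i> * (c1 (Re z) - c1 0))"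
    show "(g has_derivative ?D) (at z within ball 0 d)"
      unfolding g_def
      by (rule has_derivative_eq_rhs[OF has_derivative_diff[OF normal_chart_partials[OF der]
            bounded_linear.has_derivative[OF bounded_linear_mult_right has_derivative_ident]]])
         (auto simp: fun_eq_iff complex_eq_iff algebra_simps)
    show "onorm ?D \<le> 2 * e"
    proof (rule onorm_le)
      fix h :: complex
      have "norm (?D h) \<le> \<bar>Re h\<bar> * norm (c1 (Re z) + \<i> * of_real (Im z) * c2 (Re z) - c1 0) + \<bar>Im h\<bar> * norm (c1 (Re z) - c1 0)"
        by (intro norm_triangle_le) (simp add: norm_mult)
      also have "\<dots> \<le> norm h * e + norm h * e"
        using d(3)[of z] d(4)[of z] z
        by (intro add_mono mult_mono abs_Re_le_cmod abs_Im_le_cmod) (auto simp: dist_norm d_def)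
      finally show "norm (?D h) \<le> 2 * e * norm h" by simp
    qed
  qed
  have "inj_on (normal_chart c c1) (ball 0 d)"
  proof (rule inj_onI)
    fix x y assume xy: "x \<in> ball 0 d" "y \<in> ball 0 d" "normal_chart c c1 x = normal_chart c c1 y"
    have "g x - g y = c1 0 * (y - x)" using xy(3) by (simp add: g_def algebra_simps)
    then have "3 * e * norm (x - y) \<le> 2 * e * norm (x - y)"
      using bound[OF xy(1,2)] by (simp add: norm_mult e_def norm_minus_commute)
    then have "e * norm (x - y) \<le> 0" by linarith
    then show "x = y" using e by (simp add: mult_le_0_iff)
  qed
  then show ?thesis using d by (intro exI[of _ d]) (auto simp: d_def)
qed

text \<open>Sussmann's open mapping theorem needs only continuity and an invertible derivative at
  the one point 0, here multiplication by \<open>c1 0\<close>. It ensures that all points near c 0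
  are reached by the chart.\<close>

lemma normal_chart_nhd:
  assumes der: "\<And>t. (c has_vector_derivative c1 t) (at t)" "\<And>t. (c1 has_vector_derivative c2 t) (at t)"
    and c1: "c1 0 \<noteq> 0" and d: "d > 0"
  shows "\<exists>r>0. ball (c 0) r \<subseteq> normal_chart c c1 ` ball 0 d"
proof -
  have "normal_chart c c1 0 \<in> interior (normal_chart c c1 ` ball 0 d)"
  proof (rule sussmann_open_mapping[where S = UNIV and f' = "(*) (c1 0)" and g' = "(*) (1 / c1 0)"])
    show "(normal_chart c c1 has_derivative (*) (c1 0)) (at 0)"
      by (rule has_derivative_eq_rhs[OF normal_chart_partials[OF der]]) (auto simp: fun_eq_iff complex_eq_iff algebra_simps)
    show "continuous_on UNIV (normal_chart c c1)"
      by (rule has_derivative_continuous_on[OF normal_chart_partials[OF der]])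
  qed (use c1 d in \<open>auto simp: fun_eq_iff bounded_linear_mult_right\<close>)
  then show ?thesis by (simp add: mem_interior normal_chart_0)
qed

subsection \<open>The boundary parametrization\<close>

lemma smooth_curve_fun_derivatives:
  assumes "smooth_curve_fun c"
  obtains c1 c2 c3 where "\<And>t. (c has_vector_derivative c1 t) (at t)" "\<And>t. (c1 has_vector_derivative c2 t) (at t)"
      "\<And>t. (c2 has_vector_derivative c3 t) (at t)" "continuous_on UNIV c3"
proof -
  obtain D where D: "D 0 = c" "\<And>k t. (D k has_vector_derivative D (Suc k) t) (at t)"
    using assms unfolding smooth_curve_fun_def by blast
  have "continuous_on UNIV (D 3)"
    using D(2) by (meson continuous_at_imp_continuous_on has_vector_derivative_continuous)
  then show ?thesis using that[of "D 1" "D 2" "D 3"] D(1) D(2)[of 0] D(2)[of 1] D(2)[of 2]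
    by (simp add: numeral_2_eq_2 numeral_3_eq_3)
qed

lemma has_vector_derivative_affine:
  fixes c :: "real \<Rightarrow> complex"
  assumes "\<And>t. (c has_vector_derivative c1 t) (at t)"
  shows "((\<lambda>t. c (t0 + \<sigma> * t)) has_vector_derivative \<sigma> *\<^sub>R c1 (t0 + \<sigma> * t)) (at t)"
proof -
  have "((\<lambda>t. t0 + \<sigma> * t) has_vector_derivative \<sigma>) (at t)"
    by (auto intro!: derivative_eq_intros simp: has_real_derivative_iff_has_vector_derivative[symmetric])
  from vector_diff_chain_at[OF this assms] show ?thesis by (simp add: o_def)
qed

lemma periodic_int:
  fixes f :: "real \<Rightarrow> 'a"
  assumes "\<And>t. f (t + 1) = f t"
  shows "f (t + of_int k) = f t"
proof (induction k rule: int_induct[where k = 0])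
  case (step1 i) then show ?case using assms[of "t + of_int i"] by (simp add: algebra_simps)
next
  case (step2 i) then show ?case using assms[of "t + of_int i - 1"] by (simp add: algebra_simps)
qed simp

text \<open>Different curves are disjoint, and \<open>frac\<close> brings both parameters into the
  period interval, where the curve is injective.\<close>

lemma boundary_param_eq:
  assumes "smooth_boundary_param \<Omega> n \<gamma>" "i < n" "j < n" "\<gamma> i t = \<gamma> j s"
  shows "i = j" and "\<exists>k::int. t = s + of_int k"
proof -
  have p: "\<And>t. \<gamma> i (t + 1) = \<gamma> i t" "inj_on (\<gamma> i) {0..<1}"
    "i \<noteq> j \<Longrightarrow> range (\<gamma> i) \<inter> range (\<gamma> j) = {}"
    using assms(1-3) unfolding smooth_boundary_param_def by blast+
  show ij: "i = j" using p(3) assms(4) by (metis IntI empty_iff rangeI)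
  have fr: "\<gamma> i (frac x) = \<gamma> i x" for x
    using periodic_int[of "\<gamma> i", OF p(1), of "frac x" "\<lfloor>x\<rfloor>"] by (simp add: frac_def)
  have "frac t = frac s"
    using inj_onD[OF p(2), of "frac t" "frac s"] assms(4) ij fr by (simp add: frac_lt_1)
  then show "\<exists>k::int. t = s + of_int k"
    by (intro exI[of _ "\<lfloor>t\<rfloor> - \<lfloor>s\<rfloor>"]) (simp add: frac_def)
qed

text \<open>The description by \<open>THE\<close> is unambiguous: two parameters of the same point
  differ by an integer, and by periodicity the derivatives there coincide.\<close>

lemma unit_tangent_param:
  assumes "smooth_boundary_param \<Omega> n \<gamma>" "i < n" "\<And>t. (\<gamma> i has_vector_derivative c1 t) (at t)"
  shows "unit_tangent n \<gamma> (\<gamma> i t) = sgn (c1 t)"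
  unfolding unit_tangent_def
proof (rule the_equality)
  have v: "vector_derivative (\<gamma> i) (at t) = c1 t" for t using assms(3) by (rule vector_derivative_at)
  show "\<exists>j<n. \<exists>s. \<gamma> j s = \<gamma> i t \<and> sgn (c1 t) = sgn (vector_derivative (\<gamma> j) (at s))"
    using assms(2) v by metis
  fix T assume "\<exists>j<n. \<exists>s. \<gamma> j s = \<gamma> i t \<and> T = sgn (vector_derivative (\<gamma> j) (at s))"
  then obtain j s where js: "j < n" "\<gamma> j s = \<gamma> i t" "T = sgn (vector_derivative (\<gamma> j) (at s))" by blast
  obtain k :: int where k: "s = t + of_int k" and j: "j = i"
    using boundary_param_eq[OF assms(1) js(1) assms(2) js(2)] by blast
  have p: "\<gamma> i (x + of_int k) = \<gamma> i x" for x
    using assms(1,2) by (intro periodic_int) (auto simp: smooth_boundary_param_def)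
  have "((\<lambda>x. \<gamma> i (of_int k + 1 * x)) has_vector_derivative 1 *\<^sub>R c1 (of_int k + 1 * t)) (at t)"
    by (rule has_vector_derivative_affine[OF assms(3)])
  then have "(\<gamma> i has_vector_derivative c1 s) (at t)" by (simp add: k p add.commute)
  then have "c1 s = c1 t" using assms(3) vector_derivative_at by metis
  then show "T = sgn (c1 t)" using js(3) v j by simp
qed

text \<open>The part \<open>K\<close> of the boundary that remains after removing the parameters
  within d of t0 is compact, being covered by one period of each curve, and it does not contain the
  point. It therefore has positive distance from it.\<close>

lemma frontier_near_param:
  assumes P: "smooth_boundary_param \<Omega> n \<gamma>" and i: "i < n" and d: "d > 0"
  shows "\<exists>e>0. \<forall>z\<in>frontier \<Omega> \<inter> ball (\<gamma> i t0) e. \<exists>u. \<bar>u\<bar> < d \<and> z = \<gamma> i (t0 + u)"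
proof -
  have per: "\<gamma> j (t + of_int k) = \<gamma> j t" if "j < n" for j t k
    using P that by (intro periodic_int) (auto simp: smooth_boundary_param_def)
  have cont: "continuous_on A (\<gamma> j)" if "j < n" for j A
  proof -
    have "smooth_curve_fun (\<gamma> j)" using P that by (simp add: smooth_boundary_param_def)
    then obtain D where D: "D 0 = \<gamma> j" "\<And>k t. (D k has_vector_derivative D (Suc k) t) (at t)"
      unfolding smooth_curve_fun_def by blast
    have "continuous (at t) (\<gamma> j)" for t using D(2)[of 0 t] D(1) has_vector_derivative_continuous by metis
    then show ?thesis by (blast intro: continuous_at_imp_continuous_on)
  qed
  have cover: "\<exists>s\<in>{t0 - 1/2..t0 + 1/2}. \<gamma> j s = \<gamma> j t" if "j < n" for j t
  proof (rule bexI)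
    show "\<gamma> j (t + of_int (- round (t - t0))) = \<gamma> j t" by (rule per[OF that])
    have "\<bar>of_int (round (t - t0)) - (t - t0)\<bar> \<le> 1/2" by (rule of_int_round_abs_le)
    then show "t + of_int (- round (t - t0)) \<in> {t0 - 1/2..t0 + 1/2}"
      unfolding of_int_minus atLeastAtMost_iff by linarith
  qed
  define K where "K = (\<Union>j\<in>{..<n} - {i}. \<gamma> j ` {t0 - 1/2..t0 + 1/2}) \<union> \<gamma> i ` ({t0 - 1/2..t0 - d} \<union> {t0 + d..t0 + 1/2})"
  have "closed K" unfolding K_def
    by (intro compact_imp_closed compact_Un compact_UN compact_continuous_image cont i) auto
  moreover have "\<gamma> i t0 \<notin> K"
  proof
    assume "\<gamma> i t0 \<in> K"
    then consider j s where "j < n" "j \<noteq> i" "\<gamma> i t0 = \<gamma> j s" 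
      | s where "s \<in> {t0 - 1/2..t0 - d} \<union> {t0 + d..t0 + 1/2}" "\<gamma> i t0 = \<gamma> i s"
      unfolding K_def by blast
    then show False
    proof cases
      case 1 then show False using boundary_param_eq(1)[OF P i] by metis
    next
      case 2
      then obtain k :: int where k: "t0 = s + of_int k" using boundary_param_eq(2)[OF P i i] by blast
      then have "\<bar>of_int k :: real\<bar> < 1" using 2(1) d by (auto simp: abs_less_iff)
      then have "k = 0" by linarith
      then show False using k 2(1) d by auto
    qed
  qed
  ultimately obtain e where e: "e > 0" "ball (\<gamma> i t0) e \<subseteq> - K"
    by (metis ComplI open_Compl openE)
  have "\<exists>u. \<bar>u\<bar> < d \<and> z = \<gamma> i (t0 + u)" if z: "z \<in> frontier \<Omega>" "z \<in> ball (\<gamma> i t0) e" for z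
  proof -
    have "frontier \<Omega> = (\<Union>i<n. range (\<gamma> i))" using P by (simp add: smooth_boundary_param_def)
    then obtain j t where "j < n" "z = \<gamma> j t" using z(1) by auto
    then obtain s where s: "j < n" "s \<in> {t0 - 1/2..t0 + 1/2}" "z = \<gamma> j s" using cover by metis
    have zK: "z \<notin> K" using z(2) e(2) by auto
    then have "j = i" using s unfolding K_def by blast
    moreover have "s \<notin> {t0 - 1/2..t0 - d} \<union> {t0 + d..t0 + 1/2}" using zK s(3) \<open>j = i\<close> unfolding K_def by blast
    then have "\<bar>s - t0\<bar> < d" using s(2) by auto
    ultimately show ?thesis using s(3) by (intro exI[of _ "s - t0"]) simp
  qed
  then show ?thesis using e(1) by blast
qed

lemma A_infty_chain:
  assumes "f \<in> A_infty \<Omega>" "open \<Omega>"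
  obtains D where "D 0 = f" "\<And>k z. z \<in> \<Omega> \<Longrightarrow> (D k has_field_derivative D (Suc k) z) (at z)"
    "\<And>k. continuous_on (closure \<Omega>) (D k)"
proof -
  have f: "f holomorphic_on \<Omega>" "continuous_on (closure \<Omega>) f"
    "\<forall>k. \<exists>g. continuous_on (closure \<Omega>) g \<and> (\<forall>z\<in>\<Omega>. g z = (deriv ^^ k) f z)"
    using assms(1) by (auto simp: A_infty_def)
  then obtain g where g: "\<And>k. continuous_on (closure \<Omega>) (g k)" "\<And>k z. z \<in> \<Omega> \<Longrightarrow> g k z = (deriv ^^ k) f z" by metis
  \<comment> \<open>The extension \<open>g 0\<close> agrees with \<open>f\<close> only on the
    closure; taking \<open>f\<close> itself makes \<open>D 0 = f\<close> an equation between
    functions.\<close>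
  define D where "D = (\<lambda>k. if k = 0 then f else g k)"
  have D: "D k z = (deriv ^^ k) f z" if "z \<in> \<Omega>" for k z using g(2)[OF that] by (simp add: D_def)
  have "(D k has_field_derivative D (Suc k) z) (at z)" if z: "z \<in> \<Omega>" for k z
  proof (rule has_field_derivative_transform_within_open[OF _ assms(2) z])
    show "((deriv ^^ k) f has_field_derivative D (Suc k) z) (at z)"
      using has_field_derivative_higher_deriv[OF f(1) assms(2) z, of k] D[OF z, of "Suc k"] by simp
  qed (simp add: D)
  then show ?thesis using that[of D] g(1) f(2) by (simp add: D_def)
qed

subsection \<open>The quotient of the kernels near the boundary\<close>

text \<open>\<open>S\<close> and \<open>L\<close> are sequences of successive derivatives. The point
  \<open>a\<close> is removed because of the pole of L. \<open>F\<close> is tied to the quotient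
  only where L is nonzero, since at a zero of L the meromorphic function may take another value than
  the pointwise quotient.\<close>

locale kernel_pair =
  fixes \<Omega> :: "complex set" and a :: complex and \<phi> :: "complex \<Rightarrow> real" and S L :: "nat \<Rightarrow> complex \<Rightarrow> complex"
    and F :: "complex \<Rightarrow> complex"
  assumes open_dom: "open \<Omega>" and a_in: "a \<in> \<Omega>"
    and S_chain: "\<And>k z. z \<in> \<Omega> - {a} \<Longrightarrow> (S k has_field_derivative S (Suc k) z) (at z)"
      "\<And>k. continuous_on (closure \<Omega> - {a}) (S k)"
    and L_chain: "\<And>k z. z \<in> \<Omega> - {a} \<Longrightarrow> (L k has_field_derivative L (Suc k) z) (at z)"
      "\<And>k. continuous_on (closure \<Omega> - {a}) (L k)"
    and isolated_zeros: "\<And>p. p \<in> \<Omega> - {a} \<Longrightarrow> \<forall>\<^sub>F w in at p. S 0 w * L 0 w \<noteq> 0"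
    and F_eq: "\<And>z. z \<in> \<Omega> - {a} \<Longrightarrow> L 0 z \<noteq> 0 \<Longrightarrow> F z = S 0 z / L 0 z"
begin

text \<open>The image of the open upper half disc is connected and misses the frontier, so it lies
  in \<Omega> or is disjoint from it. In the second case the claim is vacuous; in the first the
  chart meets the assumptions of \<open>half_disc_chart\<close>.\<close>

lemma one_sided_limit:
  assumes c: "\<And>t. (c has_vector_derivative c1 t) (at t)" "\<And>t. (c1 has_vector_derivative c2 t) (at t)"
      "\<And>t. (c2 has_vector_derivative c3 t) (at t)" "continuous_on UNIV c3" "\<And>t. c1 t \<noteq> 0"
    and d: "d > 0" and inj: "inj_on (normal_chart c c1) (ball 0 d)"
    and fr: "\<And>t. \<bar>t\<bar> < d \<Longrightarrow> c t \<in> frontier \<Omega>"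
    and off: "\<And>z. z \<in> ball 0 d \<Longrightarrow> Im z > 0 \<Longrightarrow> normal_chart c c1 z \<notin> frontier \<Omega>"
    and ne_a: "\<And>z. z \<in> ball 0 d \<Longrightarrow> normal_chart c c1 z \<noteq> a"
    and bdry: "\<And>t. \<bar>t\<bar> < d \<Longrightarrow> norm (S 0 (c t)) * \<phi> (c t) = norm (L 0 (c t))"
    and real: "\<And>t. \<bar>t\<bar> < d \<Longrightarrow> Im (\<i> * (S 0 (c t) * L 0 (c t)) * c1 t) = 0"
    and \<phi>: "isCont (\<lambda>t. \<phi> (c t)) 0" "\<phi> (c 0) > 0" and e: "e > 0"
  shows "\<exists>r>0. \<forall>z. norm z < r \<longrightarrow> Im z > 0 \<longrightarrow> normal_chart c c1 z \<in> \<Omega> \<longrightarrow>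
      \<bar>norm (F (normal_chart c c1 z)) - 1 / \<phi> (c 0)\<bar> < e"
proof -
  define \<Phi> where "\<Phi> = normal_chart c c1"
  define H where "H = ball 0 d \<inter> {z. 0 < Im z}"
  have cont: "continuous_on A \<Phi>" for A
    unfolding \<Phi>_def by (rule has_derivative_continuous_on[OF normal_chart_partials[OF c(1,2)]])
  have "connected (\<Phi> ` H)"
    unfolding H_def by (intro connected_continuous_image cont convex_connected convex_Int convex_ball convex_halfspace_Im_gt)
  moreover have "\<Phi> ` H \<inter> frontier \<Omega> = {}" using off by (auto simp: H_def \<Phi>_def)
  ultimately consider "\<Phi> ` H \<inter> \<Omega> = {}" | "\<Phi> ` H \<subseteq> \<Omega>"
    using connected_Int_frontier[of "\<Phi> ` H" \<Omega>] by blast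
  then show ?thesis
  proof cases
    case 1
    have no: "normal_chart c c1 z \<notin> \<Omega>" if "norm z < d" "Im z > 0" for z
    proof -
      have "z \<in> H" using that by (simp add: H_def)
      then show ?thesis using 1 unfolding \<Phi>_def by blast
    qed
    show ?thesis
    proof (intro exI[of _ d] conjI allI impI)
      fix z assume "norm z < d" "0 < Im z" "normal_chart c c1 z \<in> \<Omega>"
      with no[of z] show "\<bar>norm (F (normal_chart c c1 z)) - 1 / \<phi> (c 0)\<bar> < e" by blast
    qed (rule d)
  next
    case 2
    have inU: "\<Phi> z \<in> \<Omega> - {a}" if "z \<in> half_disc d" "Im z > 0" for z
      using 2 that ne_a[of z] by (auto simp: H_def half_disc_def \<Phi>_def)
    have inV: "\<Phi> z \<in> closure \<Omega> - {a}" if z: "z \<in> half_disc d" for z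
    proof (cases "Im z > 0")
      case True then show ?thesis using inU[OF z] closure_subset by auto
    next
      case False
      then have "z = of_real (Re z)" using z by (auto simp: half_disc_def complex_eq_iff)
      moreover have "\<bar>Re z\<bar> < d" using z abs_Re_le_cmod[of z] by (auto simp: half_disc_def)
      ultimately have "\<Phi> z \<in> frontier \<Omega>" using fr normal_chart_of_real unfolding \<Phi>_def by metis
      then show ?thesis using ne_a[of z] z by (auto simp: frontier_def half_disc_def \<Phi>_def)
    qed
    interpret half_disc_chart c c1 c2 c3 d "\<Omega> - {a}" "closure \<Omega> - {a}" \<Phi>
      using c d inU inV by unfold_locales (auto simp: \<Phi>_def)
    \<comment> \<open>The top of the half circle lies in the domain, where zeros of the product are
      isolated. By injectivity, neighbouring points of the half circle are mapped to other points
      than the top, so the product is nonzero at some of them.\<close>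
    have nz: "\<exists>z\<in>half_disc d. norm z = r \<and> S 0 (\<Phi> z) * L 0 (\<Phi> z) \<noteq> 0" if r: "0 < r" "r < d" for r
    proof -
      define p where "p = (\<lambda>t. of_real r * cis t)"
      have pd: "p t \<in> half_disc d" "norm (p t) = r" "Im (p t) > 0" if "t \<in> {0<..<pi}" for t
        using r that sin_gt_zero[of t] by (auto simp: p_def half_disc_def norm_mult)
      have m: "pi/2 \<in> {0<..<pi}" by auto
      have "filterlim (\<lambda>t. \<Phi> (p t)) (at (\<Phi> (p (pi/2)))) (at (pi/2))"
        unfolding filterlim_at
      proof (intro conjI)
        have "continuous_on UNIV (\<lambda>t. \<Phi> (p t))"
          by (rule continuous_on_compose2[OF cont]) (auto simp: p_def cis_conv_exp intro!: continuous_intros)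
        then show "((\<lambda>t. \<Phi> (p t)) \<longlongrightarrow> \<Phi> (p (pi/2))) (at (pi/2))" by (auto simp: continuous_on_def)
        have "\<forall>\<^sub>F t in at (pi/2). t \<in> {0<..<pi} - {pi/2}" using m by (intro eventually_at_in_open) auto
        then show "\<forall>\<^sub>F t in at (pi/2). \<Phi> (p t) \<in> UNIV \<and> \<Phi> (p t) \<noteq> \<Phi> (p (pi/2))"
        proof eventually_elim
          case (elim t)
          have "p t \<noteq> p (pi/2)"
          proof
            assume "p t = p (pi/2)"
            then have "Re (p t) = Re (p (pi/2))" by simp
            then have "cos t = 0" using r by (simp add: p_def)
            then have "t = pi/2" using elim cos_inj_pi[of t "pi/2"] by auto
            then show False using elim by simp
          qed
          then show ?case
            using inj_onD[OF inj, of "p t" "p (pi/2)"] pd(2)[of t] pd(2)[OF m] elim r by (auto simp: \<Phi>_def)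
        qed
      qed
      moreover have "\<Phi> (p (pi/2)) \<in> \<Omega> - {a}" using inU pd m by blast
      ultimately have "\<forall>\<^sub>F t in at (pi/2). S 0 (\<Phi> (p t)) * L 0 (\<Phi> (p t)) \<noteq> 0"
        using isolated_zeros filterlim_iff by fast
      moreover have "\<forall>\<^sub>F t in at (pi/2). t \<in> {0<..<pi} - {pi/2}" using m by (intro eventually_at_in_open) auto
      ultimately have "\<forall>\<^sub>F t in at (pi/2). S 0 (\<Phi> (p t)) * L 0 (\<Phi> (p t)) \<noteq> 0 \<and> t \<in> {0<..<pi}"
        by eventually_elim auto
      then obtain t where "S 0 (\<Phi> (p t)) * L 0 (\<Phi> (p t)) \<noteq> 0" "t \<in> {0<..<pi}"
        using eventually_happens[of _ "at (pi/2)"] by auto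
      then show ?thesis using pd by blast
    qed
    note lim = norm_quotient_tendsto[of S L \<phi>, OF S_chain L_chain bdry real nz \<phi>]
    have "\<forall>\<^sub>F z in at 0 within half_disc d. dist (norm (S 0 (\<Phi> z) / L 0 (\<Phi> z))) (1 / \<phi> (c 0)) < e \<and> L 0 (\<Phi> z) \<noteq> 0"
      using tendstoD[OF lim(1) e] lim(2) by (rule eventually_conj)
    then obtain r where r: "r > 0" "\<And>z. z \<in> half_disc d \<Longrightarrow> z \<noteq> 0 \<Longrightarrow> norm z < r \<Longrightarrow>
        dist (norm (S 0 (\<Phi> z) / L 0 (\<Phi> z))) (1 / \<phi> (c 0)) < e \<and> L 0 (\<Phi> z) \<noteq> 0"
      unfolding eventually_at by (auto simp: dist_norm)
    have close: "\<bar>norm (F (\<Phi> z)) - 1 / \<phi> (c 0)\<bar> < e" if "norm z < min r d" "Im z > 0" for z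
    proof -
      have z: "z \<in> half_disc d" "z \<noteq> 0" "norm z < r" using that by (auto simp: half_disc_def)
      have "F (\<Phi> z) = S 0 (\<Phi> z) / L 0 (\<Phi> z)"
        by (rule F_eq[OF inU[OF z(1) that(2)]]) (use r(2)[OF z] in blast)
      then show ?thesis using r(2)[OF z] by (simp add: dist_norm)
    qed
    show ?thesis
    proof (intro exI[of _ "min r d"] conjI allI impI)
      fix z assume "norm z < min r d" "0 < Im z"
      then show "\<bar>norm (F (normal_chart c c1 z)) - 1 / \<phi> (c 0)\<bar> < e" using close[of z] unfolding \<Phi>_def by blast
    qed (use r d in simp)
  qed
qed

end


text \<open>If S vanished on \<Omega>, it would vanish on the frontier too, and then
  \<open>k\<close>, which is i (z - a) H - 1 / (2 pi), would be zero there. By the maximum principle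
  it would vanish at \<open>a\<close>, where its value is - 1 / (2 pi).\<close>

lemma szego_not_identically_zero:
  fixes \<Omega> :: "complex set" and a :: complex and S H :: "complex \<Rightarrow> complex"
  assumes "bounded \<Omega>" "open \<Omega>" "a \<in> \<Omega>"
    and S: "continuous_on (closure \<Omega>) S"
    and H: "H holomorphic_on \<Omega>" "continuous_on (closure \<Omega>) H"
    and fr: "\<And>z. z \<in> frontier \<Omega> \<Longrightarrow> S z = 0 \<Longrightarrow> 1 / (2 * pi) * (1 / (z - a)) - \<i> * H z = 0"
  shows "\<exists>z\<in>\<Omega>. S z \<noteq> 0"
proof (rule ccontr)
  assume "\<not> ?thesis"
  then have "S z = 0" if "z \<in> closure \<Omega>" for z
    using continuous_constant_on_closure[of \<Omega> S 0 z] S that by blast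
  then have L0: "1 / (2 * pi) * (1 / (z - a)) = \<i> * H z" if "z \<in> frontier \<Omega>" for z
    using fr[OF that] that by (simp add: frontier_def)
  define k where "k = (\<lambda>z. \<i> * (z - a) * H z - 1 / (2 * pi))"
  have "norm (k a) \<le> 0"
  proof (rule maximum_modulus_frontier[of k \<Omega>])
    show "k holomorphic_on interior \<Omega>"
      unfolding k_def using assms(2) H by (auto intro!: holomorphic_intros simp: interior_open)
    show "continuous_on (closure \<Omega>) k" unfolding k_def by (intro continuous_intros H)
    fix z assume z: "z \<in> frontier \<Omega>"
    then have "z \<noteq> a" using assms(2,3) by (auto simp: frontier_def interior_open)
    have "k z = (z - a) * (\<i> * H z) - 1 / (2 * pi)" by (simp add: k_def)
    also have "\<dots> = 0" unfolding L0[OF z, symmetric] using \<open>z \<noteq> a\<close> by simp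
    finally show "norm (k z) \<le> 0" by simp
  qed (use assms in auto)
  then show False by (simp add: k_def)
qed

section \<open>The limit at a boundary point\<close>

theorem mainTheorem5:
  fixes \<Omega> :: "complex set" and n :: nat and \<gamma> :: "nat \<Rightarrow> real \<Rightarrow> complex"
    and \<phi> :: "complex \<Rightarrow> real" and a :: complex and S L :: "complex \<Rightarrow> complex"
  assumes "bounded \<Omega>" and "n_connected_domain n \<Omega>"
    and "smooth_boundary_param \<Omega> n \<gamma>"
    and "\<forall>C\<in>components (frontier \<Omega>). \<nexists>p. C = {p}"
    and "\<forall>z\<in>frontier \<Omega>. \<phi> z > 0" and "smooth_on_boundary n \<gamma> \<phi>"
    and "a \<in> \<Omega>"
    and "is_weighted_szego \<Omega> n \<gamma> \<phi> a S"
    and "is_weighted_garabedian \<Omega> n \<gamma> \<phi> a S L"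
  shows "\<forall>z\<^sub>0\<in>frontier \<Omega>.
           ((\<lambda>z. norm (weighted_ahlfors S L z)) \<longlongrightarrow> 1 / \<phi> z\<^sub>0) (at z\<^sub>0 within \<Omega>)"
proof
  fix z\<^sub>0 assume z0: "z\<^sub>0 \<in> frontier \<Omega>"
  have dom: "open \<Omega>" "connected \<Omega>" using assms(2) by (auto simp: n_connected_domain_def)
  have disj: "\<Omega> \<inter> frontier \<Omega> = {}" using dom(1) by (auto simp: frontier_def interior_open)
  note P = assms(3)
  obtain Sk where Sk: "Sk 0 = S" "\<And>k z. z \<in> \<Omega> \<Longrightarrow> (Sk k has_field_derivative Sk (Suc k) z) (at z)"
    "\<And>k. continuous_on (closure \<Omega>) (Sk k)"
    using assms(8) A_infty_chain[OF _ dom(1), of S] unfolding is_weighted_szego_def by blast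
  obtain H where H: "H \<in> A_infty \<Omega>"
    "\<And>z. z \<in> frontier \<Omega> \<Longrightarrow> cauchy_fun n \<gamma> a z / of_real (\<phi> z) = S z + cnj (H z * unit_tangent n \<gamma> z) / of_real (\<phi> z)"
    "\<And>z. z \<in> closure \<Omega> - {a} \<Longrightarrow> L z = 1 / (2 * pi) * (1 / (z - a)) - \<i> * H z"
    using assms(9) unfolding is_weighted_garabedian_def by blast
  obtain Hk where Hk: "Hk 0 = H" "\<And>k z. z \<in> \<Omega> \<Longrightarrow> (Hk k has_field_derivative Hk (Suc k) z) (at z)"
    "\<And>k. continuous_on (closure \<Omega>) (Hk k)"
    using A_infty_chain[OF H(1) dom(1)] by blast
  define E where "E = (\<lambda>z. 1 / (2 * pi) * (1 / (z - a)) :: complex)"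
  \<comment> \<open>\<open>L\<close> is prescribed only on the closure without \<open>a\<close>,
    where it agrees with \<open>Lk 0\<close>. The higher terms combine the derivatives of the
    explicit polar part with the continuous extensions for H.\<close>
  define Lk where "Lk = (\<lambda>k z. (deriv ^^ k) E z - \<i> * Hk k z)"
  have E_hol: "E holomorphic_on - {a}" unfolding E_def by (auto intro!: holomorphic_intros)
  have Lk0: "Lk 0 z = 1 / (2 * pi) * (1 / (z - a)) - \<i> * H z" for z by (simp add: Lk_def E_def Hk(1))
  have Lk: "(Lk k has_field_derivative Lk (Suc k) z) (at z)" if "z \<in> \<Omega> - {a}" for k z
    unfolding Lk_def
  proof (intro DERIV_diff DERIV_cmult Hk(2))
    show "((deriv ^^ k) E has_field_derivative (deriv ^^ Suc k) E z) (at z)"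
      using that by (intro has_field_derivative_higher_deriv[OF E_hol]) auto
  qed (use that in auto)
  have Lk_cont: "continuous_on (closure \<Omega> - {a}) (Lk k)" for k
  proof -
    have "(deriv ^^ k) E holomorphic_on - {a}" by (intro holomorphic_higher_deriv E_hol) auto
    then have "continuous_on (closure \<Omega> - {a}) ((deriv ^^ k) E)"
      by (rule holomorphic_on_imp_continuous_on[THEN continuous_on_subset]) auto
    then show ?thesis unfolding Lk_def by (intro continuous_intros continuous_on_subset[OF Hk(3)]) auto
  qed
  \<comment> \<open>This is the relation between the two kernels, obtained by conjugating the
    orthogonal decomposition of the Cauchy function and collecting the terms with T.\<close>
  have relation: "of_real (\<phi> z) * cnj (S z) = - \<i> * unit_tangent n \<gamma> z * Lk 0 z" if z: "z \<in> frontier \<Omega>" for z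
  proof -
    have p: "of_real (\<phi> z) \<noteq> (0::complex)" using assms(5) z by auto
    have "cauchy_fun n \<gamma> a z = of_real (\<phi> z) * (cauchy_fun n \<gamma> a z / of_real (\<phi> z))" using p by simp
    also have "\<dots> = of_real (\<phi> z) * S z + cnj (H z * unit_tangent n \<gamma> z)"
      unfolding H(2)[OF z] using p by (simp add: distrib_left)
    finally have "cnj (cauchy_fun n \<gamma> a z) = cnj (of_real (\<phi> z) * S z + cnj (H z * unit_tangent n \<gamma> z))" by simp
    then have eq: "1 / (2 * pi * \<i>) * (unit_tangent n \<gamma> z / (z - a)) = of_real (\<phi> z) * cnj (S z) + H z * unit_tangent n \<gamma> z"
      by (simp add: cauchy_fun_def)
    define q v where "q = complex_of_real (1 / (2 * pi))" and "v = 1 / (z - a)"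
    have qv: "1 / (2 * pi * \<i>) = - \<i> * q" "unit_tangent n \<gamma> z / (z - a) = unit_tangent n \<gamma> z * v"
      by (simp_all add: q_def v_def field_simps)
    have "- \<i> * q * (unit_tangent n \<gamma> z * v) = of_real (\<phi> z) * cnj (S z) + H z * unit_tangent n \<gamma> z"
      using eq unfolding qv .
    moreover have "q * v = Lk 0 z + \<i> * H z" unfolding Lk0 by (simp add: q_def v_def)
    then have "- \<i> * q * (unit_tangent n \<gamma> z * v) = - \<i> * unit_tangent n \<gamma> z * (Lk 0 z + \<i> * H z)"
      by (metis mult.assoc mult.commute)
    ultimately show ?thesis by (simp add: algebra_simps eq_neg_iff_add_eq_0)
  qed
  have tangent: "norm (unit_tangent n \<gamma> (\<gamma> i t)) = 1 \<and> c1 t = of_real (norm (c1 t)) * unit_tangent n \<gamma> (\<gamma> i t)"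
    if "i < n" "\<And>t. (\<gamma> i has_vector_derivative c1 t) (at t)" for i t c1
  proof -
    have "c1 t \<noteq> 0"
      using P that vector_derivative_at[OF that(2)] unfolding smooth_boundary_param_def by metis
    then have "norm (sgn (c1 t)) = 1" "c1 t = of_real (norm (c1 t)) * sgn (c1 t)"
      by (simp add: norm_sgn, simp add: sgn_eq)
    then show ?thesis unfolding unit_tangent_param[OF P that] by blast
  qed
  have norms: "norm (S z) * \<phi> z = norm (Lk 0 z)" if z: "z \<in> frontier \<Omega>" for z
  proof -
    obtain i t where it: "i < n" "z = \<gamma> i t" using z P by (auto simp: smooth_boundary_param_def)
    then have "smooth_curve_fun (\<gamma> i)" using P by (auto simp: smooth_boundary_param_def)
    then obtain c1 c2 c3 where "\<And>t. (\<gamma> i has_vector_derivative c1 t) (at t)" by (rule smooth_curve_fun_derivatives) blast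
    from tangent[OF it(1) this] have "norm (unit_tangent n \<gamma> z) = 1" by (simp add: it(2))
    moreover have "\<phi> z > 0" using assms(5) z by blast
    ultimately show ?thesis using arg_cong[OF relation[OF z], of norm] by (simp add: norm_mult mult.commute)
  qed
  have "\<exists>z\<in>\<Omega>. S z \<noteq> 0"
  proof (rule szego_not_identically_zero[of \<Omega> a S H])
    show "1 / (2 * pi) * (1 / (z - a)) - \<i> * H z = 0" if "z \<in> frontier \<Omega>" "S z = 0" for z
      using norms[OF that(1)] that(2) unfolding Lk0[symmetric] by simp
  qed (use assms(1,7) dom(1) Sk(1) Sk(3)[of 0] Hk(1) Hk(3)[of 0] H(1) in \<open>auto simp: A_infty_def\<close>)
  then obtain w where w: "w \<in> \<Omega>" "S w \<noteq> 0" by blast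
  have S_hol: "S holomorphic_on \<Omega>" using assms(8) by (simp add: is_weighted_szego_def A_infty_def)
  have Lk_hol: "Lk 0 holomorphic_on \<Omega> - {a}"
    unfolding holomorphic_on_def
  proof
    fix z assume "z \<in> \<Omega> - {a}"
    from Lk[OF this, of 0] have "Lk 0 field_differentiable (at z)"
      unfolding field_differentiable_def by (rule exI)
    then show "Lk 0 field_differentiable (at z within \<Omega> - {a})" by (rule field_differentiable_at_within)
  qed
  \<comment> \<open>L has a simple pole: (z - a) L tends to 1 / (2 pi).\<close>
  have L_near_a: "\<forall>\<^sub>F z in at a. Lk 0 z \<noteq> 0"
  proof -
    have "isCont H a" using Hk(2)[OF assms(7), of 0] Hk(1) DERIV_isCont by metis
    then have "((\<lambda>z. 1 / (2 * pi) - \<i> * (z - a) * H z) \<longlongrightarrow> 1 / (2 * pi) - \<i> * (a - a) * H a) (at a)"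
      by (intro tendsto_intros) (simp add: isCont_def)
    then have "\<forall>\<^sub>F z in at a. 1 / (2 * pi) - \<i> * (z - a) * H z \<noteq> 0"
      by (rule tendsto_imp_eventually_ne) simp
    moreover have "\<forall>\<^sub>F z in at a. z \<noteq> a" by (simp add: eventually_at_filter)
    ultimately show ?thesis
    proof eventually_elim
      case (elim z)
      have "y * (q * (1 / y) - \<i> * h) = q - \<i> * y * h" if "y \<noteq> 0" for y q h :: complex
        using that by (simp add: field_simps)
      from this[of "z - a" "1 / (2 * pi)" "H z"]
      have "(z - a) * Lk 0 z = 1 / (2 * pi) - \<i> * (z - a) * H z" unfolding Lk0 using elim(2) by (simp only: right_minus_eq not_False_eq_True simp_thms)
      then show ?case using elim(1) by auto
    qed
  qed
  \<comment> \<open>A point near the pole where neither kernel vanishes. As \<Omega> without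
    \<open>a\<close> is connected, it makes all zeros of the product isolated.\<close>
  have "\<forall>\<^sub>F z in at a. (S z \<noteq> 0 \<and> z \<in> \<Omega>) \<and> Lk 0 z \<noteq> 0 \<and> z \<noteq> a"
    by (intro eventually_conj non_zero_neighbour_alt[OF S_hol dom assms(7) w] L_near_a) (simp add: eventually_at_filter)
  then obtain \<beta> where \<beta>: "\<beta> \<in> \<Omega> - {a}" "S \<beta> * Lk 0 \<beta> \<noteq> 0"
    using eventually_happens[of _ "at a"] by auto
  interpret kernel_pair \<Omega> a \<phi> Sk Lk "weighted_ahlfors S L"
  proof
    show "open \<Omega>" "a \<in> \<Omega>" by (rule dom assms)+
    show "continuous_on (closure \<Omega> - {a}) (Sk k)" for k by (rule continuous_on_subset[OF Sk(3)]) auto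
    show "\<forall>\<^sub>F w in at p. Sk 0 w * Lk 0 w \<noteq> 0" if "p \<in> \<Omega> - {a}" for p
    proof -
      have "(\<lambda>z. S z * Lk 0 z) holomorphic_on \<Omega> - {a}"
        by (intro holomorphic_intros Lk_hol holomorphic_on_subset[OF S_hol]) auto
      moreover have "open (\<Omega> - {a})" "connected (\<Omega> - {a})"
        using dom by (auto intro: connected_open_delete)
      ultimately have "\<forall>\<^sub>F w in at p. S w * Lk 0 w \<noteq> 0 \<and> w \<in> \<Omega> - {a}"
        using non_zero_neighbour_alt that \<beta> by blast
      then show ?thesis unfolding Sk(1) by eventually_elim blast
    qed
    fix z assume z: "z \<in> \<Omega> - {a}"
    show "(Sk k has_field_derivative Sk (Suc k) z) (at z)" "(Lk k has_field_derivative Lk (Suc k) z) (at z)" for k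
      using z Sk(2) Lk by auto
    assume nz: "Lk 0 z \<noteq> 0"
    have L_eq: "L y = Lk 0 y" if "y \<in> \<Omega> - {a}" for y
      using H(3)[of y] that closure_subset[of \<Omega>] by (auto simp: Lk0)
    \<comment> \<open>Where L is nonzero the quotient is already analytic, so
      \<open>remove_sings\<close> leaves its value unchanged.\<close>
    have "(\<lambda>z. S z / L z) analytic_on {z}"
    proof -
      have "open (\<Omega> - {a})" using dom by auto
      then have "S analytic_on {z}" "Lk 0 analytic_on {z}"
        using z holomorphic_on_subset[OF S_hol, of "\<Omega> - {a}"] Lk_hol analytic_on_open analytic_on_subset
        by (metis Diff_subset empty_subsetI insert_subset)+
      then have "(\<lambda>z. S z / Lk 0 z) analytic_on {z}" using nz by (intro analytic_intros) auto
      moreover have "\<forall>\<^sub>F y in nhds z. y \<in> \<Omega> - {a}" using z \<open>open (\<Omega> - {a})\<close> by (intro eventually_nhds_in_open)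
      then have "\<forall>\<^sub>F y in nhds z. S y / Lk 0 y = S y / L y" by eventually_elim (simp add: L_eq)
      from analytic_at_cong[OF this refl] calculation show ?thesis by simp
    qed
    then show "weighted_ahlfors S L z = Sk 0 z / Lk 0 z"
      by (simp add: weighted_ahlfors_def L_eq[OF z] Sk(1))
  qed (rule Lk_cont)
  obtain i t0 where i: "i < n" "z\<^sub>0 = \<gamma> i t0" using z0 P by (auto simp: smooth_boundary_param_def)
  have "smooth_curve_fun (\<gamma> i)" using P i by (auto simp: smooth_boundary_param_def)
  then obtain c1 c2 c3 where c: "\<And>t. (\<gamma> i has_vector_derivative c1 t) (at t)" "\<And>t. (c1 has_vector_derivative c2 t) (at t)"
      "\<And>t. (c2 has_vector_derivative c3 t) (at t)" "continuous_on UNIV c3"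
    by (rule smooth_curve_fun_derivatives) blast
  have c1_nz: "c1 t \<noteq> 0" for t
    using P i vector_derivative_at[OF c(1)] unfolding smooth_boundary_param_def by metis
  define C C1 C2 C3 where "C = (\<lambda>\<sigma> t. \<gamma> i (t0 + \<sigma> * t))" and "C1 = (\<lambda>\<sigma> t. \<sigma> *\<^sub>R c1 (t0 + \<sigma> * t))"
    and "C2 = (\<lambda>\<sigma> t. \<sigma> *\<^sub>R \<sigma> *\<^sub>R c2 (t0 + \<sigma> * t))" and "C3 = (\<lambda>\<sigma> t. \<sigma> *\<^sub>R \<sigma> *\<^sub>R \<sigma> *\<^sub>R c3 (t0 + \<sigma> * t))"
  have C: "(C \<sigma> has_vector_derivative C1 \<sigma> t) (at t)" "(C1 \<sigma> has_vector_derivative C2 \<sigma> t) (at t)"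
      "(C2 \<sigma> has_vector_derivative C3 \<sigma> t) (at t)" "continuous_on UNIV (C3 \<sigma>)" for \<sigma> t
    unfolding C_def C1_def C2_def C3_def
    by (intro bounded_linear.has_vector_derivative[OF bounded_linear_scaleR_right] has_vector_derivative_affine c
        continuous_intros continuous_on_compose2[OF c(4)]; simp)+
  define \<Phi> where "\<Phi> = (\<lambda>\<sigma>. normal_chart (C \<sigma>) (C1 \<sigma>))"
  have C_0: "C \<sigma> 0 = z\<^sub>0" for \<sigma> by (simp add: C_def i)
  \<comment> \<open>The reversed curve gives the chart for the other side of the boundary.\<close>
  have flip: "\<Phi> (-1) z = \<Phi> 1 (- z)" for z by (simp add: \<Phi>_def normal_chart_def C_def C1_def)
  obtain d where d: "d > 0" "inj_on (\<Phi> 1) (ball 0 d)"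
  proof -
    have "continuous_on UNIV (C2 1)"
      using C(3) by (meson continuous_at_imp_continuous_on has_vector_derivative_continuous)
    moreover have "C1 1 0 \<noteq> 0" using c1_nz by (simp add: C1_def)
    ultimately show ?thesis using that normal_chart_inj[OF C(1) C(2), of 1] unfolding \<Phi>_def by blast
  qed
  obtain e where e: "e > 0" "\<And>z. z \<in> frontier \<Omega> \<Longrightarrow> dist z\<^sub>0 z < e \<Longrightarrow> \<exists>u. \<bar>u\<bar> < d \<and> z = \<gamma> i (t0 + u)"
    using frontier_near_param[OF P i(1) d(1), of t0] i(2) by auto
  have "z\<^sub>0 \<noteq> a" using z0 disj assms(7) by auto
  have \<Phi>_cont: "continuous_on A (\<Phi> \<sigma>)" for A \<sigma>
    unfolding \<Phi>_def by (rule has_derivative_continuous_on[OF normal_chart_partials[OF C(1) C(2)]])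
  have "isCont (\<Phi> 1) 0" using \<Phi>_cont[of UNIV 1] by (simp add: continuous_on_eq_continuous_at)
  \<comment> \<open>The radius \<open>d0\<close> keeps the image of the chart away from
    \<open>a\<close> and so close to z0 that frontier points in it have parameters within d of
    t0.\<close>
  then obtain d0 where d0: "d0 > 0" "\<And>z. norm z < d0 \<Longrightarrow> dist (\<Phi> 1 z) z\<^sub>0 < min e (dist z\<^sub>0 a)"
    using e(1) \<open>z\<^sub>0 \<noteq> a\<close> unfolding continuous_at_eps_delta
    by (metis C_0 \<Phi>_def dist_pos_lt min_less_iff_conj normal_chart_0 dist_norm diff_zero)
  define r where "r = min d d0"
  have r: "r > 0" "r \<le> d" using d(1) d0(1) by (auto simp: r_def)
  have near: "dist z\<^sub>0 (\<Phi> 1 z) < e" "\<Phi> 1 z \<noteq> a" if "norm z < r" for z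
    using d0(2)[of z] that by (auto simp: r_def dist_commute)
  \<comment> \<open>A frontier point in the image is the image of a real u with |u| < d as well, and
    the chart is injective on the disc of radius d.\<close>
  have on_frontier: "Im z = 0" if z: "norm z < r" "\<Phi> 1 z \<in> frontier \<Omega>" for z
  proof -
    obtain u where u: "\<bar>u\<bar> < d" "\<Phi> 1 z = \<gamma> i (t0 + u)" using e(2)[OF z(2) near(1)[OF z(1)]] by blast
    have "\<gamma> i (t0 + u) = \<Phi> 1 (of_real u)" unfolding \<Phi>_def normal_chart_of_real by (simp add: C_def)
    then have "z = of_real u" using inj_onD[OF d(2), of z "of_real u"] u z(1) r by simp
    then show ?thesis by simp
  qed
  have C_frontier: "C \<sigma> t \<in> frontier \<Omega>" for \<sigma> t
    using P i(1) by (auto simp: smooth_boundary_param_def C_def)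
  have \<phi>_cont: "isCont (\<lambda>t. \<phi> (C \<sigma> t)) 0" for \<sigma>
  proof -
    have "smooth_curve_fun (\<lambda>t. \<phi> (\<gamma> i t))" using assms(6) i(1) by (simp add: smooth_on_boundary_def)
    then obtain D where D: "D 0 = (\<lambda>t. \<phi> (\<gamma> i t))" "\<And>k t. (D k has_vector_derivative D (Suc k) t) (at t)"
      unfolding smooth_curve_fun_def by blast
    have "isCont (\<lambda>t. \<phi> (\<gamma> i t)) (t0 + \<sigma> * 0)" using D(2)[of 0] D(1) has_vector_derivative_continuous by metis
    moreover have "isCont (\<lambda>t. t0 + \<sigma> * t) 0" by (intro continuous_intros)
    ultimately show ?thesis unfolding C_def using isCont_o2[of 0 "\<lambda>t. t0 + \<sigma> * t" "\<lambda>t. \<phi> (\<gamma> i t)"] by simp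
  qed
  have side: "\<exists>s>0. \<forall>z. norm z < s \<longrightarrow> Im z > 0 \<longrightarrow> \<Phi> \<sigma> z \<in> \<Omega> \<longrightarrow>
      \<bar>norm (weighted_ahlfors S L (\<Phi> \<sigma> z)) - 1 / \<phi> z\<^sub>0\<bar> < \<epsilon>" if \<sigma>: "\<sigma> = 1 \<or> \<sigma> = -1" and \<epsilon>: "\<epsilon> > 0" for \<sigma> \<epsilon> :: real
  proof -
    have sgn: "\<Phi> \<sigma> z = \<Phi> 1 (of_real \<sigma> * z)" "norm (of_real \<sigma> * z) = norm z" for z using \<sigma> flip[of z] by auto
    have nc: "normal_chart (C \<sigma>) (C1 \<sigma>) = \<Phi> \<sigma>" by (simp add: \<Phi>_def)
    have C1_nz: "C1 \<sigma> t \<noteq> 0" for t using c1_nz \<sigma> by (auto simp: C1_def)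
    show ?thesis
    proof (rule one_sided_limit[OF C[of \<sigma>] C1_nz r(1), unfolded nc C_0])
      show "inj_on (\<Phi> \<sigma>) (ball 0 r)"
      proof (rule inj_onI)
        fix x y assume "x \<in> ball 0 r" "y \<in> ball 0 r" "\<Phi> \<sigma> x = \<Phi> \<sigma> y"
        then have "of_real \<sigma> * x = of_real \<sigma> * y"
          using inj_onD[OF d(2), of "of_real \<sigma> * x" "of_real \<sigma> * y"] sgn r(2) by auto
        then show "x = y" using \<sigma> by auto
      qed
      show "\<Phi> \<sigma> z \<notin> frontier \<Omega>" if "z \<in> ball 0 r" "Im z > 0" for z
        using on_frontier[of "of_real \<sigma> * z"] that \<sigma> sgn by auto
      show "\<Phi> \<sigma> z \<noteq> a" if "z \<in> ball 0 r" for z using near(2)[of "of_real \<sigma> * z"] that sgn by auto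
      fix t
      show "C \<sigma> t \<in> frontier \<Omega>" by (rule C_frontier)
      show "norm (Sk 0 (C \<sigma> t)) * \<phi> (C \<sigma> t) = norm (Lk 0 (C \<sigma> t))" unfolding Sk(1) by (rule norms[OF C_frontier])
      define z T where "z = C \<sigma> t" and "T = unit_tangent n \<gamma> z"
      have "c1 (t0 + \<sigma> * t) = of_real (norm (c1 (t0 + \<sigma> * t))) * T"
        using tangent[OF i(1) c(1), of "t0 + \<sigma> * t"] by (simp add: T_def z_def C_def)
      then obtain \<rho> :: real where \<rho>: "C1 \<sigma> t = of_real \<rho> * T"
        by (metis C1_def of_real_mult scaleR_conv_of_real mult.assoc)
      \<comment> \<open>The tangent vector of the possibly reversed curve is a real multiple of T,
        so the boundary relation turns the product into - \<rho> \<phi> |S|^2.\<close>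
      have "\<i> * (S z * Lk 0 z) * C1 \<sigma> t = - of_real \<rho> * S z * (- \<i> * T * Lk 0 z)" by (simp add: \<rho>)
      also have "\<dots> = - of_real (\<rho> * \<phi> z) * (S z * cnj (S z))"
        unfolding T_def relation[OF C_frontier[of \<sigma> t, folded z_def], symmetric] by simp
      finally show "Im (\<i> * (Sk 0 (C \<sigma> t) * Lk 0 (C \<sigma> t)) * C1 \<sigma> t) = 0"
        unfolding Sk(1) z_def[symmetric] by (simp add: complex_mult_cnj)
    qed (use \<phi>_cont assms(5) z0 \<epsilon> in auto)
  qed
  show "((\<lambda>z. norm (weighted_ahlfors S L z)) \<longlongrightarrow> 1 / \<phi> z\<^sub>0) (at z\<^sub>0 within \<Omega>)"
  proof (rule tendstoI)
    fix \<epsilon> :: real assume \<epsilon>: "\<epsilon> > 0"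
    obtain s1 where s1: "s1 > 0" "\<And>z. norm z < s1 \<Longrightarrow> Im z > 0 \<Longrightarrow> \<Phi> 1 z \<in> \<Omega> \<Longrightarrow>
        \<bar>norm (weighted_ahlfors S L (\<Phi> 1 z)) - 1 / \<phi> z\<^sub>0\<bar> < \<epsilon>" using side[of 1, OF _ \<epsilon>] by blast
    obtain s2 where s2: "s2 > 0" "\<And>z. norm z < s2 \<Longrightarrow> Im z > 0 \<Longrightarrow> \<Phi> (-1) z \<in> \<Omega> \<Longrightarrow>
        \<bar>norm (weighted_ahlfors S L (\<Phi> (-1) z)) - 1 / \<phi> z\<^sub>0\<bar> < \<epsilon>" using side[of "-1", OF _ \<epsilon>] by blast
    have "C1 1 0 \<noteq> 0" using c1_nz by (simp add: C1_def)
    then obtain q where q: "q > 0" "ball z\<^sub>0 q \<subseteq> \<Phi> 1 ` ball 0 (min s1 s2)"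
      using normal_chart_nhd[OF C(1) C(2), of 1 "min s1 s2"] s1(1) s2(1) unfolding \<Phi>_def C_0 by auto
    have "dist (norm (weighted_ahlfors S L z)) (1 / \<phi> z\<^sub>0) < \<epsilon>" if z: "z \<in> \<Omega>" "dist z z\<^sub>0 < q" for z
    proof -
      obtain x where x: "norm x < s1" "norm x < s2" "z = \<Phi> 1 x" using q(2) z(2) by (force simp: dist_commute)
      \<comment> \<open>Real x would give a frontier point. So x or - x lies in the upper half disc,
        which decides between the two charts.\<close>
      have "Im x \<noteq> 0"
      proof
        assume "Im x = 0"
        then have "z = C 1 (Re x)" by (simp add: x(3) \<Phi>_def normal_chart_def)
        then show False using C_frontier[of 1 "Re x"] z(1) disj by auto
      qed
      then consider "Im x > 0" | "Im (- x) > 0" by fastforce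
      then show ?thesis
      proof cases
        case 1 then show ?thesis using s1(2)[of x] x z(1) by (simp add: dist_real_def)
      next
        case 2 then show ?thesis using s2(2)[of "- x"] x z(1) flip[of "- x"] by (simp add: dist_real_def)
      qed
    qed
    then show "\<forall>\<^sub>F z in at z\<^sub>0 within \<Omega>. dist (norm (weighted_ahlfors S L z)) (1 / \<phi> z\<^sub>0) < \<epsilon>"
      using q(1) unfolding eventually_at by blast
  qed
qed

end
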